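(* Let $C,D\subseteq \mathbb{R}^d$ be polyhedral cones. Then, for $Q\in O(d)$ uniformly at random and every integer $k>0$, $$\mathbb{E}[v_k(C\cap QD)] = v_{k+d}(C\times D), \qquad \mathbb{E}[v_0(C\cap QD)] = \sum_{j=0}^d v_j(C\times D).$$ If $D=L$ is a linear subspace of dimension $d-m$, then, for every integer $k>0$, $$\mathbb{E}[v_k(C\cap QL)] = v_{k+m}(C), \qquad \mathbb{E}[v_0(C\cap QL)] = \sum_{j=0}^m v_j(C).$$
   Context: A polyhedral cone $C\subseteq\mathbb{R}^d$ is a finite intersection of closed half-spaces bounded by linear hyperplanes (so $\mathbb{R}^d$ and linear subspaces are included). A face of $C$ is either $C$ itself or a set $C\cap H$ with $H$ a linear hyperplane such that $C$ lies in one of the two closed half-spaces of $H$. $\dim F$ is the dimension of the linear span of $F$, $\operatorname{relint}(F)$ is the interior of $F$ in its linear span, and $\mathcal{F}_k(C)$ is the set of $k$-dimensional faces of $C$. Intrinsic volumes: for a polyhedral cone $C\subseteq\mathbb{R}^N$ let $\Pi_C$ be the Euclidean nearest-point projection onto $C$ and $g$ a standard Gaussian vector in $\mathbb{R}^N$. The $k$-th intrinsic volume of $C$ is $v_k(C)=\sum_{F\in\mathcal{F}_k(C)}\mathbb{P}\{\Pi_C(g)\in\operatorname{relint}(F)\}$ (it is $0$ for $k>N$). The product $C\times D$ is a polyhedral cone in $\mathbb{R}^{2d}$. "$Q\in O(d)$ uniformly at random" means that $Q$ is distributed according to the Haar probability measure on the orthogonal group $O(d)$. Part of the claim is that $Q\mapsto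 v_k(C\cap QD)$ is integrable, so that the expectations make sense. *)

theory Defs
  imports "HOL-Probability.Probability"
begin

definition polyhedral_cone :: "'a::euclidean_space set \<Rightarrow> bool" where
  "polyhedral_cone C \<longleftrightarrow>
     (\<exists>\<H>. finite \<H> \<and> C = \<Inter>\<H> \<and> (\<forall>h\<in>\<H>. \<exists>a. a \<noteq> 0 \<and> h = {x. a \<bullet> x \<le> 0}))"

(* Both vectors a and -a define the same hyperplane, so fixing the sign in
   the half-space condition loses nothing.  The library's face_of is not used:
   it also admits the empty set as a face. *)
definition cone_faces :: "'a::euclidean_space set \<Rightarrow> 'a set set" where
  "cone_faces C = {F. F = C \<or>
     (\<exists>a. a \<noteq> 0 \<and> C \<subseteq> {x. a \<bullet> x \<le> 0} \<and> F = C \<inter> {x. a \<bullet> x = 0})}"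

definition cone_faces_dim :: "nat \<Rightarrow> 'a::euclidean_space set \<Rightarrow> 'a set set" where
  "cone_faces_dim k C = {F \<in> cone_faces C. dim F = k}"

(* rel_interior is taken in the affine hull, which for faces of cones is the linear span. *)
lemma affine_hull_cone_face:
  assumes "polyhedral_cone C" "F \<in> cone_faces C"
  shows "affine hull F = span F"
proof -
  have "0 \<in> C"
    using assms(1) by (auto simp: polyhedral_cone_def)
  then have "0 \<in> F"
    using assms(2) by (auto simp: cone_faces_def)
  then show ?thesis
    by (simp add: affine_hull_span_0 hull_inc)
qed

definition std_gaussian :: "'a::euclidean_space measure" where
  "std_gaussian = density lborel (\<lambda>x. ennreal (\<Prod>b\<in>Basis. std_normal_density (x \<bullet> b)))"

definition intrinsic_volume :: "nat \<Rightarrow> 'a::euclidean_space set \<Rightarrow> real" where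
  "intrinsic_volume k C =
     (\<Sum>F\<in>cone_faces_dim k C. measure std_gaussian {g. closest_point C g \<in> rel_interior F})"

definition orthogonal_group :: "(real^'n^'n) set" where
  "orthogonal_group = {Q. orthogonal_matrix Q}"

(* The orthogonal group is compact, so exactly one such measure exists, and
   left invariance already implies right invariance. *)
definition haar_prob_orthogonal :: "(real^'n^'n) measure \<Rightarrow> bool" where
  "haar_prob_orthogonal \<mu> \<longleftrightarrow>
     prob_space \<mu> \<and>
     sets \<mu> = sets (restrict_space borel orthogonal_group) \<and>
     (\<forall>U\<in>orthogonal_group. distr \<mu> \<mu> (\<lambda>Q. U ** Q) = \<mu>)"

end

(* Stratify C, D by their sets of active constraints. The nearest point of C \<inter> QD to g lies over the strata
   C_S and D_T exactly when g = x + u + Qv with x in C_S and Q^T x in D_T, and with u and v in the normal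
   cones of C at S and of D at T. If L and L' are the spans of C_S and D_T and dim L + dim L' > d, then almost
   surely L and QL' are transversal and every g has exactly one decomposition g = x + u + Qv with
   x in L \<inter> QL', u orthogonal to L and v orthogonal to L'. The law of the directions of
   (x, u, Q^T x, v) is invariant under reflections in L, its complement, L' and its complement, and these act
   transitively on products of unit spheres. Such a law is unique, so it agrees with the law of the
   directions of the projections of two independent Gaussian vectors. Hence the stratum pair (S, T) has the
   same probability for C \<inter> QD as for C \<times> D. Summing over pairs gives the case k > 0; the case k = 0
   follows since the intrinsic volumes sum to 1. *)
theory Submission
  imports Defs
begin

section \<open>Strata and projections of polyhedral cones\<close>

text \<open>Only directions can be compared: \<open>x\<close> and \<open>transpose Q *v x\<close>
  have equal length, whereas the projections of two independent Gaussian vectors have independent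
  lengths. Nothing is lost, because strata and the cones generated by constraints are invariant
  under positive scaling. The symmetry acts on \<open>Q\<close> and \<open>g\<close> together:
  \<open>g\<close> is moved to \<open>U *v g\<close> and \<open>Q\<close> to
  \<open>U ** Q ** W\<close>, where \<open>U\<close> and \<open>W\<close> are products of two
  reflections. Two-sided invariance of the Haar measure and rotation invariance of the Gaussian
  measure then replace any computation of Jacobians. When the dimensions add up to at most
  \<open>d\<close>, the spans generically meet only in \<open>0\<close> and \<open>x\<close> has no
  direction; this is the obstacle that leaves \<open>k = 0\<close> to a subtraction. Measurability
  is a separate concern, since the events are defined by the existence of a decomposition. They are
  projections of closed sets intersected with open sets, hence countable unions of compact
  sets.\<close>

lemma sets_std_gaussian [simp, measurable_cong]: "sets std_gaussian = sets borel"
  by (simp add: std_gaussian_def)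

lemma space_std_gaussian [simp]: "space std_gaussian = UNIV"
  by (simp add: std_gaussian_def)

lemma prob_space_std_gaussian: "prob_space (std_gaussian :: 'a::euclidean_space measure)"
proof
  have "emeasure std_gaussian (space (std_gaussian :: 'a measure)) =
      (\<integral>\<^sup>+x. ennreal (\<Prod>b\<in>Basis. std_normal_density (x \<bullet> b)) \<partial>(lborel :: 'a measure))"
    by (simp add: std_gaussian_def emeasure_density)
  also have "\<dots> = (\<integral>\<^sup>+x. (\<Prod>b\<in>Basis. ennreal (std_normal_density (x \<bullet> b))) \<partial>(lborel :: 'a measure))"
    by (simp add: prod_ennreal)
  also have "\<dots> = (\<Prod>b\<in>(Basis :: 'a set). \<integral>\<^sup>+x. ennreal (std_normal_density x) \<partial>lborel)"
    by (rule nn_integral_lborel_prod) auto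
  also have "(\<integral>\<^sup>+x. ennreal (std_normal_density x) \<partial>lborel) = 1"
    using prob_space.emeasure_space_1[OF prob_space_normal_density[of 1 0]]
    by (simp add: emeasure_density)
  finally show "emeasure std_gaussian (space (std_gaussian :: 'a measure)) = 1" by simp
qed

interpretation std_gaussian: prob_space "std_gaussian :: 'a::euclidean_space measure"
  by (rule prob_space_std_gaussian)

section \<open>Polyhedral cones given by finite sets of normals, and their faces\<close>

definition polar_cone :: "'a::euclidean_space set \<Rightarrow> 'a set" where
  "polar_cone H = {x. \<forall>a\<in>H. a \<bullet> x \<le> 0}"

definition active :: "'a::euclidean_space set \<Rightarrow> 'a \<Rightarrow> 'a set" where
  "active H x = {a\<in>H. a \<bullet> x = 0}"

lemma active_subset: "active H x \<subseteq> H"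
  by (auto simp: active_def)

lemma mem_orthogonal_comp: "x \<in> S\<^sup>\<bottom> \<longleftrightarrow> (\<forall>a\<in>S. a \<bullet> x = 0)"
  by (auto simp: orthogonal_comp_def orthogonal_def)

text \<open>Passing to a set of normals, with \<open>0\<close> allowed among them, lets
  intersections, rotations and products of cones act directly on the constraint sets.\<close>

lemma polyhedral_cone_imp_polar_cone:
  assumes "polyhedral_cone C"
  obtains H where "finite H" "C = polar_cone H"
proof -
  obtain \<H> where \<H>: "finite \<H>" "C = \<Inter>\<H>" "\<forall>h\<in>\<H>. \<exists>a. a \<noteq> 0 \<and> h = {x. a \<bullet> x \<le> 0}"
    using assms unfolding polyhedral_cone_def by blast
  then obtain f where f: "\<And>h. h \<in> \<H> \<Longrightarrow> h = {x. f h \<bullet> x \<le> 0}" by metis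
  have "C = polar_cone (f ` \<H>)"
    unfolding polar_cone_def using \<H>(2) f by auto
  with \<H>(1) that show ?thesis by blast
qed

lemma zero_in_polar_cone [simp]: "0 \<in> polar_cone H"
  by (simp add: polar_cone_def)

lemma polar_cone_eq_INT: "polar_cone H = (\<Inter>a\<in>H. {x. a \<bullet> x \<le> 0})"
  by (auto simp: polar_cone_def)

lemma closed_polar_cone: "closed (polar_cone H)"
  unfolding polar_cone_eq_INT by (intro closed_INT ballI closed_halfspace_le)

lemma convex_polar_cone: "convex (polar_cone H)"
  unfolding polar_cone_eq_INT by (intro convex_INT convex_halfspace_le)

lemma polyhedron_polar_cone: "finite H \<Longrightarrow> polyhedron (polar_cone H)"
  unfolding polar_cone_eq_INT by (intro polyhedron_Inter) (auto intro: polyhedron_halfspace_le)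

lemma closest_point_polar_cone: "closest_point (polar_cone H) g \<in> polar_cone H"
  by (rule closest_point_in_set[OF closed_polar_cone]) (use zero_in_polar_cone in blast)

text \<open>The inactive constraints are strict at \<open>x\<close> and finite in number, so they
  persist on a ball; locally only the active ones cut out the cone.\<close>

lemma neighbourhood_in_polar_cone:
  assumes "finite H" "x \<in> polar_cone H"
  obtains e where "e > 0"
    "\<And>y. y \<in> ball x e \<Longrightarrow> (\<And>a. a \<in> active H x \<Longrightarrow> a \<bullet> y \<le> 0) \<Longrightarrow> y \<in> polar_cone H"
proof -
  let ?T = "\<Inter>a\<in>H - active H x. {y. a \<bullet> y < 0}"
  have "open ?T"
    using assms(1) by (intro open_INT ballI open_halfspace_lt) auto
  moreover have "x \<in> ?T"
    using assms(2) by (auto simp: polar_cone_def active_def less_le)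
  ultimately obtain e where e: "e > 0" "ball x e \<subseteq> ?T"
    by (meson openE)
  show ?thesis
  proof (rule that[OF e(1)])
    fix y assume y: "y \<in> ball x e" "\<And>a. a \<in> active H x \<Longrightarrow> a \<bullet> y \<le> 0"
    have "a \<bullet> y \<le> 0" if "a \<in> H" for a
      using e(2) y that by (cases "a \<in> active H x") (auto simp: less_imp_le)
    then show "y \<in> polar_cone H" by (simp add: polar_cone_def)
  qed
qed

lemma active_direction_in_polar_cone:
  assumes "finite H" "x \<in> polar_cone H" "\<And>a. a \<in> active H x \<Longrightarrow> a \<bullet> z \<le> 0"
  obtains t where "t > 0" "x + t *\<^sub>R z \<in> polar_cone H"
proof -
  obtain e where e: "e > 0"
    "\<And>y. y \<in> ball x e \<Longrightarrow> (\<And>a. a \<in> active H x \<Longrightarrow> a \<bullet> y \<le> 0) \<Longrightarrow> y \<in> polar_cone H"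
    using neighbourhood_in_polar_cone[OF assms(1,2)] by metis
  \<comment> \<open>The summand \<open>1\<close> covers \<open>z = 0\<close>; the step is shorter
    than \<open>e\<close> and so stays in the ball where only active constraints count.\<close>
  define t where "t = e / (2 * (norm z + 1))"
  have n: "norm z + 1 > 0" by (rule add_nonneg_pos) auto
  have t: "t > 0" using e(1) n by (simp add: t_def)
  have "t * norm z < t * (2 * (norm z + 1))"
    using t n by (intro mult_strict_left_mono) auto
  also have "\<dots> = e" using n by (simp add: t_def)
  finally have "x + t *\<^sub>R z \<in> ball x e" using t by (simp add: dist_norm)
  moreover have "a \<bullet> (x + t *\<^sub>R z) \<le> 0" if "a \<in> active H x" for a
  proof -
    have "a \<bullet> x = 0" using that by (simp add: active_def)
    then show ?thesis
      using assms(3)[OF that] t by (simp add: inner_add_right mult_le_0_iff)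
  qed
  ultimately show ?thesis using e(2) t that by blast
qed

lemma cone_face_imp_face_of:
  assumes "F \<in> cone_faces C" "convex C"
  shows "F face_of C"
  using assms face_of_Int_supporting_hyperplane_le[OF assms(2)]
  by (auto simp: cone_faces_def face_of_refl)

lemma finite_cone_faces:
  assumes "finite H"
  shows "finite (cone_faces (polar_cone H))"
  by (rule finite_subset[OF _ finite_polyhedron_faces[OF polyhedron_polar_cone[OF assms]]])
     (auto intro: cone_face_imp_face_of convex_polar_cone)

text \<open>The sum of the active normals is a supporting functional: on the cone it is a sum of
  nonpositive terms, so it vanishes exactly where every active constraint does.\<close>

lemma minimal_face_in_cone_faces:
  assumes "finite H"
  shows "polar_cone H \<inter> (active H x)\<^sup>\<bottom> \<in> cone_faces (polar_cone H)"
proof -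
  let ?b = "\<Sum>a\<in>active H x. a"
  have fin: "finite (active H x)" using assms active_subset finite_subset by blast
  have le: "a \<bullet> y \<le> 0" if "y \<in> polar_cone H" "a \<in> active H x" for a y
    using that by (auto simp: polar_cone_def active_def)
  have eq: "polar_cone H \<inter> (active H x)\<^sup>\<bottom> = polar_cone H \<inter> {y. ?b \<bullet> y = 0}"
  proof -
    have "y \<in> (active H x)\<^sup>\<bottom> \<longleftrightarrow> ?b \<bullet> y = 0" if "y \<in> polar_cone H" for y
    proof -
      have "(\<Sum>a\<in>active H x. - (a \<bullet> y)) = 0 \<longleftrightarrow> (\<forall>a\<in>active H x. - (a \<bullet> y) = 0)"
        using le[OF that] by (intro sum_nonneg_eq_0_iff fin) auto
      then show ?thesis by (simp add: mem_orthogonal_comp inner_sum_left sum_negf)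
    qed
    then show ?thesis by blast
  qed
  have "polar_cone H \<subseteq> {y. ?b \<bullet> y \<le> 0}"
    using le by (auto simp: inner_sum_left intro!: sum_nonpos)
  \<comment> \<open>When the active normals cancel, this face is the whole cone, which
    \<open>cone_faces\<close> admits separately.\<close>
  then show ?thesis
    unfolding eq cone_faces_def by (cases "?b = 0") auto
qed

text \<open>On the affine hull of the minimal face the active constraints are equalities, so near
  \<open>x\<close> only strict ones remain and a relative ball lies in the face.\<close>

lemma minimal_face_rel_interior:
  assumes "finite H" "x \<in> polar_cone H"
  shows "x \<in> rel_interior (polar_cone H \<inter> (active H x)\<^sup>\<bottom>)"
proof -
  obtain e where e: "e > 0"
    "\<And>y. y \<in> ball x e \<Longrightarrow> (\<And>a. a \<in> active H x \<Longrightarrow> a \<bullet> y \<le> 0) \<Longrightarrow> y \<in> polar_cone H"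
    using neighbourhood_in_polar_cone[OF assms] by metis
  let ?F = "polar_cone H \<inter> (active H x)\<^sup>\<bottom>"
  have "affine hull ?F \<subseteq> (active H x)\<^sup>\<bottom>"
    by (rule hull_minimal) (auto intro: subspace_imp_affine subspace_orthogonal_comp)
  then have "ball x e \<inter> affine hull ?F \<subseteq> ?F"
    using e(2) by (auto simp: mem_orthogonal_comp)
  moreover have "x \<in> ?F"
    using assms(2) by (auto simp: mem_orthogonal_comp active_def)
  ultimately show ?thesis using e(1) by (auto simp: mem_rel_interior_ball)
qed

text \<open>From \<open>x\<close> a short step in any direction of
  \<open>(active H x)\<^sup>\<bottom>\<close> stays in the face, hence the face spans that
  subspace.\<close>

lemma dim_minimal_face:
  assumes "finite H" "x \<in> polar_cone H"
  shows "dim (polar_cone H \<inter> (active H x)\<^sup>\<bottom>) = dim ((active H x)\<^sup>\<bottom>)"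
proof (rule antisym)
  let ?F = "polar_cone H \<inter> (active H x)\<^sup>\<bottom>"
  show "dim ?F \<le> dim ((active H x)\<^sup>\<bottom>)" by (rule dim_subset) auto
  have xF: "x \<in> ?F"
    using assms(2) by (auto simp: mem_orthogonal_comp active_def)
  have "y \<in> span ?F" if y: "y \<in> (active H x)\<^sup>\<bottom>" for y
  proof -
    have "a \<bullet> y \<le> 0" if "a \<in> active H x" for a
      using y that by (auto simp: mem_orthogonal_comp)
    then obtain t where t: "t > 0" "x + t *\<^sub>R y \<in> polar_cone H"
      using active_direction_in_polar_cone[OF assms] by metis
    have "x + t *\<^sub>R y \<in> (active H x)\<^sup>\<bottom>"
      using xF y by (auto intro: subspace_add subspace_scale subspace_orthogonal_comp)
    with t have "x + t *\<^sub>R y \<in> span ?F" by (auto intro: span_base)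
    then have "(x + t *\<^sub>R y) - x \<in> span ?F"
      using xF span_base span_diff by blast
    then have "t *\<^sub>R y \<in> span ?F" by simp
    then have "(1 / t) *\<^sub>R (t *\<^sub>R y) \<in> span ?F"
      by (rule span_scale)
    then show ?thesis using t by simp
  qed
  then show "dim ((active H x)\<^sup>\<bottom>) \<le> dim ?F"
    by (metis dim_span dim_subset subsetI)
qed

text \<open>Faces whose relative interiors meet coincide, so the active constraints at
  \<open>x\<close> determine the one face that has \<open>x\<close> in its relative
  interior.\<close>

lemma cone_face_rel_interior_iff:
  assumes "finite H" "x \<in> polar_cone H" "F \<in> cone_faces (polar_cone H)"
  shows "x \<in> rel_interior F \<longleftrightarrow> F = polar_cone H \<inter> (active H x)\<^sup>\<bottom>"
proof
  assume "x \<in> rel_interior F"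
  then show "F = polar_cone H \<inter> (active H x)\<^sup>\<bottom>"
    using minimal_face_rel_interior[OF assms(1,2)] minimal_face_in_cone_faces[OF assms(1), of x]
      assms(3) cone_face_imp_face_of convex_polar_cone face_of_eq by blast
qed (use minimal_face_rel_interior[OF assms(1,2)] in blast)

lemma borel_rel_interior: "rel_interior (S :: 'a::euclidean_space set) \<in> sets borel"
proof -
  obtain T where "open T" "rel_interior S = affine hull S \<inter> T"
    using openin_rel_interior[of S] openin_open by blast
  moreover have "closed (affine hull S)" by simp
  ultimately show ?thesis
    by (metis borel_open borel_closed sets.Int)
qed

lemma measurable_closest_point_polar_cone [measurable]:
  "closest_point (polar_cone H) \<in> borel_measurable borel"
  by (intro borel_measurable_continuous_onI continuous_on_closest_point
      convex_polar_cone closed_polar_cone) (use zero_in_polar_cone in blast)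

text \<open>The relative interiors of the faces partition the cone, and the cell of a point can be
  read off from its active constraints. From here on intrinsic volumes are Gaussian probabilities of
  active sets.\<close>

theorem intrinsic_volume_polar_cone:
  fixes H :: "'a::euclidean_space set"
  assumes "finite H"
  shows "intrinsic_volume k (polar_cone H) =
    measure std_gaussian {g. dim ((active H (closest_point (polar_cone H) g))\<^sup>\<bottom>) = k}"
proof -
  let ?C = "polar_cone H"
  let ?A = "\<lambda>F. {g. closest_point ?C g \<in> rel_interior F}"
  have "intrinsic_volume k ?C = measure std_gaussian (\<Union>F\<in>cone_faces_dim k ?C. ?A F)"
    unfolding intrinsic_volume_def
  proof (rule std_gaussian.finite_measure_finite_Union[symmetric])
    show "finite (cone_faces_dim k ?C)"
      using finite_cone_faces[OF assms] by (simp add: cone_faces_dim_def)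
    have "?A F \<in> sets borel" for F
    proof -
      have "closest_point ?C -` rel_interior F \<inter> space borel \<in> sets borel"
        by (rule measurable_sets[OF measurable_closest_point_polar_cone borel_rel_interior])
      then show ?thesis by (simp add: vimage_def)
    qed
    then show "?A ` cone_faces_dim k ?C \<subseteq> sets std_gaussian" by auto
    show "disjoint_family_on ?A (cone_faces_dim k ?C)"
      unfolding disjoint_family_on_def cone_faces_dim_def
      using cone_face_rel_interior_iff[OF assms closest_point_polar_cone] by auto
  qed
  also have "(\<Union>F\<in>cone_faces_dim k ?C. ?A F) = {g. dim ((active H (closest_point ?C g))\<^sup>\<bottom>) = k}"
    unfolding cone_faces_dim_def
    using cone_face_rel_interior_iff[OF assms closest_point_polar_cone]
      minimal_face_in_cone_faces[OF assms] minimal_face_rel_interior[OF assms closest_point_polar_cone]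
      dim_minimal_face[OF assms closest_point_polar_cone]
    by auto
  finally show ?thesis .
qed

section \<open>Farkas' lemma and the normal cone at the nearest point\<close>

lemma farkas:
  fixes S :: "'a::euclidean_space set"
  assumes "finite S" "\<And>z. (\<And>a. a \<in> S \<Longrightarrow> a \<bullet> z \<le> 0) \<Longrightarrow> w \<bullet> z \<le> 0"
  shows "w \<in> convex_cone hull S"
proof (rule ccontr)
  assume w: "w \<notin> convex_cone hull S"
  obtain z b where zb: "z \<bullet> w < b" "\<forall>x\<in>convex_cone hull S. z \<bullet> x > b"
    using separating_hyperplane_closed_point[OF convex_convex_cone_hull closed_convex_cone_hull[OF assms(1)] w]
    by blast
  have b: "b < 0" using zb(2) convex_cone_hull_contains_0 by force
  have "z \<bullet> a \<ge> 0" if "a \<in> S" for a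
  proof (rule ccontr)
    assume "\<not> z \<bullet> a \<ge> 0"
    then have neg: "z \<bullet> a < 0" by simp
    \<comment> \<open>This multiple of \<open>a\<close> is scaled so that the functional takes the
      value \<open>b\<close> on it, which strict separation forbids.\<close>
    have "(b / (z \<bullet> a)) *\<^sub>R a \<in> convex_cone hull S"
      using neg b that by (intro convex_cone_hull_mul hull_inc divide_nonpos_neg) auto
    then have "z \<bullet> ((b / (z \<bullet> a)) *\<^sub>R a) > b" using zb(2) by blast
    then show False using neg by simp
  qed
  then have "w \<bullet> (- z) \<le> 0"
    by (intro assms(2)) (simp add: inner_commute)
  then show False using zb(1) b by (simp add: inner_commute)
qed

lemma inner_convex_cone_hull_le:
  assumes "w \<in> convex_cone hull S" "\<And>a. a \<in> S \<Longrightarrow> a \<bullet> z \<le> 0"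
  shows "w \<bullet> z \<le> 0"
proof -
  have "convex_cone hull S \<subseteq> {x. z \<bullet> x \<le> 0}"
    using assms(2) by (intro hull_minimal convex_cone_halfspace_le) (auto simp: inner_commute)
  then show ?thesis using assms(1) by (auto simp: inner_commute)
qed

lemma convex_cone_hull_subset_span: "convex_cone hull S \<subseteq> span S"
  by (rule hull_minimal) (auto intro: span_base convex_cone_span)

text \<open>The optimality condition for the projection: the residual lies in the normal cone at
  \<open>x\<close>. The feasible directions are those allowed by the active constraints, so the
  variational inequality and \<open>farkas\<close> give one implication; an obtuse angle with every
  feasible displacement gives the other.\<close>

theorem closest_point_polar_cone_iff:
  assumes "finite H"
  shows "closest_point (polar_cone H) g = x \<longleftrightarrow>
    x \<in> polar_cone H \<and> g - x \<in> convex_cone hull (active H x)"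
proof
  assume x: "closest_point (polar_cone H) g = x"
  have xC: "x \<in> polar_cone H" using x closest_point_polar_cone by blast
  moreover have "g - x \<in> convex_cone hull (active H x)"
  proof (rule farkas)
    show "finite (active H x)" using assms active_subset finite_subset by blast
    fix z assume z: "\<And>a. a \<in> active H x \<Longrightarrow> a \<bullet> z \<le> 0"
    obtain t where t: "t > 0" "x + t *\<^sub>R z \<in> polar_cone H"
      using active_direction_in_polar_cone[OF assms xC z] by metis
    have "(g - x) \<bullet> (x + t *\<^sub>R z - x) \<le> 0"
      using closest_point_dot[OF convex_polar_cone closed_polar_cone t(2), of g] x by simp
    then show "(g - x) \<bullet> z \<le> 0" using t(1) by (simp add: mult_le_0_iff)
  qed
  ultimately show "x \<in> polar_cone H \<and> g - x \<in> convex_cone hull (active H x)" by simp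
next
  assume x: "x \<in> polar_cone H \<and> g - x \<in> convex_cone hull (active H x)"
  have "dist g x \<le> dist g y" if "y \<in> polar_cone H" for y
  proof -
    have "(g - x) \<bullet> (y - x) \<le> 0"
    proof (rule inner_convex_cone_hull_le)
      show "g - x \<in> convex_cone hull (active H x)" using x by simp
      show "a \<bullet> (y - x) \<le> 0" if "a \<in> active H x" for a
        using that \<open>y \<in> polar_cone H\<close> by (auto simp: active_def polar_cone_def inner_diff_right)
    qed
    then have "norm (g - x) ^ 2 \<le> norm (g - y) ^ 2"
      using inner_ge_zero[of "y - x"]
      by (simp add: power2_norm_eq_inner inner_diff_left inner_diff_right inner_commute)
    then show ?thesis by (simp add: dist_norm)
  qed
  then show "closest_point (polar_cone H) g = x"
    using closest_point_unique[OF convex_polar_cone closed_polar_cone] x by metis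
qed

section \<open>Gaussian measure and uniqueness of uniformly distributed measures\<close>

text \<open>Projections of Borel sets need not be Borel, but a closed set is a countable union of
  compact sets, whose images are compact. Sets defined below by an existential quantifier become
  Borel in this way.\<close>

lemma borel_fst_image_closed:
  fixes G :: "('a::euclidean_space \<times> 'b::euclidean_space) set"
  assumes "closed G"
  shows "fst ` G \<in> sets borel"
proof -
  have G: "G = (\<Union>n::nat. G \<inter> cball 0 (real n))"
    by (auto simp: real_arch_simple)
  have "compact (fst ` (G \<inter> cball 0 (real n)))" for n
    by (intro compact_continuous_image continuous_on_fst continuous_on_id closed_Int_compact assms) auto
  then have "fst ` (G \<inter> cball 0 (real n)) \<in> sets borel" for n
    by (simp add: borel_compact)
  then have "(\<Union>n::nat. fst ` (G \<inter> cball 0 (real n))) \<in> sets borel"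
    by blast
  moreover have "fst ` G = (\<Union>n::nat. fst ` (G \<inter> cball 0 (real n)))"
    by (subst G) blast
  ultimately show ?thesis by simp
qed

lemma borel_fst_image_closed_Int_open:
  fixes G :: "('a::euclidean_space \<times> 'b::euclidean_space) set"
  assumes "closed G" "open U"
  shows "fst ` (G \<inter> U) \<in> sets borel"
proof -
  obtain \<D> where \<D>: "countable \<D>" "\<And>X. X \<in> \<D> \<Longrightarrow> \<exists>a b. X = cbox a b" "\<Union>\<D> = U"
    using open_countable_Union_open_cbox[OF assms(2)] by metis
  have "fst ` (G \<inter> U) = (\<Union>X\<in>\<D>. fst ` (G \<inter> X))"
    using \<D>(3) by blast
  moreover have "fst ` (G \<inter> X) \<in> sets borel" if "X \<in> \<D>" for X
    using \<D>(2)[OF that] assms(1) by (intro borel_fst_image_closed closed_Int) auto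
  ultimately show ?thesis using \<D>(1) by auto
qed

section \<open>Measures determined by the masses of balls\<close>

lemma measure_eqI_compact:
  fixes \<mu> \<nu> :: "'a::euclidean_space measure"
  assumes "sets \<mu> = sets borel" "sets \<nu> = sets borel"
    and eq: "\<And>F. compact F \<Longrightarrow> emeasure \<mu> F = emeasure \<nu> F"
    and fin: "\<And>F. compact F \<Longrightarrow> emeasure \<mu> F < \<infinity>"
  shows "\<mu> = \<nu>"
proof -
  have "sigma_sets UNIV (Collect closed) = sigma_sets UNIV (Collect (compact :: 'a set \<Rightarrow> bool))"
  proof (rule sigma_sets_eqI)
    fix A :: "'a set" assume "A \<in> Collect closed"
    moreover have "A = (\<Union>n::nat. A \<inter> cball 0 (real n))"
      by (auto simp: real_arch_simple)
    moreover have "(\<Union>n::nat. A \<inter> cball 0 (real n)) \<in> sigma_sets UNIV (Collect compact)"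
      if "closed A"
      using that by (intro sigma_sets.Union sigma_sets.Basic) auto
    ultimately show "A \<in> sigma_sets UNIV (Collect compact)" by simp
  qed (auto intro: compact_imp_closed)
  then have borel: "sets borel = sigma_sets UNIV (Collect (compact :: 'a set \<Rightarrow> bool))"
    by (simp add: borel_eq_closed)
  show ?thesis
  proof (rule measure_eqI_generator_eq[where E = "Collect compact" and \<Omega> = UNIV
        and A = "\<lambda>n. cball 0 (real n)"])
    show "Int_stable (Collect (compact :: 'a set \<Rightarrow> bool))"
      by (auto simp: Int_stable_def)
    show "emeasure \<mu> (cball 0 (real n)) \<noteq> \<infinity>" for n
      using fin[of "cball 0 (real n)"] by auto
  qed (use assms borel in \<open>auto simp: real_arch_simple\<close>)
qed

text \<open>Christensen's argument: integrating the kernel \<open>dist x y < r\<close> against both measures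
  compares \<open>\<nu> F\<close> with \<open>\<mu>\<close> of the closed \<open>r\<close>-neighbourhood of \<open>F\<close>.\<close>

lemma emeasure_compact_le_of_equal_balls:
  fixes \<mu> \<nu> :: "'a::euclidean_space measure"
  assumes [measurable_cong]: "sets \<mu> = sets borel" "sets \<nu> = sets borel"
    and "sigma_finite_measure \<mu>" "sigma_finite_measure \<nu>"
    and K: "AE x in \<mu>. x \<in> K" "AE x in \<nu>. x \<in> K"
    and eq: "\<And>r x y. 0 < r \<Longrightarrow> x \<in> K \<Longrightarrow> y \<in> K \<Longrightarrow> emeasure \<mu> (ball x r) = emeasure \<nu> (ball y r)"
    and pos: "\<And>r. 0 < r \<Longrightarrow> \<exists>x\<in>K. 0 < emeasure \<mu> (ball x r)"
    and fin: "\<And>F. compact F \<Longrightarrow> emeasure \<mu> F < \<infinity>"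
    and F: "compact F"
  shows "emeasure \<nu> F \<le> emeasure \<mu> F"
proof (cases "F = {}")
  case False
  interpret \<mu>: sigma_finite_measure \<mu> by fact
  interpret \<nu>: sigma_finite_measure \<nu> by fact
  interpret pair_sigma_finite \<mu> \<nu> ..
  define F' where "F' r = {y. infdist y F \<le> r}" for r
  have cF': "compact (F' r)" if "0 < r" for r
    unfolding F'_def using F False that by (intro compact_infdist_le) auto
  have F'_meas: "F' r \<in> sets borel" for r
    unfolding F'_def
    by (intro borel_closed closed_Collect_le continuous_on_infdist continuous_on_id continuous_on_const)
  have F_meas[measurable]: "F \<in> sets borel"
    using F by (rule borel_compact)
  note F'_meas[measurable]
  have le: "emeasure \<nu> F \<le> emeasure \<mu> (F' r)" if r: "0 < r" for r
  proof -
    obtain x0 where x0: "x0 \<in> K" "0 < emeasure \<mu> (ball x0 r)" using pos[OF r] by blast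
    define h where "h = emeasure \<mu> (ball x0 r)"
    have h: "emeasure \<mu> (ball x r) = h" "emeasure \<nu> (ball x r) = h" if "x \<in> K" for x
      using eq[OF r that that] eq[OF r x0(1) that] by (auto simp: h_def)
    have "emeasure \<mu> (ball x0 r) \<le> emeasure \<mu> (cball x0 r)"
      by (intro emeasure_mono) auto
    also have "\<dots> < \<infinity>" by (rule fin) simp
    finally have hfin: "h \<noteq> \<infinity>" by (simp add: h_def)
    have ball: "indicator (ball x r) y = (indicator {p. dist (fst p) (snd p) < r} (x, y) :: ennreal)"
      "indicator (ball y r) x = (indicator {p. dist (fst p) (snd p) < r} (x, y) :: ennreal)" for x y :: 'a
      by (auto simp: indicator_def dist_commute)
    have mult: "(\<integral>\<^sup>+y. indicator (ball x r) y * c \<partial>\<mu>) = emeasure \<mu> (ball x r) * c"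
      "(\<integral>\<^sup>+y. indicator (ball x r) y * c \<partial>\<nu>) = emeasure \<nu> (ball x r) * c" for x c
    proof -
      have b: "ball x r \<in> sets \<mu>" "ball x r \<in> sets \<nu>" by (simp_all add: assms(1,2))
      show "(\<integral>\<^sup>+y. indicator (ball x r) y * c \<partial>\<mu>) = emeasure \<mu> (ball x r) * c"
        "(\<integral>\<^sup>+y. indicator (ball x r) y * c \<partial>\<nu>) = emeasure \<nu> (ball x r) * c"
        using b by (auto simp: nn_integral_multc[OF borel_measurable_indicator])
    qed
    have "h * emeasure \<nu> F = (\<integral>\<^sup>+x. h * indicator F x \<partial>\<nu>)"
      by (simp add: nn_integral_cmult_indicator)
    also have "\<dots> = (\<integral>\<^sup>+x. emeasure \<mu> (ball x r) * indicator F x \<partial>\<nu>)"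
      using K(2) by (intro nn_integral_cong_AE) (auto simp: h)
    also have "\<dots> = (\<integral>\<^sup>+x. (\<integral>\<^sup>+y. indicator (ball x r) y * indicator F x \<partial>\<mu>) \<partial>\<nu>)"
      by (simp only: mult)
    \<comment> \<open>If \<open>x\<close> is in \<open>F\<close> and \<open>dist x y < r\<close>,
      then \<open>y\<close> lies in \<open>F' r\<close>. Moving the indicator to \<open>y\<close>
      allows the integrals to be exchanged so that the inner one is again the mass \<open>h\<close>
      of a ball.\<close>
    also have "\<dots> \<le> (\<integral>\<^sup>+x. (\<integral>\<^sup>+y. indicator (ball y r) x * indicator (F' r) y \<partial>\<mu>) \<partial>\<nu>)"
    proof (intro nn_integral_mono)
      fix x y
      show "indicator (ball x r) y * indicator F x \<le> (indicator (ball y r) x * indicator (F' r) y :: ennreal)"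
        using infdist_le[of x F y] by (auto simp: indicator_def F'_def dist_commute)
    qed
    also have "\<dots> = (\<integral>\<^sup>+y. (\<integral>\<^sup>+x. indicator (ball y r) x * indicator (F' r) y \<partial>\<nu>) \<partial>\<mu>)"
    proof (rule Fubini')
      have "(\<lambda>(y,x). indicator {p. dist (fst p) (snd p) < r} (x, y) * indicator (F' r) y :: ennreal)
        \<in> borel_measurable (\<mu> \<Otimes>\<^sub>M \<nu>)"
        by measurable
      then show "(\<lambda>(y,x). indicator (ball y r) x * indicator (F' r) y :: ennreal)
        \<in> borel_measurable (\<mu> \<Otimes>\<^sub>M \<nu>)"
        by (simp add: ball)
    qed
    also have "\<dots> = (\<integral>\<^sup>+y. emeasure \<nu> (ball y r) * indicator (F' r) y \<partial>\<mu>)"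
      by (simp only: mult)
    also have "\<dots> = (\<integral>\<^sup>+y. h * indicator (F' r) y \<partial>\<mu>)"
      using K(1) by (intro nn_integral_cong_AE) (auto simp: h)
    also have "\<dots> = h * emeasure \<mu> (F' r)"
      by (simp add: nn_integral_cmult_indicator)
    finally show ?thesis
      using x0(2) hfin
      by (metis ennreal_mult_le_mult_iff h_def infinity_ennreal_def not_gr_zero)
  qed
  \<comment> \<open>The radius tends to \<open>0\<close>. Continuity from above applies because the
    closed neighbourhoods are compact and so have finite mass; their intersection is
    \<open>F\<close> since \<open>F\<close> is closed.\<close>
  have "emeasure \<nu> F \<le> (INF n::nat. emeasure \<mu> (F' (1 / Suc n)))"
    by (intro INF_greatest le) simp
  also have "\<dots> = emeasure \<mu> (\<Inter>n::nat. F' (1 / Suc n))"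
  proof (rule INF_emeasure_decseq)
    show "decseq (\<lambda>n. F' (1 / real (Suc n)))"
      unfolding decseq_def F'_def by (auto intro: order_trans simp: frac_le)
    show "emeasure \<mu> (F' (1 / real (Suc n))) \<noteq> \<infinity>" for n
      using fin[OF cF'] by (metis less_irrefl of_nat_0_less_iff zero_less_Suc zero_less_divide_1_iff)
  qed auto
  also have "(\<Inter>n::nat. F' (1 / Suc n)) = F"
  proof -
    have "x \<in> F" if x: "\<And>n::nat. infdist x F \<le> 1 / Suc n" for x
    proof -
      have "infdist x F \<le> 0"
      proof (rule field_le_epsilon)
        fix e :: real assume "e > 0"
        then obtain n :: nat where "1 / Suc n < e"
          using nat_approx_posE by blast
        then show "infdist x F \<le> 0 + e" using x[of n] by linarith
      qed
      then have "infdist x F = 0" using infdist_nonneg[of x F] by linarith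
      then show ?thesis
        using in_closed_iff_infdist_zero[OF compact_imp_closed[OF F] False] by blast
    qed
    moreover have "infdist x F \<le> 1 / Suc n" if "x \<in> F" for x and n :: nat
      using that by simp
    ultimately show ?thesis unfolding F'_def by blast
  qed
  finally show ?thesis .
qed simp

text \<open>By Lindeloef's theorem countably many of the balls cover \<open>K\<close>; if all were
  null, \<open>K\<close> would be null although it carries the whole mass.\<close>

lemma exists_ball_positive_measure:
  fixes \<mu> :: "'a::euclidean_space measure"
  assumes [measurable_cong]: "sets \<mu> = sets borel"
    and K: "AE x in \<mu>. x \<in> K" and "emeasure \<mu> UNIV \<noteq> 0" and r: "0 < r"
  shows "\<exists>x\<in>K. 0 < emeasure \<mu> (ball x r)"
proof (rule ccontr)
  assume "\<not> ?thesis"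
  then have z: "ball x r \<in> null_sets \<mu>" if "x \<in> K" for x
    using that by (auto simp: null_sets_def assms(1))
  obtain \<D> where \<D>: "\<D> \<subseteq> (\<lambda>x. ball x r) ` K" "countable \<D>" "\<Union>\<D> = \<Union>((\<lambda>x. ball x r) ` K)"
    using Lindelof[of "(\<lambda>x. ball x r) ` K"] by auto
  have "\<Union>\<D> \<in> null_sets \<mu>"
    using \<D>(1,2) z by (intro null_sets_UN'[where N = "\<lambda>x. x", simplified] ) auto
  then have "AE x in \<mu>. x \<notin> \<Union>\<D>" by (rule AE_not_in)
  moreover have "K \<subseteq> \<Union>\<D>" using \<D>(3) r by auto
  ultimately have "AE x in \<mu>. x \<notin> K" by (auto elim!: eventually_mono)
  with K have "AE x in \<mu>. False" by eventually_elim simp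
  then have "emeasure \<mu> (space \<mu>) = 0" by (simp add: AE_iff_null null_sets_def)
  then show False using assms(3) sets_eq_imp_space_eq[OF assms(1)] by simp
qed

text \<open>Each measure gives all balls of radius \<open>r\<close> centred in \<open>K\<close> the
  same mass; integrating the kernel \<open>dist x y < r\<close> in both orders shows that the two
  constants agree. The comparison on compact sets then applies in both directions.\<close>

theorem prob_measure_eqI_uniformly_distributed:
  fixes \<mu> \<nu> :: "'a::euclidean_space measure"
  assumes s: "sets \<mu> = sets borel" "sets \<nu> = sets borel"
    and p: "prob_space \<mu>" "prob_space \<nu>"
    and K: "AE x in \<mu>. x \<in> K" "AE x in \<nu>. x \<in> K"
    and eq: "\<And>r x y. x \<in> K \<Longrightarrow> y \<in> K \<Longrightarrow> emeasure \<mu> (ball x r) = emeasure \<mu> (ball y r)"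
      "\<And>r x y. x \<in> K \<Longrightarrow> y \<in> K \<Longrightarrow> emeasure \<nu> (ball x r) = emeasure \<nu> (ball y r)"
  shows "\<mu> = \<nu>"
proof -
  note [measurable_cong] = s
  interpret \<mu>: prob_space \<mu> by fact
  interpret \<nu>: prob_space \<nu> by fact
  interpret pair_sigma_finite \<mu> \<nu> ..
  have sp: "space \<mu> = UNIV" "space \<nu> = UNIV"
    using sets_eq_imp_space_eq[OF s(1)] sets_eq_imp_space_eq[OF s(2)] by auto
  have one: "emeasure \<mu> UNIV = 1" "emeasure \<nu> UNIV = 1"
    using \<mu>.emeasure_space_1 \<nu>.emeasure_space_1 sp by auto
  have balls: "emeasure \<mu> (ball x r) = emeasure \<nu> (ball y r)" if "x \<in> K" "y \<in> K" for x y r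
  proof -
    have "emeasure \<mu> (ball x r) = (\<integral>\<^sup>+z. emeasure \<mu> (ball x r) \<partial>\<nu>)"
      by (simp add: one sp)
    also have "\<dots> = (\<integral>\<^sup>+z. emeasure \<mu> (ball z r) \<partial>\<nu>)"
      using K(2) eq(1)[OF that(1)] by (intro nn_integral_cong_AE) auto
    also have "\<dots> = (\<integral>\<^sup>+z. (\<integral>\<^sup>+w. indicator {p. dist (fst p) (snd p) < r} (w, z) \<partial>\<mu>) \<partial>\<nu>)"
    proof (rule nn_integral_cong)
      fix z
      have "(\<integral>\<^sup>+w. indicator {p. dist (fst p) (snd p) < r} (w, z) \<partial>\<mu>) = (\<integral>\<^sup>+w. indicator (ball z r) w \<partial>\<mu>)"
        by (intro nn_integral_cong) (auto simp: indicator_def dist_commute)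
      then show "emeasure \<mu> (ball z r) = (\<integral>\<^sup>+w. indicator {p. dist (fst p) (snd p) < r} (w, z) \<partial>\<mu>)"
        by simp
    qed
    also have "\<dots> = (\<integral>\<^sup>+w. (\<integral>\<^sup>+z. indicator {p. dist (fst p) (snd p) < r} (w, z) \<partial>\<nu>) \<partial>\<mu>)"
      by (rule Fubini') measurable
    also have "\<dots> = (\<integral>\<^sup>+w. emeasure \<nu> (ball w r) \<partial>\<mu>)"
    proof (rule nn_integral_cong)
      fix w
      have "(\<integral>\<^sup>+z. indicator {p. dist (fst p) (snd p) < r} (w, z) \<partial>\<nu>) = (\<integral>\<^sup>+z. indicator (ball w r) z \<partial>\<nu>)"
        by (intro nn_integral_cong) (auto simp: indicator_def dist_commute)
      then show "(\<integral>\<^sup>+z. indicator {p. dist (fst p) (snd p) < r} (w, z) \<partial>\<nu>) = emeasure \<nu> (ball w r)"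
        by simp
    qed
    also have "\<dots> = (\<integral>\<^sup>+w. emeasure \<nu> (ball y r) \<partial>\<mu>)"
      using K(1) eq(2)[OF that(2)] by (intro nn_integral_cong_AE) auto
    also have "\<dots> = emeasure \<nu> (ball y r)" by (simp add: one sp)
    finally show ?thesis .
  qed
  have fin: "emeasure \<mu> F < \<infinity>" "emeasure \<nu> F < \<infinity>" for F
    by (simp_all add: \<mu>.emeasure_eq_measure \<nu>.emeasure_eq_measure)
  have balls': "emeasure \<nu> (ball x r) = emeasure \<mu> (ball y r)" if "x \<in> K" "y \<in> K" for x y r
    using balls[OF that(2,1)] by simp
  have pos: "\<exists>x\<in>K. 0 < emeasure \<mu> (ball x r)" "\<exists>x\<in>K. 0 < emeasure \<nu> (ball x r)" if "0 < r" for r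
    using exists_ball_positive_measure[OF s(1) K(1) _ that]
      exists_ball_positive_measure[OF s(2) K(2) _ that] one by auto
  have "emeasure \<mu> F = emeasure \<nu> F" if "compact F" for F
  proof (rule antisym)
    show "emeasure \<nu> F \<le> emeasure \<mu> F"
      by (rule emeasure_compact_le_of_equal_balls[OF s \<mu>.sigma_finite_measure_axioms
            \<nu>.sigma_finite_measure_axioms K balls pos(1) fin(1) that])
    show "emeasure \<mu> F \<le> emeasure \<nu> F"
      by (rule emeasure_compact_le_of_equal_balls[OF s(2,1) \<nu>.sigma_finite_measure_axioms
            \<mu>.sigma_finite_measure_axioms K(2,1) balls' pos(2) fin(2) that])
  qed
  then show ?thesis
    using fin by (intro measure_eqI_compact s) auto
qed

section \<open>Rotation invariance and null sets of the Gaussian measure\<close>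

text \<open>Preimages of balls are balls of the same radius, so the image measure has the ball
  masses of \<open>lborel\<close> at every centre; the comparison on compact sets with
  \<open>K = UNIV\<close> forces equality.\<close>

lemma distr_lborel_orthogonal_transformation:
  fixes T :: "'a::euclidean_space \<Rightarrow> 'a"
  assumes T: "orthogonal_transformation T"
  shows "distr lborel borel T = lborel"
proof -
  have lin: "linear T" using T by (rule orthogonal_transformation_linear)
  have [measurable]: "T \<in> borel_measurable borel"
    using lin by (simp add: linear_linear borel_measurable_continuous_onI linear_continuous_on)
  let ?\<nu> = "distr lborel borel T"
  obtain S where S: "orthogonal_transformation S" "\<And>x. S (T x) = x" "\<And>x. T (S x) = x"
    using orthogonal_transformation_inv[OF T] orthogonal_transformation_bij[OF T]
    by (metis bij_inv_eq_iff)
  have vim: "T -` A = S ` A" for A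
    using S(2,3) by (auto simp: image_iff vimage_def) metis
  have linS: "linear S" using S(1) by (rule orthogonal_transformation_linear)
  have ballv: "emeasure ?\<nu> (ball x r) = emeasure lborel (ball (S x) r)" for x r
    by (simp add: emeasure_distr vim image_orthogonal_transformation_ball[OF S(1)])
  have compv: "emeasure ?\<nu> F < \<infinity>" if "compact F" for F
  proof -
    have "compact (S ` F)"
      using that linS by (intro compact_continuous_image) (auto simp: linear_continuous_on linear_linear)
    then have "emeasure lborel (S ` F) < \<infinity>"
      by (rule emeasure_compact_finite)
    then show ?thesis using borel_compact[OF that] by (simp add: emeasure_distr vim)
  qed
  have balls: "emeasure lborel (ball x r) = emeasure lborel (ball y r)" if "0 < r" for x y :: 'a and r
    using that by (simp add: emeasure_ball)
  have pos: "0 < emeasure lborel (ball x r)" if "0 < r" for x :: 'a and r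
    using that by (simp add: emeasure_ball unit_ball_vol_pos)
  have sf: "sigma_finite_measure ?\<nu>"
  proof
    show "\<exists>A. countable A \<and> A \<subseteq> sets ?\<nu> \<and> \<Union>A = space ?\<nu> \<and> (\<forall>a\<in>A. emeasure ?\<nu> a \<noteq> \<infinity>)"
      using compv by (intro exI[of _ "range (\<lambda>n::nat. cball 0 (real n))"])
        (auto simp: real_arch_simple less_top[symmetric] dest!: spec)
  qed
  have "emeasure ?\<nu> F = emeasure lborel F" if "compact F" for F
  proof (rule antisym)
    show "emeasure ?\<nu> F \<le> emeasure lborel F"
      by (rule emeasure_compact_le_of_equal_balls[where K = UNIV])
         (use ballv balls pos sf that emeasure_compact_finite in \<open>auto simp: lborel.sigma_finite_measure_axioms\<close>)
    show "emeasure lborel F \<le> emeasure ?\<nu> F"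
      by (rule emeasure_compact_le_of_equal_balls[where K = UNIV])
         (use ballv balls pos sf that compv in \<open>auto simp: lborel.sigma_finite_measure_axioms\<close>)
  qed
  then show ?thesis
    using emeasure_compact_finite by (intro measure_eqI_compact) (auto intro: compv)
qed

text \<open>Dependence on the norm alone gives invariance under orthogonal maps; additivity of
  squared norms gives the product formula.\<close>

lemma std_gaussian_density_eq_norm:
  "(\<Prod>b\<in>Basis. std_normal_density (x \<bullet> b)) =
    (1 / sqrt (2 * pi)) ^ DIM('a) * exp (- (norm x)\<^sup>2 / 2)" for x :: "'a::euclidean_space"
proof -
  have "(\<Prod>b\<in>Basis. std_normal_density (x \<bullet> b)) =
      (1 / sqrt (2 * pi)) ^ DIM('a) * exp (\<Sum>b\<in>Basis. - (x \<bullet> b)\<^sup>2 / 2)"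
    by (simp add: std_normal_density_def prod.distrib exp_sum prod_dividef power_divide)
  also have "(\<Sum>b\<in>Basis. - (x \<bullet> b)\<^sup>2 / 2) = - (norm x)\<^sup>2 / 2"
    unfolding power2_norm_eq_inner
    by (subst euclidean_inner[of x x]) (simp add: sum_divide_distrib[symmetric] sum_negf power2_eq_square)
  finally show ?thesis .
qed

theorem distr_std_gaussian_orthogonal_transformation:
  fixes T :: "'a::euclidean_space \<Rightarrow> 'a"
  assumes T: "orthogonal_transformation T"
  shows "distr std_gaussian borel T = std_gaussian"
proof -
  let ?f = "\<lambda>x::'a. ennreal (\<Prod>b\<in>Basis. std_normal_density (x \<bullet> b))"
  have lin: "linear T" using T by (rule orthogonal_transformation_linear)
  have [measurable]: "T \<in> borel_measurable borel"
    using lin by (simp add: linear_linear borel_measurable_continuous_onI linear_continuous_on)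
  have "std_gaussian = density (distr lborel borel T) ?f"
    by (simp add: std_gaussian_def distr_lborel_orthogonal_transformation[OF T])
  also have "\<dots> = distr (density lborel (\<lambda>x. ?f (T x))) borel T"
    by (rule density_distr) measurable
  also have "(\<lambda>x. ?f (T x)) = ?f"
    unfolding std_gaussian_density_eq_norm by (simp add: orthogonal_transformation_norm[OF T])
  finally show ?thesis by (simp add: std_gaussian_def)
qed

lemma null_sets_std_gaussian: "A \<in> null_sets lborel \<Longrightarrow> A \<in> null_sets std_gaussian"
  unfolding std_gaussian_def
  by (subst null_sets_density_iff) (auto dest: AE_not_in elim!: eventually_mono)

lemma std_gaussian_AE_notin_lowdim:
  fixes S :: "'a::euclidean_space set"
  assumes "dim S < DIM('a)"
  shows "AE x in std_gaussian. x \<notin> S"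
proof -
  have "negligible (span S)" using assms by (intro negligible_lowdim) simp
  then have "span S \<in> null_sets lborel"
    by (simp add: negligible_iff_null_sets null_sets_completion_iff closed_subspace borel_closed)
  then have "AE x in std_gaussian. x \<notin> span S"
    by (intro AE_not_in null_sets_std_gaussian)
  then show ?thesis by (auto elim!: eventually_mono intro: span_base)
qed

lemma std_gaussian_pair:
  "(std_gaussian :: 'a::euclidean_space measure) \<Otimes>\<^sub>M (std_gaussian :: 'b::euclidean_space measure) = std_gaussian"
proof -
  have "sigma_finite_measure (density lborel (\<lambda>x::'b. ennreal (\<Prod>b\<in>Basis. std_normal_density (x \<bullet> b))))"
    using std_gaussian.sigma_finite_measure_axioms by (simp add: std_gaussian_def)
  then have "(std_gaussian :: 'a measure) \<Otimes>\<^sub>M (std_gaussian :: 'b measure) =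
    density (lborel \<Otimes>\<^sub>M lborel) (\<lambda>(x::'a,y::'b). ennreal (\<Prod>b\<in>Basis. std_normal_density (x \<bullet> b)) *
      ennreal (\<Prod>b\<in>Basis. std_normal_density (y \<bullet> b)))"
    unfolding std_gaussian_def by (intro pair_measure_density lborel.sigma_finite_measure_axioms) auto
  also have "\<dots> = std_gaussian"
    unfolding std_gaussian_def lborel_prod
  proof (intro arg_cong[where f = "density lborel"] ext, clarify)
    fix x :: 'a and y :: 'b
    show "ennreal (\<Prod>b\<in>Basis. std_normal_density (x \<bullet> b)) * ennreal (\<Prod>b\<in>Basis. std_normal_density (y \<bullet> b))
      = ennreal (\<Prod>b\<in>Basis. std_normal_density ((x, y) \<bullet> b))"
      unfolding std_gaussian_density_eq_norm
      by (simp add: ennreal_mult[symmetric] norm_Pair power_add exp_add[symmetric] field_simps)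
  qed
  finally show ?thesis .
qed

text \<open>All translates of \<open>S\<close> along \<open>v\<close> have the same measure, so averaging over translates
  and exchanging the integrals reduces the claim to lines.\<close>

lemma null_sets_lborel_countable_on_lines:
  fixes S :: "'a::euclidean_space set"
  assumes [measurable]: "S \<in> sets borel" and c: "\<And>w. countable {t. w + t *\<^sub>R v \<in> S}"
  shows "S \<in> null_sets lborel"
proof -
  have tr: "emeasure lborel S = (\<integral>\<^sup>+w. indicator S (w + t *\<^sub>R v) \<partial>lborel)" for t
  proof -
    have "emeasure lborel S = (\<integral>\<^sup>+w. indicator S w \<partial>distr lborel borel ((+) (t *\<^sub>R v)))"
      by (simp add: lborel_distr_plus)
    also have "\<dots> = (\<integral>\<^sup>+w. indicator S (t *\<^sub>R v + w) \<partial>lborel)"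
      by (rule nn_integral_distr) auto
    finally show ?thesis by (simp add: add.commute)
  qed
  have "emeasure lborel S = (\<integral>\<^sup>+t. emeasure lborel S * indicator {0..1::real} t \<partial>lborel)"
    by (simp add: nn_integral_cmult_indicator)
  also have "\<dots> = (\<integral>\<^sup>+t. (\<integral>\<^sup>+w. indicator S (w + t *\<^sub>R v) * indicator {0..1::real} t \<partial>lborel) \<partial>lborel)"
    using tr by (simp add: nn_integral_multc)
  also have "\<dots> = (\<integral>\<^sup>+w. (\<integral>\<^sup>+t. indicator S (w + t *\<^sub>R v) * indicator {0..1::real} t \<partial>lborel) \<partial>lborel)"
    by (rule lborel_pair.Fubini') measurable
  also have "\<dots> = (\<integral>\<^sup>+w. 0 \<partial>(lborel :: 'a measure))"
  proof (rule nn_integral_cong)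
    fix w
    have "AE t in lborel. t \<notin> {t. w + t *\<^sub>R v \<in> S}"
      by (intro AE_not_in countable_imp_null_set_lborel c)
    then have "AE t in lborel. indicator S (w + t *\<^sub>R v) * indicator {0..1::real} t = (0 :: ennreal)"
      by (auto elim!: eventually_mono)
    then show "(\<integral>\<^sup>+t. indicator S (w + t *\<^sub>R v) * indicator {0..1::real} t \<partial>lborel) = 0"
      by (subst nn_integral_0_iff_AE) auto
  qed
  finally show ?thesis by (auto simp: null_sets_def)
qed

section \<open>Random rotations and transversality\<close>

declare transpose_matrix_vector [simp del]

section \<open>Orthogonal projections and reflections\<close>

definition orth_proj :: "'a::euclidean_space set \<Rightarrow> 'a \<Rightarrow> 'a" where
  "orth_proj S x = (THE y. y \<in> S \<and> x - y \<in> S\<^sup>\<bottom>)"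

lemma orth_proj_eqI:
  assumes "subspace S" "y \<in> S" "x - y \<in> S\<^sup>\<bottom>"
  shows "orth_proj S x = y"
  unfolding orth_proj_def
proof (rule the_equality)
  fix z assume z: "z \<in> S \<and> x - z \<in> S\<^sup>\<bottom>"
  have "(x - y) - (x - z) \<in> S\<^sup>\<bottom>"
    using z assms(3) subspace_diff[OF subspace_orthogonal_comp] by blast
  moreover have "z - y \<in> S" using z assms by (intro subspace_diff) auto
  ultimately have "z - y \<in> S \<inter> S\<^sup>\<bottom>" by simp
  then show "z = y" using orthogonal_Int_0[OF assms(1)] by simp
qed (use assms in auto)

lemma orth_proj:
  assumes "subspace S"
  shows orth_proj_in: "orth_proj S x \<in> S" and diff_orth_proj_in: "x - orth_proj S x \<in> S\<^sup>\<bottom>"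
proof -
  obtain y z where "y \<in> S" "z \<in> S\<^sup>\<bottom>" "x = y + z"
    using subspace_sum_orthogonal_comp[OF assms] by (metis UNIV_I set_plus_elim)
  then have "y \<in> S" "x - y \<in> S\<^sup>\<bottom>" by auto
  then show "orth_proj S x \<in> S" "x - orth_proj S x \<in> S\<^sup>\<bottom>"
    using orth_proj_eqI[OF assms] by auto
qed

lemma linear_orth_proj:
  assumes "subspace S"
  shows "linear (orth_proj S)"
proof (rule linearI)
  note S = assms orth_proj[OF assms] subspace_orthogonal_comp
  show "orth_proj S (x + y) = orth_proj S x + orth_proj S y" for x y
  proof (rule orth_proj_eqI[OF assms])
    have "(x - orth_proj S x) + (y - orth_proj S y) \<in> S\<^sup>\<bottom>"
      by (intro subspace_add S)
    then show "x + y - (orth_proj S x + orth_proj S y) \<in> S\<^sup>\<bottom>" by (simp add: algebra_simps)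
  qed (intro subspace_add S)
  show "orth_proj S (c *\<^sub>R x) = c *\<^sub>R orth_proj S x" for c x
  proof (rule orth_proj_eqI[OF assms])
    have "c *\<^sub>R (x - orth_proj S x) \<in> S\<^sup>\<bottom>"
      by (intro subspace_scale S)
    then show "c *\<^sub>R x - c *\<^sub>R orth_proj S x \<in> S\<^sup>\<bottom>" by (simp add: algebra_simps)
  qed (intro subspace_scale S)
qed

lemma orth_proj_self: "subspace S \<Longrightarrow> x \<in> S \<Longrightarrow> orth_proj S x = x"
  by (rule orth_proj_eqI) (auto simp: subspace_0 subspace_orthogonal_comp)

text \<open>Since \<open>x / 0 = 0\<close>, \<open>reflect 0\<close> is the identity and no case distinction is needed.\<close>

definition reflect :: "'a::euclidean_space \<Rightarrow> 'a \<Rightarrow> 'a" where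
  "reflect w x = x - (2 * (w \<bullet> x) / (w \<bullet> w)) *\<^sub>R w"

lemma reflect_orthogonal: "w \<bullet> x = 0 \<Longrightarrow> reflect w x = x"
  by (simp add: reflect_def)

lemma linear_reflect: "linear (reflect w)"
  by (rule linearI) (auto simp: reflect_def inner_add_right algebra_simps add_divide_distrib)

lemma reflect_reflect [simp]: "reflect w (reflect w x) = x"
  by (simp add: reflect_def inner_diff_right algebra_simps)

lemma inner_reflect_left: "reflect w x \<bullet> y = x \<bullet> reflect w y"
  by (simp add: reflect_def inner_diff_left inner_diff_right inner_commute)

lemma orthogonal_transformation_reflect: "orthogonal_transformation (reflect w)"
  unfolding orthogonal_transformation_def
  by (simp add: linear_reflect inner_reflect_left)

lemma reflect_in_subspace: "subspace S \<Longrightarrow> w \<in> S \<Longrightarrow> x \<in> S \<Longrightarrow> reflect w x \<in> S"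
  unfolding reflect_def by (intro subspace_diff subspace_scale)

text \<open>The mirror is the perpendicular bisector of \<open>x\<close> and \<open>y\<close>, which
  passes through the origin because the norms agree. Reflections thus act transitively on
  spheres.\<close>

lemma reflect_diff_swap:
  assumes "norm x = norm y"
  shows "reflect (x - y) x = y"
proof (cases "x = y")
  case False
  have xy: "x \<bullet> x = y \<bullet> y" using assms by (simp add: norm_eq_sqrt_inner)
  have "(x - y) \<bullet> (x - y) = 2 * ((x - y) \<bullet> x)"
    using xy by (simp add: inner_diff_left inner_diff_right inner_commute)
  then have "2 * ((x - y) \<bullet> x) / ((x - y) \<bullet> (x - y)) = 1"
    using False by (metis divide_self inner_eq_zero_iff right_minus_eq)
  then have "reflect (x - y) x = x - 1 *\<^sub>R (x - y)" by (simp only: reflect_def)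
  then show ?thesis by simp
qed (simp add: reflect_def)

section \<open>Measurability of matrix operations\<close>

lemma continuous_on_matrix_matrix_mult [continuous_intros]:
  fixes f :: "'a::topological_space \<Rightarrow> real^'n^'m" and g :: "'a \<Rightarrow> real^'k^'n"
  assumes "continuous_on S f" "continuous_on S g"
  shows "continuous_on S (\<lambda>x. f x ** g x)"
  unfolding matrix_matrix_mult_def using assms by (intro continuous_intros)

lemma continuous_on_matrix_vector_mult [continuous_intros]:
  fixes f :: "'a::topological_space \<Rightarrow> real^'n^'m" and g :: "'a \<Rightarrow> real^'n"
  assumes "continuous_on S f" "continuous_on S g"
  shows "continuous_on S (\<lambda>x. f x *v g x)"
  unfolding matrix_vector_mult_def using assms by (intro continuous_intros)

lemma continuous_on_transpose [continuous_intros]: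
  fixes f :: "'a::topological_space \<Rightarrow> real^'n^'m"
  assumes "continuous_on S f"
  shows "continuous_on S (\<lambda>x. transpose (f x))"
  unfolding transpose_def using assms by (intro continuous_intros)

lemma borel_measurable_matrix_matrix_mult [measurable (raw)]:
  fixes f :: "'a \<Rightarrow> real^'n^'m" and g :: "'a \<Rightarrow> real^'k^'n"
  assumes "f \<in> borel_measurable M" "g \<in> borel_measurable M"
  shows "(\<lambda>x. f x ** g x) \<in> borel_measurable M"
  using assms by (rule borel_measurable_continuous_Pair) (intro continuous_intros)

lemma borel_measurable_matrix_vector_mult [measurable (raw)]:
  fixes f :: "'a \<Rightarrow> real^'n^'m" and g :: "'a \<Rightarrow> real^'n"
  assumes "f \<in> borel_measurable M" "g \<in> borel_measurable M"
  shows "(\<lambda>x. f x *v g x) \<in> borel_measurable M"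
  using assms by (rule borel_measurable_continuous_Pair) (intro continuous_intros)

lemma borel_measurable_transpose [measurable (raw)]:
  fixes f :: "'a \<Rightarrow> real^'n^'m"
  assumes "f \<in> borel_measurable M"
  shows "(\<lambda>x. transpose (f x)) \<in> borel_measurable M"
  using assms by (rule borel_measurable_continuous_on[rotated]) (intro continuous_intros)

lemma borel_measurable_linear [measurable (raw)]:
  fixes T :: "'a::euclidean_space \<Rightarrow> 'b::euclidean_space"
  shows "linear T \<Longrightarrow> T \<in> borel_measurable borel"
  by (simp add: linear_linear borel_measurable_continuous_onI linear_continuous_on)

text \<open>The Householder form \<open>I - 2 w w^T / |w|^2\<close>, explicit in \<open>w\<close>,
  from which the measurability of a random reflection follows.\<close>

lemma matrix_reflect_eq:
  "matrix (reflect w) = mat 1 - (2 / (w \<bullet> w)) *\<^sub>R (\<chi> i j. w $ i * w $ j)" for w :: "real^'n"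
  by (simp add: matrix_def reflect_def vec_eq_iff mat_def axis_def inner_axis
      inner_axis[unfolded axis_def])

lemma borel_measurable_matrix_reflect [measurable (raw)]:
  fixes f :: "'a \<Rightarrow> real^'n"
  assumes [measurable]: "f \<in> borel_measurable M"
  shows "(\<lambda>x. matrix (reflect (f x))) \<in> borel_measurable M"
proof -
  have [measurable]: "(\<lambda>w::real^'n. (\<chi> i j. w $ i * w $ j) :: real^'n^'n) \<in> borel_measurable borel"
    by (intro borel_measurable_continuous_onI continuous_intros)
  show ?thesis unfolding matrix_reflect_eq by measurable
qed

lemma matrix_reflect_mult: "matrix (reflect w) *v x = reflect w x" for w :: "real^'n"
  using matrix_vector_mul(2)[OF linear_reflect] by metis

lemma transpose_matrix_reflect: "transpose (matrix (reflect w)) = matrix (reflect w)" for w :: "real^'n"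
  unfolding matrix_reflect_eq by (simp add: transpose_def vec_eq_iff mat_def mult.commute)

lemma orthogonal_matrix_reflect: "orthogonal_matrix (matrix (reflect w))" for w :: "real^'n"
  using orthogonal_transformation_reflect orthogonal_transformation_matrix by blast

lemma orthogonal_matrix_mult_transpose [simp]:
  fixes Q :: "real^'n^'n"
  assumes "orthogonal_matrix Q"
  shows "transpose Q *v (Q *v x) = x" "Q *v (transpose Q *v x) = x"
  using assms by (simp_all add: orthogonal_matrix_def matrix_vector_mul_assoc)

lemma in_rotated_image_iff:
  fixes Q :: "real^'n^'n"
  assumes "orthogonal_matrix Q"
  shows "y \<in> (*v) Q ` S \<longleftrightarrow> transpose Q *v y \<in> S"
proof
  assume "transpose Q *v y \<in> S"
  then have "Q *v (transpose Q *v y) \<in> (*v) Q ` S" by (rule imageI)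
  then show "y \<in> (*v) Q ` S" using assms by simp
qed (use assms in auto)

lemma inner_matrix_vector_mult: "(Q *v x) \<bullet> y = x \<bullet> (transpose Q *v y)" for Q :: "real^'n^'m"
  by (metis dot_lmul_matrix inner_commute transpose_matrix_vector transpose_transpose)

lemma norm_orthogonal_matrix_mult:
  fixes Q :: "real^'n^'n"
  assumes "orthogonal_matrix Q"
  shows "norm (Q *v x) = norm x"
  using assms by (simp add: norm_eq_sqrt_inner inner_matrix_vector_mult)

text \<open>The Haar measure is carried as a Borel measure on all matrices, concentrated on the
  orthogonal group, so that no restricted sigma-algebra enters. Invariance under transposition and
  right multiplication is derived from left invariance.\<close>

locale haar_orthogonal = prob_space \<mu> for \<mu> :: "(real^'n^'n) measure" +
  assumes sets_haar: "sets \<mu> = sets borel"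
    and AE_orthogonal: "AE Q in \<mu>. orthogonal_matrix Q"
    and distr_left: "orthogonal_matrix U \<Longrightarrow> distr \<mu> borel (\<lambda>Q. U ** Q) = \<mu>"
begin

declare sets_haar [simp, measurable_cong]

lemma space_haar [simp]: "space \<mu> = UNIV"
  using sets_eq_imp_space_eq[OF sets_haar] by simp

lemma nn_integral_left:
  assumes "orthogonal_matrix U" and [measurable]: "f \<in> borel_measurable borel"
  shows "(\<integral>\<^sup>+Q. f (U ** Q) \<partial>\<mu>) = (\<integral>\<^sup>+Q. f Q \<partial>\<mu>)"
proof -
  have "(\<integral>\<^sup>+Q. f Q \<partial>\<mu>) = (\<integral>\<^sup>+Q. f Q \<partial>distr \<mu> borel (\<lambda>Q. U ** Q))"
    by (simp add: distr_left[OF assms(1)])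
  also have "\<dots> = (\<integral>\<^sup>+Q. f (U ** Q) \<partial>\<mu>)"
    by (rule nn_integral_distr) auto
  finally show ?thesis ..
qed

text \<open>For independent \<open>Q\<close> and \<open>R\<close> the mean of
  \<open>f (transpose Q ** R)\<close> is computed twice: left invariance in \<open>R\<close> gives
  the mean of \<open>f\<close>, and left invariance in \<open>Q\<close>, after transposing the
  argument, gives the mean of \<open>f\<close> composed with transposition.\<close>

lemma nn_integral_transpose:
  assumes [measurable]: "f \<in> borel_measurable borel"
  shows "(\<integral>\<^sup>+Q. f (transpose Q) \<partial>\<mu>) = (\<integral>\<^sup>+Q. f Q \<partial>\<mu>)"
proof -
  interpret P: pair_sigma_finite \<mu> \<mu> ..
  have "(\<integral>\<^sup>+Q. f Q \<partial>\<mu>) = (\<integral>\<^sup>+Q. (\<integral>\<^sup>+R. f R \<partial>\<mu>) \<partial>\<mu>)"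
    using emeasure_space_1 by simp
  also have "\<dots> = (\<integral>\<^sup>+Q. (\<integral>\<^sup>+R. f (transpose Q ** R) \<partial>\<mu>) \<partial>\<mu>)"
    using AE_orthogonal by (intro nn_integral_cong_AE) (auto simp: nn_integral_left elim!: eventually_mono)
  also have "\<dots> = (\<integral>\<^sup>+R. (\<integral>\<^sup>+Q. f (transpose Q ** R) \<partial>\<mu>) \<partial>\<mu>)"
    by (rule P.Fubini') measurable
  also have "\<dots> = (\<integral>\<^sup>+R. (\<integral>\<^sup>+Q. f (transpose (transpose R ** Q)) \<partial>\<mu>) \<partial>\<mu>)"
    by (simp add: matrix_transpose_mul)
  also have "\<dots> = (\<integral>\<^sup>+R. (\<integral>\<^sup>+Q. f (transpose Q) \<partial>\<mu>) \<partial>\<mu>)"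
    using AE_orthogonal
    by (intro nn_integral_cong_AE)
       (auto simp: nn_integral_left[where f = "\<lambda>Q. f (transpose Q)"] elim!: eventually_mono)
  also have "\<dots> = (\<integral>\<^sup>+Q. f (transpose Q) \<partial>\<mu>)"
    using emeasure_space_1 by simp
  finally show ?thesis ..
qed

lemma nn_integral_right:
  assumes "orthogonal_matrix W" and [measurable]: "f \<in> borel_measurable borel"
  shows "(\<integral>\<^sup>+Q. f (Q ** W) \<partial>\<mu>) = (\<integral>\<^sup>+Q. f Q \<partial>\<mu>)"
proof -
  have "(\<integral>\<^sup>+Q. f (Q ** W) \<partial>\<mu>) = (\<integral>\<^sup>+Q. f (transpose Q ** W) \<partial>\<mu>)"
    by (rule nn_integral_transpose[symmetric]) measurable
  also have "\<dots> = (\<integral>\<^sup>+Q. f (transpose (transpose W ** Q)) \<partial>\<mu>)"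
    by (simp add: matrix_transpose_mul)
  also have "\<dots> = (\<integral>\<^sup>+Q. f (transpose Q) \<partial>\<mu>)"
    using assms(1) by (intro nn_integral_left[where f = "\<lambda>Q. f (transpose Q)"]) auto
  also have "\<dots> = (\<integral>\<^sup>+Q. f Q \<partial>\<mu>)" by (rule nn_integral_transpose) measurable
  finally show ?thesis .
qed

end

section \<open>Almost sure transversality of a subspace and a rotated subspace\<close>

lemma finite_quadratic_roots:
  fixes a b c :: real
  assumes "a \<noteq> 0"
  shows "finite {t. a * t\<^sup>2 + b * t + c = 0}"
proof -
  have "finite {t. poly [:c, b, a:] t = 0}"
    using assms by (intro poly_roots_finite) auto
  then show ?thesis by (simp add: algebra_simps power2_eq_square)
qed

lemma AE_reflected_not_orthogonal:
  fixes e p :: "'a::euclidean_space"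
  assumes S: "subspace S" and e: "e \<in> S" "e \<noteq> 0" and p: "p \<in> S" "p \<noteq> 0"
  shows "AE g in std_gaussian. p \<bullet> reflect (orth_proj S g) e \<noteq> 0"
proof -
  let ?P = "orth_proj S"
  have inner_P: "y \<bullet> ?P g = y \<bullet> g" if "y \<in> S" for y g
    using diff_orth_proj_in[OF S, of g] that by (auto simp: mem_orthogonal_comp inner_diff_right)
  \<comment> \<open>The vanishing of the inner product with the denominator \<open>|?P g|^2\<close>
    cleared; as \<open>e\<close> and \<open>p\<close> lie in \<open>S\<close>, their products with
    \<open>?P g\<close> are products with \<open>g\<close>.\<close>
  let ?Z = "{g. (p \<bullet> e) * (?P g \<bullet> ?P g) - 2 * (e \<bullet> g) * (p \<bullet> g) = 0}"
  have inZ: "g \<in> ?Z" if "p \<bullet> reflect (?P g) e = 0" for g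
  proof (cases "?P g = 0")
    case True
    then show ?thesis using inner_P[OF e(1), of g] by simp
  next
    case False
    then show ?thesis
      using that inner_P[OF e(1), of g] inner_P[OF p(1), of g]
      by (simp add: reflect_def inner_diff_right inner_commute field_simps)
  qed
  have "AE g in std_gaussian. g \<notin> ?Z"
  \<comment> \<open>If \<open>p\<close> and \<open>e\<close> are orthogonal, the quadric degenerates
    to the two hyperplanes normal to \<open>e\<close> and \<open>p\<close>. Otherwise its equation
    on a line in direction \<open>p\<close> is quadratic with leading coefficient
    \<open>-(p \<bullet> e) * (p \<bullet> p)\<close>, so each such line meets it in finitely many
    points.\<close>
  proof (cases "p \<bullet> e = 0")
    case True
    have "AE g in std_gaussian. g \<notin> {g. y \<bullet> g = 0}" if "y \<noteq> 0" for y :: 'a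
      using that by (intro std_gaussian_AE_notin_lowdim) (simp add: dim_hyperplane)
    from this[OF e(2)] this[OF p(2)] show ?thesis
      by eventually_elim (use True in simp)
  next
    case False
    have [measurable]: "?P \<in> borel_measurable borel"
      by (rule borel_measurable_linear[OF linear_orth_proj[OF S]])
    have "?Z \<in> sets borel" by measurable
    moreover have "countable {t. w + t *\<^sub>R p \<in> ?Z}" for w
    proof -
      have "?P (w + t *\<^sub>R p) = ?P w + t *\<^sub>R p" for t
        using linear_add[OF linear_orth_proj[OF S]] linear_scale[OF linear_orth_proj[OF S]]
          orth_proj_self[OF S p(1)] by simp
      then have "{t. w + t *\<^sub>R p \<in> ?Z} = {t. (- (p \<bullet> e) * (p \<bullet> p)) * t\<^sup>2 +
          (- 2 * (e \<bullet> w) * (p \<bullet> p)) * t + ((p \<bullet> e) * (?P w \<bullet> ?P w) - 2 * (e \<bullet> w) * (p \<bullet> w)) = 0}"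
        (is "_ = ?R")
        using inner_P[OF p(1), of w]
        by (intro Collect_cong) (simp add: inner_add_left inner_add_right inner_commute
            algebra_simps power2_eq_square)
      moreover have "finite ?R" using False p(2) by (intro finite_quadratic_roots) simp
      ultimately show ?thesis by (simp only: countable_finite)
    qed
    ultimately show ?thesis
      by (intro AE_not_in null_sets_std_gaussian null_sets_lborel_countable_on_lines)
  qed
  then show ?thesis using inZ by (auto elim!: eventually_mono)
qed

text \<open>Asking for a unit vector instead of a nonzero one makes the set of pairs of
  \<open>Q\<close> and \<open>x\<close> closed, so that its projection to \<open>Q\<close> is
  Borel.\<close>

lemma borel_meets:
  fixes A B :: "(real^'n) set"
  assumes "closed A" "closed B"
  shows "{Q::real^'n^'n. \<exists>x. norm x = 1 \<and> x \<in> A \<and> transpose Q *v x \<in> B} \<in> sets borel"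
proof -
  have "closed {p :: (real^'n^'n) \<times> (real^'n). norm (snd p) = 1 \<and> snd p \<in> A \<and> transpose (fst p) *v snd p \<in> B}"
  proof -
    have "closed ((\<lambda>p :: (real^'n^'n) \<times> (real^'n). norm (snd p)) -` {1} \<inter> snd -` A \<inter>
        (\<lambda>p. transpose (fst p) *v snd p) -` B)"
      using assms by (intro closed_Int closed_vimage closed_singleton continuous_intros)
    then show ?thesis by (simp add: vimage_def Collect_conj_eq Int_assoc)
  qed
  from borel_fst_image_closed[OF this] show ?thesis
    by (rule back_subst[of "\<lambda>X. X \<in> sets borel"]) (auto simp: image_iff)
qed

context haar_orthogonal begin

text \<open>Induction on \<open>dim N\<close>: a vector \<open>e\<close> is split off, leaving
  \<open>N'\<close>, for which the claim is known. Composing \<open>Q\<close> on the right with a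
  random reflection that fixes \<open>N'\<close> does not change the law of \<open>Q\<close>, and
  for fixed \<open>Q\<close> it moves \<open>e\<close> off a hyperplane that contains
  \<open>N'\<close> and the image of \<open>M\<close> under \<open>transpose Q\<close>.\<close>

theorem AE_subspace_Int_trivial:
  fixes M N :: "(real^'n) set"
  assumes M: "subspace M" and "subspace N" "dim M + dim N \<le> CARD('n)"
  shows "AE Q in \<mu>. \<forall>x\<in>M. transpose Q *v x \<in> N \<longrightarrow> x = 0"
  using assms(2,3)
proof (induction "dim N" arbitrary: N)
  case 0
  then have N: "N \<subseteq> {0}" by simp
  show ?case
    using AE_orthogonal
  proof eventually_elim
    case (elim Q)
    have "x = 0" if "transpose Q *v x \<in> N" for x
    proof -
      have "Q *v (transpose Q *v x) = 0" using that N by auto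
      then show ?thesis using elim by simp
    qed
    then show ?case by blast
  qed
next
  case (Suc d)
  note N = \<open>subspace N\<close>
  have "N \<noteq> {0}" using Suc(2) by auto
  then obtain e where e: "e \<in> N" "e \<noteq> 0" using subspace_0[OF N] by blast
  define N' where "N' = {y\<in>N. \<forall>x\<in>span {e}. orthogonal x y}"
  have N'_eq: "N' = {y\<in>N. e \<bullet> y = 0}"
    unfolding N'_def by (auto simp: span_singleton orthogonal_def)
  have N': "subspace N'"
    unfolding N'_eq using N by (auto simp: subspace_def inner_add_right)
  have "dim N' + dim (span {e}) = dim N"
    unfolding N'_def using e N by (intro dim_subspace_orthogonal_to_vectors) (auto simp: span_minimal)
  then have dimN': "dim N' + 1 = dim N" using e by (simp add: dim_singleton)
  define B where "B = {Q. \<exists>x. norm x = 1 \<and> x \<in> M \<and> transpose Q *v x \<in> N}"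
  have [measurable]: "B \<in> sets borel"
    unfolding B_def by (intro borel_meets closed_subspace M N)
  interpret P: pair_sigma_finite \<mu> "std_gaussian :: (real^'n) measure"
    by (simp add: pair_sigma_finite_def sigma_finite_measure_axioms std_gaussian.sigma_finite_measure_axioms)
  \<comment> \<open>A Gaussian vector projected to the complement of \<open>N'\<close>: reflections
    along it fix \<open>N'\<close> pointwise.\<close>
  let ?w = "orth_proj (N'\<^sup>\<bottom>)"
  have subN'c: "subspace (N'\<^sup>\<bottom>)" by (rule subspace_orthogonal_comp)
  have [measurable]: "?w \<in> borel_measurable borel"
    by (rule borel_measurable_linear[OF linear_orth_proj[OF subN'c]])
  have "AE Q in \<mu>. \<forall>x\<in>M. transpose Q *v x \<in> N' \<longrightarrow> x = 0"
    using Suc dimN' by (intro Suc(1) N') auto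
  then have key: "AE Q in \<mu>. AE g in std_gaussian. Q ** matrix (reflect (?w g)) \<notin> B"
    using AE_orthogonal
  proof eventually_elim
    case (elim Q)
    define P where "P = {x + y | x y. x \<in> (*v) (transpose Q) ` M \<and> y \<in> N'}"
    have lin: "linear ((*v) (transpose Q))" by simp
    have QM: "subspace ((*v) (transpose Q) ` M)"
      by (rule linear_subspace_image[OF lin M])
    have "dim P + dim (((*v) (transpose Q) ` M) \<inter> N') = dim ((*v) (transpose Q) ` M) + dim N'"
      unfolding P_def by (rule dim_sums_Int[OF QM N'])
    moreover have "dim ((*v) (transpose Q) ` M) \<le> dim M"
      by (rule dim_image_le[OF lin])
    \<comment> \<open>Since \<open>dim N'\<close> is one less than \<open>dim N\<close>, the sum
      \<open>P\<close> is a proper subspace, and \<open>p\<close> is chosen normal to it.\<close>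
    ultimately have "dim P < DIM(real^'n)" using Suc(2,4) dimN' by simp
    then obtain p where p: "p \<noteq> 0" "span P \<subseteq> {x. p \<bullet> x = 0}"
      using lowdim_subset_hyperplane by blast
    have P0: "p \<bullet> (transpose Q *v x) = 0" if "x \<in> M" for x
    proof -
      have "transpose Q *v x + 0 \<in> P" unfolding P_def using that subspace_0[OF N'] by blast
      then show ?thesis using p(2) span_base by force
    qed
    have P1: "p \<bullet> y = 0" if "y \<in> N'" for y
    proof -
      have "0 + y \<in> P" unfolding P_def using that subspace_0[OF QM] by blast
      then show ?thesis using p(2) span_base by force
    qed
    have "p \<in> N'\<^sup>\<bottom>" using P1 by (simp add: mem_orthogonal_comp inner_commute)
    moreover have "e \<in> N'\<^sup>\<bottom>" by (auto simp: mem_orthogonal_comp N'_eq inner_commute)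
    ultimately have "AE g in std_gaussian. p \<bullet> reflect (?w g) e \<noteq> 0"
      using AE_reflected_not_orthogonal[OF subN'c] e(2) p(1) by blast
    then show ?case
    proof eventually_elim
      case (elim g)
      have wN: "?w g \<bullet> y = 0" if "y \<in> N'" for y
        using orth_proj_in[OF subN'c, of g] that by (auto simp: mem_orthogonal_comp inner_commute)
      show ?case
      proof
        assume "Q ** matrix (reflect (?w g)) \<in> B"
        then obtain x where x: "norm x = 1" "x \<in> M" "transpose (Q ** matrix (reflect (?w g))) *v x \<in> N"
          unfolding B_def by blast
        define y where "y = reflect (?w g) (transpose Q *v x)"
        have y: "y \<in> N"
          using x(3) unfolding y_def matrix_transpose_mul transpose_matrix_reflect
          by (simp add: matrix_vector_mul_assoc[symmetric] matrix_reflect_mult)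
        \<comment> \<open>The component of \<open>y\<close> along \<open>e\<close>, so that the rest
          lies in \<open>N'\<close>. The inner product with \<open>p\<close> leaves only
          \<open>c\<close> times a nonzero number, whence \<open>c = 0\<close> and the induction
          hypothesis for \<open>N'\<close> applies.\<close>
        define c where "c = (e \<bullet> y) / (e \<bullet> e)"
        have ym: "y - c *\<^sub>R e \<in> N'"
          unfolding N'_eq using y e N
          by (auto intro!: subspace_diff subspace_scale simp: inner_diff_right c_def)
        have "transpose Q *v x = reflect (?w g) (c *\<^sub>R e + (y - c *\<^sub>R e))"
          by (simp add: y_def)
        also have "\<dots> = c *\<^sub>R reflect (?w g) e + (y - c *\<^sub>R e)"
          using linear_add[OF linear_reflect] linear_scale[OF linear_reflect]
            reflect_orthogonal[OF wN[OF ym]] by metis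
        finally have Qx: "transpose Q *v x = c *\<^sub>R reflect (?w g) e + (y - c *\<^sub>R e)" .
        have "p \<bullet> (transpose Q *v x) = c * (p \<bullet> reflect (?w g) e)"
          unfolding Qx using P1[OF ym] by (simp add: inner_add_right)
        then have "c = 0" using P0[OF x(2)] elim by simp
        then have "transpose Q *v x \<in> N'" using Qx ym by simp
        then have "x = 0" using \<open>\<forall>x\<in>M. transpose Q *v x \<in> N' \<longrightarrow> x = 0\<close> x(2) by blast
        then show False using x(1) by simp
      qed
    qed
  qed
  \<comment> \<open>Right invariance allows the random reflection to be inserted; after exchanging
    the integrals, the inner one vanishes for almost every \<open>Q\<close> by
    \<open>key\<close>.\<close>
  have "emeasure \<mu> B = (\<integral>\<^sup>+g. emeasure \<mu> B \<partial>(std_gaussian :: (real^'n) measure))"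
    using std_gaussian.emeasure_space_1[where 'a = "real^'n"] by simp
  also have "\<dots> = (\<integral>\<^sup>+g. (\<integral>\<^sup>+Q. indicator B (Q ** matrix (reflect (?w g))) \<partial>\<mu>) \<partial>std_gaussian)"
    by (subst nn_integral_right) (auto simp: orthogonal_matrix_reflect)
  also have "\<dots> = (\<integral>\<^sup>+Q. (\<integral>\<^sup>+g. indicator B (Q ** matrix (reflect (?w g))) \<partial>std_gaussian) \<partial>\<mu>)"
    by (rule P.Fubini') measurable
  also have "\<dots> = (\<integral>\<^sup>+Q. 0 \<partial>\<mu>)"
    using key
  proof (intro nn_integral_cong_AE, eventually_elim)
    case (elim Q)
    then show ?case by (subst nn_integral_0_iff_AE) (auto elim!: eventually_mono)
  qed
  finally have "B \<in> null_sets \<mu>" by (auto simp: null_sets_def)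
  then have "AE Q in \<mu>. Q \<notin> B" by (rule AE_not_in)
  then show ?case
  proof eventually_elim
    case (elim Q)
    show ?case
    proof (intro ballI impI, rule ccontr)
      fix x assume x: "x \<in> M" "transpose Q *v x \<in> N" "x \<noteq> 0"
      have "norm (x /\<^sub>R norm x) = 1" "x /\<^sub>R norm x \<in> M"
        using x M by (auto intro: subspace_scale)
      moreover have "transpose Q *v (x /\<^sub>R norm x) \<in> N"
        using x(2) N by (simp add: matrix_vector_mult_scaleR subspace_scale)
      ultimately show False using elim unfolding B_def by blast
    qed
  qed
qed

end

section \<open>The law of the directions\<close>

lemma borel_measurable_sgn_vector [measurable (raw)]:
  fixes f :: "'a \<Rightarrow> 'b::euclidean_space"
  assumes [measurable]: "f \<in> borel_measurable M"
  shows "(\<lambda>x. sgn (f x)) \<in> borel_measurable M"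
  unfolding sgn_div_norm by measurable

text \<open>The unit sphere of \<open>S\<close>, with the value \<open>{0}\<close> at
  \<open>S = {0}\<close> to match \<open>sgn 0 = 0\<close>; trivial factors can then stay in the
  product \<open>K\<close>.\<close>

definition directions :: "'a::euclidean_space set \<Rightarrow> 'a set" where
  "directions S = {x\<in>S. norm x = (if S = {0} then 0 else 1)}"

lemma directions_transitive:
  assumes "subspace S" "x \<in> directions S" "y \<in> directions S"
  obtains w where "w \<in> S" "reflect w x = y"
proof (rule that[of "x - y"])
  show "x - y \<in> S" using assms by (auto simp: directions_def intro: subspace_diff)
  show "reflect (x - y) x = y" using assms by (intro reflect_diff_swap) (auto simp: directions_def)
qed

lemma sgn_in_directions:
  assumes "subspace S" "x \<in> S" "S \<noteq> {0} \<Longrightarrow> x \<noteq> 0"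
  shows "sgn x \<in> directions S"
proof -
  have "sgn x \<in> S" using assms(1,2) by (simp add: sgn_div_norm subspace_scale)
  then show ?thesis using assms by (auto simp: directions_def norm_sgn)
qed

lemma sgn_reflect: "sgn (reflect w x) = reflect w (sgn x)"
  using orthogonal_transformation_norm[OF orthogonal_transformation_reflect, of w x]
    linear_scale[OF linear_reflect, of w "inverse (norm x)" x] by (simp add: sgn_div_norm)

lemma reflect_0 [simp]: "reflect w 0 = 0"
  by (simp add: reflect_def)

lemma orthogonal_comp_inner: "x \<in> S \<Longrightarrow> y \<in> S\<^sup>\<bottom> \<Longrightarrow> x \<bullet> y = 0" "x \<in> S\<^sup>\<bottom> \<Longrightarrow> y \<in> S \<Longrightarrow> x \<bullet> y = 0"
  by (auto simp: mem_orthogonal_comp inner_commute)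

text \<open>\<open>reflect a\<close> fixes the complement of \<open>S\<close> pointwise and
  \<open>reflect b\<close> fixes \<open>S\<close> pointwise, so they act separately on the two
  components of \<open>g\<close>.\<close>

lemma orth_proj_double_reflect:
  assumes S: "subspace S" and ab: "a \<in> S" "b \<in> S\<^sup>\<bottom>"
  shows "orth_proj S (reflect a (reflect b g)) = reflect a (orth_proj S g)"
    and "reflect a (reflect b g) - orth_proj S (reflect a (reflect b g)) = reflect b (g - orth_proj S g)"
proof -
  note sc = subspace_orthogonal_comp[of S]
  define p q where "p = orth_proj S g" and "q = g - orth_proj S g"
  have p: "p \<in> S" and q: "q \<in> S\<^sup>\<bottom>" unfolding p_def q_def by (simp_all add: orth_proj S)
  have bq: "reflect b q \<in> S\<^sup>\<bottom>" by (intro reflect_in_subspace sc ab q)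
  have g: "g = p + q" by (simp add: p_def q_def)
  have eq: "reflect a (reflect b g) = reflect a p + reflect b q"
  proof -
    have "reflect b g = p + reflect b q"
      using g linear_add[OF linear_reflect] reflect_orthogonal[OF orthogonal_comp_inner(2)[OF ab(2) p]]
      by metis
    then show ?thesis
      using linear_add[OF linear_reflect] reflect_orthogonal[OF orthogonal_comp_inner(1)[OF ab(1) bq]]
      by metis
  qed
  show 1: "orth_proj S (reflect a (reflect b g)) = reflect a (orth_proj S g)"
    using bq p by (intro orth_proj_eqI S) (auto simp: eq p_def[symmetric] intro: reflect_in_subspace S ab)
  show "reflect a (reflect b g) - orth_proj S (reflect a (reflect b g)) = reflect b (g - orth_proj S g)"
    using eq unfolding 1 p_def q_def by simp
qed

lemma std_gaussian_AE_notin_proper_subspace: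
  fixes S :: "'a::euclidean_space set"
  assumes "subspace S" "S \<noteq> UNIV"
  shows "AE g in std_gaussian. g \<notin> S"
proof (rule std_gaussian_AE_notin_lowdim)
  have "dim S \<noteq> DIM('a)" using assms dim_eq_full span_eq_iff by metis
  then show "dim S < DIM('a)" using dim_subset_UNIV[of S] by linarith
qed

lemma emeasure_ball_invariant:
  fixes \<nu> :: "'a::euclidean_space measure"
  assumes "sets \<nu> = sets borel" "distr \<nu> borel T = \<nu>" "T \<in> borel_measurable borel"
    and "\<And>z z'. dist (T z) (T z') = dist z z'"
  shows "emeasure \<nu> (ball (T k) r) = emeasure \<nu> (ball k r)"
proof -
  have [measurable]: "T \<in> borel_measurable \<nu>"
    using assms(1,3) by (simp cong: measurable_cong_sets)
  have "space \<nu> = UNIV" using sets_eq_imp_space_eq[OF assms(1)] by simp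
  moreover have "T -` ball (T k) r = ball k r" using assms(4) by auto
  ultimately show ?thesis
    by (subst assms(2)[symmetric]) (simp add: emeasure_distr)
qed

definition reflect4 where
  "reflect4 a b c d = (\<lambda>(x, y, z, w). (reflect a x, reflect b y, reflect c z, reflect d w))"

lemma dist_reflect: "dist (reflect a x) (reflect a y) = dist x y"
  using orthogonal_transformation_norm[OF orthogonal_transformation_reflect] linear_diff[OF linear_reflect]
  by (metis dist_norm)

lemma dist_reflect4: "dist (reflect4 a b c d z) (reflect4 a b c d z') = dist z z'"
  by (cases z; cases z') (simp add: reflect4_def dist_Pair_Pair dist_reflect)

lemma borel_measurable_reflect [measurable]: "reflect a \<in> borel_measurable borel"
  by (rule borel_measurable_linear[OF linear_reflect])

lemma borel_measurable_reflect4 [measurable]: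
  "reflect4 a b c d \<in> borel_measurable borel"
  unfolding reflect4_def borel_prod[symmetric] by measurable

lemma dim_orthogonal_comp: "subspace S \<Longrightarrow> dim (S\<^sup>\<bottom>) + dim S = DIM('a)" for S :: "'a::euclidean_space set"
  using dim_subspace_orthogonal_to_vectors[of S UNIV] by (simp add: orthogonal_comp_def)

text \<open>\<open>L1\<close> and \<open>L2\<close> stand for the spans of two strata. The strict
  inequality \<open>dims\<close> makes \<open>L1\<close> and the rotated \<open>L2\<close> meet in a
  nonzero vector and leaves room for their complements to be transversal.\<close>

locale kinematic = haar_orthogonal \<mu> for \<mu> :: "(real^'n^'n) measure" +
  fixes L1 L2 :: "(real^'n) set"
  assumes sub1: "subspace L1" and sub2: "subspace L2" and dims: "CARD('n) < dim L1 + dim L2"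
begin

text \<open>Transversality in dual form: \<open>L1\<close> and the rotated \<open>L2\<close> span
  the space exactly when their complements meet in \<open>0\<close>. This form yields uniqueness of
  the splitting directly.\<close>

definition good :: "(real^'n^'n) set" where
  "good = {Q. orthogonal_matrix Q \<and> (\<forall>x\<in>L1\<^sup>\<bottom>. transpose Q *v x \<in> L2\<^sup>\<bottom> \<longrightarrow> x = 0)}"

text \<open>For good \<open>Q\<close> the three summands form a direct sum; the first is orthogonal
  to the other two, which are in general oblique to each other.\<close>

definition splits :: "(real^'n^'n) \<times> (real^'n) \<Rightarrow> (real^'n) \<times> (real^'n) \<times> (real^'n) \<Rightarrow> bool" where
  "splits = (\<lambda>(Q, g) (x, u, v). x \<in> L1 \<and> transpose Q *v x \<in> L2 \<and> u \<in> L1\<^sup>\<bottom> \<and> v \<in> L2\<^sup>\<bottom> \<and> g = x + u + Q *v v)"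

lemma subc: "subspace (L1\<^sup>\<bottom>)" "subspace (L2\<^sup>\<bottom>)"
  by (rule subspace_orthogonal_comp)+

lemma AE_good: "AE Q in \<mu>. Q \<in> good"
proof -
  have "AE Q in \<mu>. \<forall>x\<in>L1\<^sup>\<bottom>. transpose Q *v x \<in> L2\<^sup>\<bottom> \<longrightarrow> x = 0"
    using dim_orthogonal_comp[OF sub1] dim_orthogonal_comp[OF sub2] dims by (intro AE_subspace_Int_trivial subc) simp
  with AE_orthogonal show ?thesis by eventually_elim (simp add: good_def)
qed

lemma good_sets [measurable]: "good \<in> sets borel"
proof -
  have 1: "closed {Q::real^'n^'n. orthogonal_matrix Q}"
    unfolding orthogonal_matrix by (intro closed_Collect_eq continuous_intros)
  have 2: "{Q::real^'n^'n. \<exists>x. norm x = 1 \<and> x \<in> L1\<^sup>\<bottom> \<and> transpose Q *v x \<in> L2\<^sup>\<bottom>} \<in> sets borel"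
    by (intro borel_meets closed_subspace subc)
  have "good = {Q. orthogonal_matrix Q} - {Q. \<exists>x. norm x = 1 \<and> x \<in> L1\<^sup>\<bottom> \<and> transpose Q *v x \<in> L2\<^sup>\<bottom>}"
    (is "good = ?A - ?B")
  proof (intro set_eqI iffI)
    fix Q assume "Q \<in> good"
    then show "Q \<in> ?A - ?B" by (auto simp: good_def)
  next
    fix Q assume Q: "Q \<in> ?A - ?B"
    have "x = 0" if x: "x \<in> L1\<^sup>\<bottom>" "transpose Q *v x \<in> L2\<^sup>\<bottom>" for x
    proof (rule ccontr)
      assume "x \<noteq> 0"
      then have "norm (x /\<^sub>R norm x) = 1" by simp
      moreover have "x /\<^sub>R norm x \<in> L1\<^sup>\<bottom>" "transpose Q *v (x /\<^sub>R norm x) \<in> L2\<^sup>\<bottom>"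
        using x subc by (auto simp: matrix_vector_mult_scaleR subspace_scale)
      ultimately show False using Q by blast
    qed
    with Q show "Q \<in> good" by (auto simp: good_def)
  qed
  with 1 2 show ?thesis by auto
qed

lemma good_orthogonal: "Q \<in> good \<Longrightarrow> orthogonal_matrix Q"
  by (simp add: good_def)

text \<open>The difference of two splittings splits \<open>0\<close>. Its first part is orthogonal
  to the other two and vanishes; what remains is a vector in both complements, which is
  \<open>0\<close> for good \<open>Q\<close>.\<close>

lemma splits_unique:
  assumes Q: "Q \<in> good" and "splits (Q, g) (x, u, v)" "splits (Q, g) (x', u', v')"
  shows "x = x' \<and> u = u' \<and> v = v'"
proof -
  note o = good_orthogonal[OF Q]
  define y a b where "y = x - x'" and "a = u - u'" and "b = v - v'"
  have y: "y \<in> L1" "transpose Q *v y \<in> L2" and a: "a \<in> L1\<^sup>\<bottom>" and b: "b \<in> L2\<^sup>\<bottom>"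
    using assms(2,3) sub1 sub2 subc unfolding y_def a_def b_def splits_def
    by (auto simp: matrix_vector_mult_diff_distrib intro!: subspace_diff)
  have "x + u + Q *v v = x' + u' + Q *v v'" using assms(2,3) by (simp add: splits_def)
  then have s: "y + a + Q *v b = 0"
    unfolding y_def a_def b_def by (simp add: algebra_simps matrix_vector_mult_diff_distrib)
  have "y \<bullet> a = 0" using y a by (rule_tac orthogonal_comp_inner)
  moreover have "y \<bullet> (Q *v b) = 0"
    using orthogonal_comp_inner(1)[OF y(2) b] inner_matrix_vector_mult[of Q b y]
    by (simp add: inner_commute)
  moreover have "y \<bullet> (y + a + Q *v b) = 0" by (simp add: s)
  ultimately have "y \<bullet> y = 0" by (simp add: inner_add_right)
  then have y0: "y = 0" by simp
  then have a': "a = - (Q *v b)" using s by (simp add: eq_neg_iff_add_eq_0)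
  have "transpose Q *v a = - b"
    using o linear_neg[OF matrix_vector_mul_linear[of "transpose Q"], of "Q *v b"] unfolding a' by simp
  then have "transpose Q *v a \<in> L2\<^sup>\<bottom>" using b subc by (simp add: subspace_neg)
  then have a0: "a = 0" using Q a by (simp add: good_def)
  then have "transpose Q *v (Q *v b) = 0" using a' by simp
  then have "b = 0" using o by simp
  then show ?thesis using y0 a0 by (simp add: y_def a_def b_def)
qed

text \<open>Projecting \<open>g\<close> to the sum of the complement of \<open>L1\<close> and the
  rotated complement of \<open>L2\<close> leaves a residual orthogonal to both, hence in
  \<open>L1\<close> and in the rotated \<open>L2\<close> by double complementation.\<close>

lemma splits_exists:
  assumes Q: "Q \<in> good"
  shows "\<exists>x u v. splits (Q, g) (x, u, v)"
proof -
  note o = good_orthogonal[OF Q]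
  have lin: "linear ((*v) Q)" by simp
  define P where "P = {u + w | u w. u \<in> L1\<^sup>\<bottom> \<and> w \<in> (*v) Q ` (L2\<^sup>\<bottom>)}"
  have P: "subspace P"
    unfolding P_def by (intro subspace_sums subc linear_subspace_image[OF lin])
  define x where "x = g - orth_proj P g"
  have x: "x \<in> P\<^sup>\<bottom>" unfolding x_def by (rule diff_orth_proj_in[OF P])
  obtain u v where uv: "u \<in> L1\<^sup>\<bottom>" "v \<in> L2\<^sup>\<bottom>" "orth_proj P g = u + Q *v v"
    using orth_proj_in[OF P, of g] unfolding P_def by blast
  have "u \<bullet> x = 0" if "u \<in> L1\<^sup>\<bottom>" for u
  proof -
    have "u + Q *v 0 \<in> P" unfolding P_def using that subspace_0[OF subc(2)] by blast
    then show ?thesis using x by (auto simp: mem_orthogonal_comp)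
  qed
  then have "x \<in> L1\<^sup>\<bottom>\<^sup>\<bottom>" by (simp add: mem_orthogonal_comp)
  then have x1: "x \<in> L1" using orthogonal_comp_self[OF sub1] by simp
  have "v \<bullet> (transpose Q *v x) = 0" if "v \<in> L2\<^sup>\<bottom>" for v
  proof -
    have "0 + Q *v v \<in> P" unfolding P_def using that subspace_0[OF subc(1)] by blast
    then show ?thesis using x by (auto simp: mem_orthogonal_comp inner_matrix_vector_mult)
  qed
  then have "transpose Q *v x \<in> L2\<^sup>\<bottom>\<^sup>\<bottom>" by (simp add: mem_orthogonal_comp)
  then have x2: "transpose Q *v x \<in> L2" using orthogonal_comp_self[OF sub2] by simp
  have "g = x + u + Q *v v" using uv(3) by (simp add: x_def)
  then show ?thesis unfolding splits_def using x1 x2 uv by blast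
qed

text \<open>The default \<open>(0, 0, 0)\<close> is taken on a null set of matrices; being constant,
  it keeps \<open>parts\<close> Borel.\<close>

definition parts :: "(real^'n^'n) \<times> (real^'n) \<Rightarrow> (real^'n) \<times> (real^'n) \<times> (real^'n)" where
  "parts z = (if fst z \<in> good then (THE t. splits z t) else (0, 0, 0))"

lemma parts_eq: "Q \<in> good \<Longrightarrow> splits (Q, g) t \<Longrightarrow> parts (Q, g) = t"
  unfolding parts_def using splits_unique by (cases t) (auto intro!: the_equality)

lemma splits_parts: "Q \<in> good \<Longrightarrow> splits (Q, g) (parts (Q, g))"
  using splits_exists parts_eq by metis

text \<open>The relation \<open>splits\<close> is closed, so the preimage of an open set is, over
  \<open>good\<close>, the projection of a closed set intersected with an open one.\<close>

lemma parts_measurable [measurable]: "parts \<in> borel_measurable borel"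
proof (rule borel_measurableI)
  fix U :: "((real^'n) \<times> (real^'n) \<times> (real^'n)) set" assume U: "open U"
  have G: "closed {p. splits (fst p) (snd p)}"
  proof -
    have "closed ((\<lambda>p. fst (snd p)) -` L1 \<inter> (\<lambda>p. transpose (fst (fst p)) *v (fst (snd p))) -` L2 \<inter>
      (\<lambda>p. fst (snd (snd p))) -` (L1\<^sup>\<bottom>) \<inter> (\<lambda>p. snd (snd (snd p))) -` (L2\<^sup>\<bottom>) \<inter>
      {p :: ((real^'n^'n) \<times> (real^'n)) \<times> ((real^'n) \<times> (real^'n) \<times> (real^'n)).
         snd (fst p) = fst (snd p) + fst (snd (snd p)) + fst (fst p) *v snd (snd (snd p))})"
      using sub1 sub2 subc
      by (intro closed_Int closed_vimage closed_Collect_eq closed_subspace continuous_intros)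
    moreover have "{p. splits (fst p) (snd p)} = ((\<lambda>p. fst (snd p)) -` L1 \<inter> (\<lambda>p. transpose (fst (fst p)) *v (fst (snd p))) -` L2 \<inter>
      (\<lambda>p. fst (snd (snd p))) -` (L1\<^sup>\<bottom>) \<inter> (\<lambda>p. snd (snd (snd p))) -` (L2\<^sup>\<bottom>) \<inter>
      {p. snd (fst p) = fst (snd p) + fst (snd (snd p)) + fst (fst p) *v snd (snd (snd p))})"
      by (auto simp: splits_def case_prod_beta)
    ultimately show ?thesis by simp
  qed
  have "open (snd -` U :: (((real^'n^'n) \<times> (real^'n)) \<times> ((real^'n) \<times> (real^'n) \<times> (real^'n))) set)"
    using U by (intro open_vimage_snd)
  from borel_fst_image_closed_Int_open[OF G this]
  have 1: "fst ` ({p. splits (fst p) (snd p)} \<inter> snd -` U) \<in> sets borel" .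
  have 2: "good \<times> (UNIV :: (real^'n) set) \<in> sets borel"
    unfolding borel_prod[symmetric] by measurable
  have "parts -` U \<inter> space borel =
    (good \<times> UNIV \<inter> fst ` ({p. splits (fst p) (snd p)} \<inter> snd -` U)) \<union>
    ((- (good \<times> UNIV)) \<inter> {z. (0, 0, 0) \<in> U})"
    (is "_ = ?R")
  proof (intro set_eqI)
    fix z :: "(real^'n^'n) \<times> (real^'n)"
    obtain Q g where z: "z = (Q, g)" by (cases z)
    have im: "z \<in> fst ` ({p. splits (fst p) (snd p)} \<inter> snd -` U) \<longleftrightarrow> (\<exists>t. splits (Q, g) t \<and> t \<in> U)"
    proof
      assume "\<exists>t. splits (Q, g) t \<and> t \<in> U"
      then obtain t where "((Q, g), t) \<in> {p. splits (fst p) (snd p)} \<inter> snd -` U" by auto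
      then have "fst ((Q, g), t) \<in> fst ` ({p. splits (fst p) (snd p)} \<inter> snd -` U)" by (rule imageI)
      then show "z \<in> fst ` ({p. splits (fst p) (snd p)} \<inter> snd -` U)" by (simp add: z)
    next
      assume "z \<in> fst ` ({p. splits (fst p) (snd p)} \<inter> snd -` U)"
      then obtain q where "z = fst q" "splits (fst q) (snd q)" "snd q \<in> U" by blast
      then show "\<exists>t. splits (Q, g) t \<and> t \<in> U" unfolding z by metis
    qed
    have gd: "z \<in> good \<times> UNIV \<longleftrightarrow> Q \<in> good" by (simp add: z)
    show "z \<in> parts -` U \<inter> space borel \<longleftrightarrow> z \<in> ?R"
    proof (cases "Q \<in> good")
      case True
      have "(\<exists>t. splits (Q, g) t \<and> t \<in> U) \<longleftrightarrow> parts (Q, g) \<in> U"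
        using splits_parts[OF True] parts_eq[OF True] by metis
      then show ?thesis using True im gd by (simp add: z)
    next
      case False
      then show ?thesis using gd by (simp add: z parts_def)
    qed
  qed
  also have "\<dots> \<in> sets borel"
    using 1 2 by (intro sets.Un sets.Int borel_comp) auto
  finally show "parts -` U \<inter> space borel \<in> sets borel" .
qed


text \<open>The part \<open>x\<close> is recorded twice, as a vector of \<open>L1\<close> and,
  pulled back by \<open>transpose Q\<close>, as a vector of \<open>L2\<close>, because it is to be
  tested against a stratum of each cone.\<close>

definition dirs :: "(real^'n^'n) \<times> (real^'n) \<Rightarrow> (real^'n) \<times> (real^'n) \<times> (real^'n) \<times> (real^'n)" where
  "dirs z = (sgn (fst (parts z)), sgn (fst (snd (parts z))),
     sgn (transpose (fst z) *v fst (parts z)), sgn (snd (snd (parts z))))"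

lemma dirs_measurable [measurable]: "dirs \<in> borel_measurable borel"
proof -
  have [measurable]: "(\<lambda>z. fst (parts z)) \<in> borel_measurable borel"
    "(\<lambda>z. fst (snd (parts z))) \<in> borel_measurable borel"
    "(\<lambda>z. snd (snd (parts z))) \<in> borel_measurable borel"
    "fst \<in> borel_measurable (borel :: ((real^'n^'n) \<times> (real^'n)) measure)"
    by ((rule measurable_compose[OF parts_measurable])?, intro borel_measurable_continuous_onI continuous_intros)+
  have "(\<lambda>z. (sgn (fst (parts z)), sgn (fst (snd (parts z))),
     sgn (transpose (fst z) *v fst (parts z)), sgn (snd (snd (parts z)))))
    \<in> borel \<rightarrow>\<^sub>M borel \<Otimes>\<^sub>M borel \<Otimes>\<^sub>M borel \<Otimes>\<^sub>M borel"
    by measurable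
  then show ?thesis unfolding borel_prod by (simp add: dirs_def[abs_def])
qed

definition gdirs :: "(real^'n) \<times> (real^'n) \<Rightarrow> (real^'n) \<times> (real^'n) \<times> (real^'n) \<times> (real^'n)" where
  "gdirs = (\<lambda>(g, h). (sgn (orth_proj L1 g), sgn (g - orth_proj L1 g),
     sgn (orth_proj L2 h), sgn (h - orth_proj L2 h)))"

lemma orth_proj_measurable [measurable]:
  "orth_proj L1 \<in> borel_measurable borel" "orth_proj L2 \<in> borel_measurable borel"
  using borel_measurable_linear linear_orth_proj sub1 sub2 by blast+

lemma gdirs_measurable [measurable]: "gdirs \<in> borel_measurable borel"
proof -
  have "gdirs \<in> borel \<Otimes>\<^sub>M borel \<rightarrow>\<^sub>M borel \<Otimes>\<^sub>M borel \<Otimes>\<^sub>M borel \<Otimes>\<^sub>M borel"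
    unfolding gdirs_def by measurable
  then show ?thesis unfolding borel_prod .
qed

definition K :: "((real^'n) \<times> (real^'n) \<times> (real^'n) \<times> (real^'n)) set" where
  "K = directions L1 \<times> directions (L1\<^sup>\<bottom>) \<times> directions L2 \<times> directions (L2\<^sup>\<bottom>)"

lemma K_transitive:
  assumes "k \<in> K" "k' \<in> K"
  obtains a b c d where "a \<in> L1" "b \<in> L1\<^sup>\<bottom>" "c \<in> L2" "d \<in> L2\<^sup>\<bottom>" "reflect4 a b c d k = k'"
proof -
  obtain x y z w x' y' z' w' where k: "k = (x, y, z, w)" "k' = (x', y', z', w')"
    by (metis prod_cases4)
  then have m: "x \<in> directions L1" "x' \<in> directions L1" "y \<in> directions (L1\<^sup>\<bottom>)" "y' \<in> directions (L1\<^sup>\<bottom>)"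
    "z \<in> directions L2" "z' \<in> directions L2" "w \<in> directions (L2\<^sup>\<bottom>)" "w' \<in> directions (L2\<^sup>\<bottom>)"
    using assms by (auto simp: K_def)
  obtain a where "a \<in> L1" "reflect a x = x'" using directions_transitive[OF sub1 m(1,2)] .
  moreover obtain b where "b \<in> L1\<^sup>\<bottom>" "reflect b y = y'" using directions_transitive[OF subc(1) m(3,4)] .
  moreover obtain c where "c \<in> L2" "reflect c z = z'" using directions_transitive[OF sub2 m(5,6)] .
  moreover obtain d where "d \<in> L2\<^sup>\<bottom>" "reflect d w = w'" using directions_transitive[OF subc(2) m(7,8)] .
  ultimately show ?thesis using that k by (auto simp: reflect4_def)
qed

lemma L_nonzero: "L1 \<noteq> {0}" "L2 \<noteq> {0}"
proof -
  have "dim L1 \<le> CARD('n)" "dim L2 \<le> CARD('n)"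
    using dim_subset_UNIV[of L1] dim_subset_UNIV[of L2] by simp_all
  then show "L1 \<noteq> {0}" "L2 \<noteq> {0}" using dims by auto
qed

lemma comp_neq_UNIV: "S \<noteq> {0} \<Longrightarrow> subspace S \<Longrightarrow> S\<^sup>\<bottom> \<noteq> UNIV" for S :: "(real^'n) set"
  using orthogonal_comp_self[of S] by auto

lemma AE_orth_proj_directions:
  fixes S :: "(real^'n) set"
  assumes S: "subspace S" and "S \<noteq> {0}"
  shows "AE g in std_gaussian. sgn (orth_proj S g) \<in> directions S \<and>
    sgn (g - orth_proj S g) \<in> directions (S\<^sup>\<bottom>)"
proof -
  have "AE g in std_gaussian. g \<notin> S\<^sup>\<bottom>"
    using assms by (intro std_gaussian_AE_notin_proper_subspace subspace_orthogonal_comp comp_neq_UNIV)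
  moreover have "AE g in std_gaussian. S\<^sup>\<bottom> \<noteq> {0} \<longrightarrow> g \<notin> S"
  proof (cases "S\<^sup>\<bottom> = {0}")
    case False
    then have "S \<noteq> UNIV" by auto
    then have "AE g in std_gaussian. g \<notin> S"
      by (intro std_gaussian_AE_notin_proper_subspace S)
    then show ?thesis by simp
  qed simp
  ultimately show ?thesis
  proof eventually_elim
    case (elim g)
    have "orth_proj S g \<noteq> 0" using diff_orth_proj_in[OF S, of g] elim(1) by auto
    moreover have "g - orth_proj S g \<noteq> 0" if "S\<^sup>\<bottom> \<noteq> {0}"
      using orth_proj_in[OF S, of g] elim(2) that by auto
    ultimately show ?case
      by (intro conjI sgn_in_directions S subspace_orthogonal_comp orth_proj S) auto
  qed
qed

text \<open>A part of \<open>g\<close> vanishes only if \<open>g\<close> lies in the sum of the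
  other two summands. Each such sum is a proper subspace and so a Gaussian null set, unless the part
  in question ranges over \<open>{0}\<close>, whose only direction is \<open>0\<close>.\<close>

lemma AE_parts_directions:
  assumes Q: "Q \<in> good"
  shows "AE g in std_gaussian. dirs (Q, g) \<in> K"
proof -
  note o = good_orthogonal[OF Q]
  have lin: "linear ((*v) Q)" "linear ((*v) (transpose Q))" by simp_all
  define Lx where "Lx = L1 \<inter> (*v) Q ` L2"
  define Lv where "Lv = (*v) Q ` (L2\<^sup>\<bottom>)"
  note img' = in_rotated_image_iff[OF o]
  have Lx: "subspace Lx" and Lv: "subspace Lv"
    unfolding Lx_def Lv_def by (auto intro!: subspace_inter sub1 linear_subspace_image[OF lin(1)] sub2 subc)
  have inner0: "x \<bullet> y = 0" if "x \<in> Lx" "y \<in> L1\<^sup>\<bottom> \<or> y \<in> Lv" for x y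
    using that orthogonal_comp_inner(1)[of x L1 y] orthogonal_comp_inner(1)[of "transpose Q *v x" L2 "transpose Q *v y"] o
    unfolding Lx_def Lv_def img' by (auto simp: inner_matrix_vector_mult img')
  have splits_iff: "splits (Q, g) (x, u, v) \<longleftrightarrow> x \<in> Lx \<and> u \<in> L1\<^sup>\<bottom> \<and> v \<in> L2\<^sup>\<bottom> \<and> g = x + u + Q *v v" for g x u v
    by (auto simp: splits_def Lx_def img')
  \<comment> \<open>By the dimension formula the intersection has dimension at least
    \<open>dim L1 + dim L2 - d\<close>, which is positive by \<open>dims\<close>.\<close>
  have Lx0: "Lx \<noteq> {0}"
  proof
    assume "Lx = {0}"
    moreover have "dim {x + y | x y. x \<in> L1 \<and> y \<in> (*v) Q ` L2} + dim Lx = dim L1 + dim ((*v) Q ` L2)"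
      unfolding Lx_def by (intro dim_sums_Int sub1 linear_subspace_image lin sub2)
    moreover have "dim ((*v) Q ` L2) = dim L2"
      using o by (intro dim_image_eq lin) (metis inj_on_def orthogonal_matrix_mult_transpose(1))
    moreover have "dim {x + y | x y. x \<in> L1 \<and> y \<in> (*v) Q ` L2} \<le> CARD('n)"
      using dim_subset_UNIV[of "{x + y | x y. x \<in> L1 \<and> y \<in> (*v) Q ` L2}"] by simp
    ultimately show False using dims by simp
  qed
  have 1: "AE g in std_gaussian. g \<notin> {u + w | u w. u \<in> L1\<^sup>\<bottom> \<and> w \<in> Lv}"
  proof (intro std_gaussian_AE_notin_proper_subspace subspace_sums subc Lv)
    obtain x where x: "x \<in> Lx" "x \<noteq> 0" using Lx0 subspace_0[OF Lx] by blast
    have "x \<notin> {u + w | u w. u \<in> L1\<^sup>\<bottom> \<and> w \<in> Lv}"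
    proof
      assume "x \<in> {u + w | u w. u \<in> L1\<^sup>\<bottom> \<and> w \<in> Lv}"
      then obtain u w where uw: "u \<in> L1\<^sup>\<bottom>" "w \<in> Lv" "x = u + w" by blast
      have "x \<bullet> (u + w) = 0" using uw x(1) inner0 by (simp only: inner_add_right) simp
      then have "x \<bullet> x = 0" using uw(3) by simp
      then show False using x(2) by simp
    qed
    then show "{u + w | u w. u \<in> L1\<^sup>\<bottom> \<and> w \<in> Lv} \<noteq> UNIV" by blast
  qed
  have 2: "AE g in std_gaussian. L1\<^sup>\<bottom> \<noteq> {0} \<longrightarrow> g \<notin> {x + w | x w. x \<in> Lx \<and> w \<in> Lv}"
  proof (cases "L1\<^sup>\<bottom> = {0}")
    case False
    then obtain b where b: "b \<in> L1\<^sup>\<bottom>" "b \<noteq> 0" using subspace_0[OF subc(1)] by blast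
    have "b \<notin> {x + w | x w. x \<in> Lx \<and> w \<in> Lv}"
    proof
      assume "b \<in> {x + w | x w. x \<in> Lx \<and> w \<in> Lv}"
      then obtain x v where "x \<in> Lx" "v \<in> L2\<^sup>\<bottom>" "b = x + Q *v v" by (auto simp: Lv_def)
      then have "splits (Q, b) (x, 0, v)" "splits (Q, b) (0, b, 0)"
        using b subspace_0[OF Lx] subspace_0[OF subc(1)] subspace_0[OF subc(2)] by (auto simp: splits_iff)
      then show False using splits_unique[OF Q] b(2) by blast
    qed
    then have "{x + w | x w. x \<in> Lx \<and> w \<in> Lv} \<noteq> UNIV" by blast
    then have "AE g in std_gaussian. g \<notin> {x + w | x w. x \<in> Lx \<and> w \<in> Lv}"
      by (intro std_gaussian_AE_notin_proper_subspace subspace_sums Lx Lv)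
    then show ?thesis by simp
  qed simp
  have 3: "AE g in std_gaussian. L2\<^sup>\<bottom> \<noteq> {0} \<longrightarrow> g \<notin> {x + u | x u. x \<in> Lx \<and> u \<in> L1\<^sup>\<bottom>}"
  proof (cases "L2\<^sup>\<bottom> = {0}")
    case False
    then obtain b where b: "b \<in> L2\<^sup>\<bottom>" "b \<noteq> 0" using subspace_0[OF subc(2)] by blast
    have "Q *v b \<notin> {x + u | x u. x \<in> Lx \<and> u \<in> L1\<^sup>\<bottom>}"
    proof
      assume "Q *v b \<in> {x + u | x u. x \<in> Lx \<and> u \<in> L1\<^sup>\<bottom>}"
      then obtain x u where "x \<in> Lx" "u \<in> L1\<^sup>\<bottom>" "Q *v b = x + u" by auto
      then have "splits (Q, Q *v b) (x, u, 0)" "splits (Q, Q *v b) (0, 0, b)"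
        using b subspace_0[OF Lx] subspace_0[OF subc(1)] subspace_0[OF subc(2)] by (auto simp: splits_iff)
      then show False using splits_unique[OF Q] b(2) by blast
    qed
    then have "{x + u | x u. x \<in> Lx \<and> u \<in> L1\<^sup>\<bottom>} \<noteq> UNIV" by blast
    then have "AE g in std_gaussian. g \<notin> {x + u | x u. x \<in> Lx \<and> u \<in> L1\<^sup>\<bottom>}"
      by (intro std_gaussian_AE_notin_proper_subspace subspace_sums Lx subc)
    then show ?thesis by simp
  qed simp
  from 1 2 3 show ?thesis
  proof eventually_elim
    case (elim g)
    obtain x u v where p: "parts (Q, g) = (x, u, v)" by (cases "parts (Q, g)")
    then have s: "splits (Q, g) (x, u, v)" using splits_parts[OF Q, of g] by simp
    then have m: "x \<in> Lx" "u \<in> L1\<^sup>\<bottom>" "v \<in> L2\<^sup>\<bottom>" "Q *v v \<in> Lv" "g = x + u + Q *v v"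
      by (auto simp: splits_iff Lv_def)
    have x: "x \<in> L1" "transpose Q *v x \<in> L2" using s by (auto simp: splits_def)
    have "x \<noteq> 0" using elim(1) m by auto
    moreover from this have "transpose Q *v x \<noteq> 0"
      using o by (metis matrix_vector_mult_0_right orthogonal_matrix_mult_transpose(2))
    moreover have "u \<noteq> 0" if "L1\<^sup>\<bottom> \<noteq> {0}"
      using elim(2) that m by auto
    moreover have "v \<noteq> 0" if "L2\<^sup>\<bottom> \<noteq> {0}"
      using elim(3) that m by auto
    ultimately show ?case
      unfolding dirs_def K_def p using x m
      by (auto intro!: sgn_in_directions sub1 sub2 subc)
  qed
qed

text \<open>\<open>U\<close> acts on \<open>L1\<close> as \<open>reflect a\<close> and on its
  complement as \<open>reflect b\<close>; \<open>transpose W\<close> acts on \<open>L2\<close> as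
  \<open>reflect c\<close> and on its complement as \<open>reflect d\<close>. Applying
  \<open>U\<close> to \<open>g = x + u + Q *v v\<close> and inserting
  \<open>W ** transpose W\<close> before \<open>v\<close> gives the splitting of the moved
  pair.\<close>

lemma parts_transform:
  assumes Q: "Q \<in> good" and ab: "a \<in> L1" "b \<in> L1\<^sup>\<bottom>" and cd: "c \<in> L2" "d \<in> L2\<^sup>\<bottom>"
  defines "U \<equiv> matrix (reflect a) ** matrix (reflect b)"
    and "W \<equiv> matrix (reflect d) ** matrix (reflect c)"
  shows "U ** Q ** W \<in> good"
    and "dirs (U ** Q ** W, U *v g) = reflect4 a b c d (dirs (Q, g))"
proof -
  note o = good_orthogonal[OF Q]
  have U: "U *v x = reflect a (reflect b x)" for x
    by (simp add: U_def matrix_vector_mul_assoc[symmetric] matrix_reflect_mult)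
  have Ut: "transpose U *v x = reflect b (reflect a x)" for x
    by (simp add: U_def matrix_transpose_mul transpose_matrix_reflect matrix_vector_mul_assoc[symmetric] matrix_reflect_mult)
  have W: "W *v x = reflect d (reflect c x)" for x
    by (simp add: W_def matrix_vector_mul_assoc[symmetric] matrix_reflect_mult)
  have Wt: "transpose W *v x = reflect c (reflect d x)" for x
    by (simp add: W_def matrix_transpose_mul transpose_matrix_reflect matrix_vector_mul_assoc[symmetric] matrix_reflect_mult)
  have oU: "orthogonal_matrix U" and oW: "orthogonal_matrix W"
    unfolding U_def W_def by (intro orthogonal_matrix_mul orthogonal_matrix_reflect)+
  have fix1: "reflect b x = x" if "x \<in> L1" for x
    using orthogonal_comp_inner(2)[OF ab(2) that] by (rule reflect_orthogonal)
  have fix2: "reflect a x = x" if "x \<in> L1\<^sup>\<bottom>" for x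
    using orthogonal_comp_inner(1)[OF ab(1) that] by (rule reflect_orthogonal)
  have fix3: "reflect d x = x" if "x \<in> L2" for x
    using orthogonal_comp_inner(2)[OF cd(2) that] by (rule reflect_orthogonal)
  have fix4: "reflect c x = x" if "x \<in> L2\<^sup>\<bottom>" for x
    using orthogonal_comp_inner(1)[OF cd(1) that] by (rule reflect_orthogonal)
  have tr: "transpose (U ** Q ** W) *v x = transpose W *v (transpose Q *v (transpose U *v x))" for x
    by (simp add: matrix_transpose_mul matrix_vector_mul_assoc matrix_mul_assoc)
  show good: "U ** Q ** W \<in> good"
    unfolding good_def
  proof (safe)
    show "orthogonal_matrix (U ** Q ** W)" using o oU oW by (intro orthogonal_matrix_mul)
    fix x assume x: "x \<in> L1\<^sup>\<bottom>" "transpose (U ** Q ** W) *v x \<in> L2\<^sup>\<bottom>"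
    define y where "y = transpose U *v x"
    have y: "y \<in> L1\<^sup>\<bottom>" unfolding y_def Ut using fix2[OF x(1)] x(1) ab(2) subc(1)
      by (simp add: reflect_in_subspace)
    define z where "z = transpose W *v (transpose Q *v y)"
    have z: "z \<in> L2\<^sup>\<bottom>" using x(2) by (simp add: z_def y_def tr)
    have "transpose Q *v y = W *v z" unfolding z_def using oW by simp
    also have "\<dots> \<in> L2\<^sup>\<bottom>" unfolding W fix4[OF z] by (intro reflect_in_subspace subc cd z)
    finally have "y = 0" using Q y by (simp add: good_def)
    then have "U *v (transpose U *v x) = 0" by (simp add: y_def)
    then show "x = 0" using oU by simp
  qed
  obtain x u v where p: "parts (Q, g) = (x, u, v)" by (cases "parts (Q, g)")
  then have s: "splits (Q, g) (x, u, v)" using splits_parts[OF Q, of g] by simp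
  have x: "x \<in> L1" "transpose Q *v x \<in> L2" "u \<in> L1\<^sup>\<bottom>" "v \<in> L2\<^sup>\<bottom>" "g = x + u + Q *v v"
    using s by (auto simp: splits_def)
  have trx: "transpose (U ** Q ** W) *v reflect a x = reflect c (transpose Q *v x)"
    unfolding tr Ut Wt using fix1[OF x(1)] fix3[OF x(2)] by simp
  have Wv: "W *v reflect d v = v"
    unfolding W using fix4[OF reflect_in_subspace[OF subc(2) cd(2) x(4)]] by simp
  have "splits (U ** Q ** W, U *v g) (reflect a x, reflect b u, reflect d v)"
    unfolding splits_def
  proof (simp add: trx, intro conjI)
    show "reflect a x \<in> L1" "reflect c (transpose Q *v x) \<in> L2" "reflect b u \<in> L1\<^sup>\<bottom>" "reflect d v \<in> L2\<^sup>\<bottom>"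
      using x ab cd sub1 sub2 subc by (auto intro: reflect_in_subspace)
    have "U *v g = U *v x + U *v u + U *v (Q *v v)"
      unfolding x(5) by (simp add: matrix_vector_right_distrib)
    moreover have "U *v x = reflect a x" unfolding U fix1[OF x(1)] ..
    moreover have "U *v u = reflect b u"
      unfolding U using fix2[OF reflect_in_subspace[OF subc(1) ab(2) x(3)]] .
    moreover have "U ** Q ** W *v reflect d v = U *v (Q *v v)"
      by (simp add: matrix_vector_mul_assoc[symmetric] Wv)
    ultimately show "U *v g = reflect a x + reflect b u + U ** Q ** W *v reflect d v" by simp
  qed
  then have "parts (U ** Q ** W, U *v g) = (reflect a x, reflect b u, reflect d v)"
    by (rule parts_eq[OF good])
  then show "dirs (U ** Q ** W, U *v g) = reflect4 a b c d (dirs (Q, g))"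
    unfolding dirs_def p by (simp add: trx sgn_reflect reflect4_def)
qed


section \<open>Invariance and equality of the two laws of directions\<close>

lemma sets_pair [simp]:
  "sets (\<mu> \<Otimes>\<^sub>M (std_gaussian :: (real^'n) measure)) = sets borel"
proof -
  have "sets (\<mu> \<Otimes>\<^sub>M (std_gaussian :: (real^'n) measure)) = sets (borel \<Otimes>\<^sub>M borel)"
    by (intro sets_pair_measure_cong) simp_all
  then show ?thesis by (simp only: borel_prod)
qed

lemma sets_gaussian_pair [simp]:
  "sets ((std_gaussian :: (real^'n) measure) \<Otimes>\<^sub>M (std_gaussian :: (real^'n) measure)) = sets borel"
  unfolding std_gaussian_pair by (rule sets_std_gaussian)

lemma dirs_measurable_pair [measurable]: "dirs \<in> borel_measurable (\<mu> \<Otimes>\<^sub>M std_gaussian)"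
  and gdirs_measurable_pair [measurable]: "gdirs \<in> borel_measurable (std_gaussian \<Otimes>\<^sub>M std_gaussian)"
  using dirs_measurable gdirs_measurable sets_pair sets_gaussian_pair
  by (simp_all cong: measurable_cong_sets)

lemma distr_haar_two_sided:
  assumes "orthogonal_matrix U" "orthogonal_matrix W"
  shows "distr \<mu> borel (\<lambda>Q. U ** Q ** W) = \<mu>"
proof (rule measure_eqI)
  fix A assume "A \<in> sets (distr \<mu> borel (\<lambda>Q. U ** Q ** W))"
  then have A[measurable]: "A \<in> sets borel" by simp
  have "emeasure (distr \<mu> borel (\<lambda>Q. U ** Q ** W)) A =
      (\<integral>\<^sup>+Q. indicator A Q \<partial>distr \<mu> borel (\<lambda>Q. U ** Q ** W))"
    by simp
  also have "\<dots> = (\<integral>\<^sup>+Q. indicator A (U ** Q ** W) \<partial>\<mu>)"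
    by (rule nn_integral_distr) auto
  also have "\<dots> = (\<integral>\<^sup>+Q. indicator A (Q ** W) \<partial>\<mu>)"
    by (rule nn_integral_left[OF assms(1), where f = "\<lambda>Q. indicator A (Q ** W)"]) measurable
  also have "\<dots> = (\<integral>\<^sup>+Q. indicator A Q \<partial>\<mu>)"
    by (rule nn_integral_right[OF assms(2)]) measurable
  finally show "emeasure (distr \<mu> borel (\<lambda>Q. U ** Q ** W)) A = emeasure \<mu> A" by simp
qed simp

lemma orthogonal_transformation_mult:
  fixes U :: "real^'n^'n"
  shows "orthogonal_matrix U \<Longrightarrow> orthogonal_transformation ((*v) U)"
  by (simp add: orthogonal_transformation norm_orthogonal_matrix_mult)

lemma distr_pair_transform:
  assumes "orthogonal_matrix U" "orthogonal_matrix W"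
  shows "distr (\<mu> \<Otimes>\<^sub>M std_gaussian) borel (\<lambda>(Q, g). (U ** Q ** W, U *v g)) = \<mu> \<Otimes>\<^sub>M std_gaussian"
proof -
  have g: "distr std_gaussian borel ((*v) U) = std_gaussian"
    by (intro distr_std_gaussian_orthogonal_transformation orthogonal_transformation_mult assms)
  have "distr \<mu> borel (\<lambda>Q. U ** Q ** W) \<Otimes>\<^sub>M distr std_gaussian borel ((*v) U) =
    distr (\<mu> \<Otimes>\<^sub>M std_gaussian) (borel \<Otimes>\<^sub>M borel) (\<lambda>(Q, g). (U ** Q ** W, U *v g))"
    by (rule pair_measure_distr) (auto simp: g std_gaussian.sigma_finite_measure_axioms)
  then show ?thesis
    by (simp add: distr_haar_two_sided assms g borel_prod)
qed

lemma K_sets [measurable]: "K \<in> sets borel"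
proof -
  have "closed (directions S)" if "subspace S" for S :: "(real^'n) set"
  proof -
    have "directions S = S \<inter> {x. norm x = (if S = {0} then 0 else 1)}"
      by (auto simp: directions_def)
    then show ?thesis
      using closed_subspace[OF that] by (auto intro!: closed_Int closed_Collect_eq continuous_intros)
  qed
  then show ?thesis
    unfolding K_def using sub1 sub2 subc by (intro borel_closed closed_Times)
qed

lemma AE_dirs_K: "AE z in \<mu> \<Otimes>\<^sub>M std_gaussian. dirs z \<in> K"
proof -
  interpret P: pair_sigma_finite \<mu> "std_gaussian :: (real^'n) measure"
    by (simp add: pair_sigma_finite_def sigma_finite_measure_axioms std_gaussian.sigma_finite_measure_axioms)
  show ?thesis
  proof (rule P.AE_pair_measure)
    show "{z \<in> space (\<mu> \<Otimes>\<^sub>M std_gaussian). dirs z \<in> K} \<in> sets (\<mu> \<Otimes>\<^sub>M std_gaussian)"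
      by measurable
    show "AE Q in \<mu>. AE g in std_gaussian. dirs (Q, g) \<in> K"
      using AE_good AE_parts_directions by (auto elim!: eventually_mono)
  qed
qed

lemma AE_gdirs_K:
  "AE z in (std_gaussian :: (real^'n) measure) \<Otimes>\<^sub>M (std_gaussian :: (real^'n) measure). gdirs z \<in> K"
proof -
  interpret P: pair_sigma_finite "std_gaussian :: (real^'n) measure" "std_gaussian :: (real^'n) measure"
    by (simp add: pair_sigma_finite_def std_gaussian.sigma_finite_measure_axioms)
  show ?thesis
  proof (rule P.AE_pair_measure)
    show "{z \<in> space ((std_gaussian :: (real^'n) measure) \<Otimes>\<^sub>M (std_gaussian :: (real^'n) measure)). gdirs z \<in> K}
      \<in> sets (std_gaussian \<Otimes>\<^sub>M std_gaussian)"
      by measurable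
    have *: "AE h in std_gaussian. gdirs (g, h) \<in> K"
      if "sgn (orth_proj L1 g) \<in> directions L1 \<and> sgn (g - orth_proj L1 g) \<in> directions (L1\<^sup>\<bottom>)" for g
      using AE_orth_proj_directions[OF sub2 L_nonzero(2)]
      by eventually_elim (use that in \<open>auto simp: gdirs_def K_def\<close>)
    show "AE g in std_gaussian. AE h in std_gaussian. gdirs (g, h) \<in> K"
      using AE_orth_proj_directions[OF sub1 L_nonzero(1)] by eventually_elim (rule *)
  qed
qed

text \<open>Both laws live on \<open>K\<close> and are invariant under the isometries
  \<open>reflect4\<close>, which act transitively on \<open>K\<close>; hence balls of equal radius
  centred in \<open>K\<close> have equal mass, as the uniqueness theorem demands.\<close>

theorem distr_dirs_eq:
  "distr (\<mu> \<Otimes>\<^sub>M std_gaussian) borel dirs = distr (std_gaussian \<Otimes>\<^sub>M std_gaussian) borel gdirs"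
  (is "?\<nu>1 = ?\<nu>2")
proof (rule prob_measure_eqI_uniformly_distributed[where K = K])
  interpret P: pair_prob_space \<mu> "std_gaussian :: (real^'n) measure"
    by (simp add: pair_prob_space_def pair_sigma_finite_def prob_space_axioms prob_space_std_gaussian
      sigma_finite_measure_axioms std_gaussian.sigma_finite_measure_axioms)
  interpret G: pair_prob_space "std_gaussian :: (real^'n) measure" "std_gaussian :: (real^'n) measure"
    by (simp add: pair_prob_space_def pair_sigma_finite_def prob_space_std_gaussian
      std_gaussian.sigma_finite_measure_axioms)
  show "prob_space ?\<nu>1" by (rule P.prob_space_distr) measurable
  show "prob_space ?\<nu>2" by (rule G.prob_space_distr) measurable
  show "AE x in ?\<nu>1. x \<in> K" using AE_dirs_K by (subst AE_distr_iff) auto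
  show "AE x in ?\<nu>2. x \<in> K" using AE_gdirs_K by (subst AE_distr_iff) auto
  have inv: "distr ?\<nu>1 borel (reflect4 a b c d) = ?\<nu>1" "distr ?\<nu>2 borel (reflect4 a b c d) = ?\<nu>2"
    if abcd: "a \<in> L1" "b \<in> L1\<^sup>\<bottom>" "c \<in> L2" "d \<in> L2\<^sup>\<bottom>" for a b c d
  proof -
    \<comment> \<open>\<open>V\<close> moves the second Gaussian vector. On the rotation side its
      transpose \<open>W\<close> takes over, since \<open>Q\<close> is multiplied from the right and
      directions in \<open>L2\<close> are read through \<open>transpose Q\<close>.\<close>
    define U V W where "U = matrix (reflect a) ** matrix (reflect b)"
      and "V = matrix (reflect c) ** matrix (reflect d)"
      and "W = matrix (reflect d) ** matrix (reflect c)"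
    have oU: "orthogonal_matrix U" and oV: "orthogonal_matrix V" and oW: "orthogonal_matrix W"
      unfolding U_def V_def W_def by (intro orthogonal_matrix_mul orthogonal_matrix_reflect)+
    let ?\<Phi> = "\<lambda>(Q, g). (U ** Q ** W, U *v g)"
    have [measurable]: "?\<Phi> \<in> borel_measurable (\<mu> \<Otimes>\<^sub>M std_gaussian)"
    proof -
      have "?\<Phi> \<in> \<mu> \<Otimes>\<^sub>M std_gaussian \<rightarrow>\<^sub>M borel \<Otimes>\<^sub>M borel" by measurable
      then show ?thesis by (simp add: borel_prod)
    qed
    have "distr ?\<nu>1 borel (reflect4 a b c d) = distr (\<mu> \<Otimes>\<^sub>M std_gaussian) borel (\<lambda>z. reflect4 a b c d (dirs z))"
      by (subst distr_distr) (auto simp: comp_def)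
    also have "\<dots> = distr (\<mu> \<Otimes>\<^sub>M std_gaussian) borel (\<lambda>z. dirs (?\<Phi> z))"
    \<comment> \<open>The equivariance of \<open>dirs\<close> holds for good \<open>Q\<close>, so
      the two maps are compared almost everywhere.\<close>
    proof (rule distr_cong_AE[OF refl refl])
      have "AE z in \<mu> \<Otimes>\<^sub>M (std_gaussian :: (real^'n) measure). fst z \<in> good"
      proof (rule P.AE_pair_measure)
        have "fst -` good \<inter> space (\<mu> \<Otimes>\<^sub>M (std_gaussian :: (real^'n) measure)) \<in> sets (\<mu> \<Otimes>\<^sub>M std_gaussian)"
          by (rule measurable_sets[OF measurable_fst]) simp
        then show "{z \<in> space (\<mu> \<Otimes>\<^sub>M (std_gaussian :: (real^'n) measure)). fst z \<in> good} \<in> sets (\<mu> \<Otimes>\<^sub>M std_gaussian)"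
          by (rule back_subst[of "\<lambda>X. X \<in> sets (\<mu> \<Otimes>\<^sub>M std_gaussian)"]) auto
      qed (use AE_good in simp)
      then show "AE z in \<mu> \<Otimes>\<^sub>M std_gaussian. reflect4 a b c d (dirs z) = dirs (?\<Phi> z)"
      proof eventually_elim
        case (elim z)
        then show ?case
          using parts_transform(2)[OF _ abcd, of "fst z" "snd z"] by (simp add: U_def W_def case_prod_beta)
      qed
    qed measurable
    also have "\<dots> = distr (distr (\<mu> \<Otimes>\<^sub>M std_gaussian) borel ?\<Phi>) borel dirs"
      by (subst distr_distr) (auto simp: comp_def)
    also have "\<dots> = ?\<nu>1" using distr_pair_transform[OF oU oW] by simp
    finally show "distr ?\<nu>1 borel (reflect4 a b c d) = ?\<nu>1" .
    let ?\<Psi> = "\<lambda>(g :: real^'n, h :: real^'n). (U *v g, V *v h)"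
    have [measurable]: "?\<Psi> \<in> borel_measurable (std_gaussian \<Otimes>\<^sub>M std_gaussian)"
    proof -
      have "?\<Psi> \<in> std_gaussian \<Otimes>\<^sub>M std_gaussian \<rightarrow>\<^sub>M borel \<Otimes>\<^sub>M borel" by measurable
      then show ?thesis by (simp add: borel_prod)
    qed
    have gU: "distr std_gaussian borel ((*v) U) = std_gaussian"
      and gV: "distr std_gaussian borel ((*v) V) = std_gaussian"
      by (intro distr_std_gaussian_orthogonal_transformation orthogonal_transformation_mult oU oV)+
    have "distr std_gaussian borel ((*v) U) \<Otimes>\<^sub>M distr std_gaussian borel ((*v) V) =
      distr (std_gaussian \<Otimes>\<^sub>M std_gaussian) (borel \<Otimes>\<^sub>M borel) ?\<Psi>"
      by (rule pair_measure_distr) (auto simp: gV std_gaussian.sigma_finite_measure_axioms)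
    then have \<Psi>: "distr (std_gaussian \<Otimes>\<^sub>M std_gaussian) borel ?\<Psi> = std_gaussian \<Otimes>\<^sub>M std_gaussian"
      by (simp add: gU gV borel_prod)
    have UV: "U *v x = reflect a (reflect b x)" "V *v x = reflect c (reflect d x)" for x
      by (simp_all add: U_def V_def matrix_vector_mul_assoc[symmetric] matrix_reflect_mult)
    have r: "reflect a (reflect b g) - reflect a (orth_proj L1 g) = reflect b (g - orth_proj L1 g)"
        "reflect c (reflect d g) - reflect c (orth_proj L2 g) = reflect d (g - orth_proj L2 g)" for g
      using orth_proj_double_reflect[OF sub1 abcd(1,2), of g]
        orth_proj_double_reflect[OF sub2 abcd(3,4), of g] by metis+
    have "distr ?\<nu>2 borel (reflect4 a b c d) = distr (std_gaussian \<Otimes>\<^sub>M std_gaussian) borel (\<lambda>z. reflect4 a b c d (gdirs z))"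
      by (subst distr_distr) (auto simp: comp_def)
    also have "(\<lambda>z. reflect4 a b c d (gdirs z)) = (\<lambda>z. gdirs (?\<Psi> z))"
      by (auto simp: fun_eq_iff gdirs_def reflect4_def UV sgn_reflect
          orth_proj_double_reflect(1)[OF sub1 abcd(1,2)] orth_proj_double_reflect(1)[OF sub2 abcd(3,4)] r)
    also have "distr (std_gaussian \<Otimes>\<^sub>M std_gaussian) borel (\<lambda>z. gdirs (?\<Psi> z)) =
        distr (distr (std_gaussian \<Otimes>\<^sub>M std_gaussian) borel ?\<Psi>) borel gdirs"
      by (subst distr_distr) (auto simp: comp_def)
    also have "\<dots> = ?\<nu>2" by (simp only: \<Psi>)
    finally show "distr ?\<nu>2 borel (reflect4 a b c d) = ?\<nu>2" .
  qed
  show "emeasure ?\<nu>1 (ball x r) = emeasure ?\<nu>1 (ball y r)" if xy: "x \<in> K" "y \<in> K" for r x y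
  proof -
    obtain a b c d where abcd: "a \<in> L1" "b \<in> L1\<^sup>\<bottom>" "c \<in> L2" "d \<in> L2\<^sup>\<bottom>" "reflect4 a b c d x = y"
      using K_transitive[OF xy] .
    show ?thesis
      using emeasure_ball_invariant[OF _ inv(1)[OF abcd(1-4)] borel_measurable_reflect4 dist_reflect4, of x r]
      by (simp add: abcd(5))
  qed
  show "emeasure ?\<nu>2 (ball x r) = emeasure ?\<nu>2 (ball y r)" if xy: "x \<in> K" "y \<in> K" for r x y
  proof -
    obtain a b c d where abcd: "a \<in> L1" "b \<in> L1\<^sup>\<bottom>" "c \<in> L2" "d \<in> L2\<^sup>\<bottom>" "reflect4 a b c d x = y"
      using K_transitive[OF xy] .
    show ?thesis
      using emeasure_ball_invariant[OF _ inv(2)[OF abcd(1-4)] borel_measurable_reflect4 dist_reflect4, of x r]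
      by (simp add: abcd(5))
  qed
qed simp_all

text \<open>The four sets are invariant under scaling, so for good \<open>Q\<close> the event is a
  condition on \<open>dirs\<close> alone. Passing to the law of \<open>gdirs\<close> turns it into a
  product set, and independence of the two Gaussian vectors gives the product.\<close>

theorem nn_integral_kinematic:
  fixes A A' B B' :: "(real^'n) set"
  assumes s: "\<And>x. sgn x \<in> A \<longleftrightarrow> x \<in> A" "\<And>x. sgn x \<in> A' \<longleftrightarrow> x \<in> A'"
      "\<And>x. sgn x \<in> B \<longleftrightarrow> x \<in> B" "\<And>x. sgn x \<in> B' \<longleftrightarrow> x \<in> B'"
    and [measurable]: "A \<in> sets borel" "A' \<in> sets borel" "B \<in> sets borel" "B' \<in> sets borel"
  shows "(\<integral>\<^sup>+Q. emeasure std_gaussian {g. \<exists>x u v. splits (Q, g) (x, u, v) \<and>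
      x \<in> A \<and> u \<in> A' \<and> transpose Q *v x \<in> B \<and> v \<in> B'} \<partial>\<mu>) =
    emeasure std_gaussian {g. orth_proj L1 g \<in> A \<and> g - orth_proj L1 g \<in> A'} *
    emeasure std_gaussian {g. orth_proj L2 g \<in> B \<and> g - orth_proj L2 g \<in> B'}"
    (is "(\<integral>\<^sup>+Q. emeasure std_gaussian (?E Q) \<partial>\<mu>) = ?R")
proof -
  let ?T = "A \<times> A' \<times> B \<times> B'"
  have T[measurable]: "?T \<in> sets borel"
    unfolding borel_prod[symmetric] by (intro pair_measureI) auto
  have E: "dirs -` ?T \<inter> space (\<mu> \<Otimes>\<^sub>M std_gaussian) \<in> sets (\<mu> \<Otimes>\<^sub>M std_gaussian)"
    by (rule measurable_sets[OF _ T]) measurable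
  have "(\<integral>\<^sup>+Q. emeasure std_gaussian (?E Q) \<partial>\<mu>) =
      (\<integral>\<^sup>+Q. emeasure std_gaussian (Pair Q -` (dirs -` ?T \<inter> space (\<mu> \<Otimes>\<^sub>M std_gaussian))) \<partial>\<mu>)"
    using AE_good
  proof (intro nn_integral_cong_AE, eventually_elim)
    fix Q assume elim: "Q \<in> good"
    have "?E Q = Pair Q -` (dirs -` ?T \<inter> space (\<mu> \<Otimes>\<^sub>M std_gaussian))"
    proof (intro set_eqI)
      fix g
      obtain x u v where p: "parts (Q, g) = (x, u, v)" by (cases "parts (Q, g)")
      have "splits (Q, g) (x', u', v') \<longleftrightarrow> x' = x \<and> u' = u \<and> v' = v" for x' u' v'
        using splits_parts[OF elim(1), of g] parts_eq[OF elim(1), of g "(x', u', v')"] p by auto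
      then show "g \<in> ?E Q \<longleftrightarrow> g \<in> Pair Q -` (dirs -` ?T \<inter> space (\<mu> \<Otimes>\<^sub>M std_gaussian))"
        by (simp add: dirs_def p s space_pair_measure)
    qed
    then show "emeasure std_gaussian (?E Q) =
        emeasure std_gaussian (Pair Q -` (dirs -` ?T \<inter> space (\<mu> \<Otimes>\<^sub>M std_gaussian)))" by simp
  qed
  also have "\<dots> = emeasure (\<mu> \<Otimes>\<^sub>M std_gaussian) (dirs -` ?T \<inter> space (\<mu> \<Otimes>\<^sub>M std_gaussian))"
    by (rule std_gaussian.emeasure_pair_measure_alt[symmetric, OF E])
  also have "\<dots> = emeasure (distr (\<mu> \<Otimes>\<^sub>M std_gaussian) borel dirs) ?T"
    by (rule emeasure_distr[symmetric]) measurable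
  also have "\<dots> = emeasure (distr (std_gaussian \<Otimes>\<^sub>M std_gaussian) borel gdirs) ?T"
    by (simp only: distr_dirs_eq)
  also have "\<dots> = emeasure (std_gaussian \<Otimes>\<^sub>M std_gaussian)
      (gdirs -` ?T \<inter> space ((std_gaussian :: (real^'n) measure) \<Otimes>\<^sub>M (std_gaussian :: (real^'n) measure)))"
    by (rule emeasure_distr) measurable
  also have "gdirs -` ?T \<inter> space ((std_gaussian :: (real^'n) measure) \<Otimes>\<^sub>M (std_gaussian :: (real^'n) measure)) =
    {g. orth_proj L1 g \<in> A \<and> g - orth_proj L1 g \<in> A'} \<times> {g. orth_proj L2 g \<in> B \<and> g - orth_proj L2 g \<in> B'}"
    by (auto simp: gdirs_def s space_pair_measure)
  also have "emeasure (std_gaussian \<Otimes>\<^sub>M std_gaussian) \<dots> = ?R"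
    by (rule std_gaussian.emeasure_pair_measure_Times) measurable
  finally show ?thesis .
qed

end

section \<open>Intrinsic volumes as sums over strata\<close>

text \<open>Indexed by sets of constraints instead of faces; a set that is not the active set of any
  point of the cone has an empty stratum and contributes \<open>0\<close>.\<close>

definition stratum :: "'a::euclidean_space set \<Rightarrow> 'a set \<Rightarrow> 'a set" where
  "stratum H S = {x \<in> polar_cone H. active H x = S}"

lemma stratum_eq:
  assumes "S \<subseteq> H"
  shows "stratum H S = S\<^sup>\<bottom> \<inter> (\<Inter>a\<in>H - S. {x. a \<bullet> x < 0})"
proof (intro set_eqI iffI)
  fix x assume "x \<in> S\<^sup>\<bottom> \<inter> (\<Inter>a\<in>H - S. {x. a \<bullet> x < 0})"
  then have 1: "a \<bullet> x = 0" if "a \<in> S" for a using that by (simp add: mem_orthogonal_comp)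
  moreover from \<open>x \<in> _\<close> have 2: "a \<bullet> x < 0" if "a \<in> H" "a \<notin> S" for a using that by auto
  ultimately have "a \<bullet> x \<le> 0" if "a \<in> H" for a using that by (cases "a \<in> S") (auto simp: less_imp_le)
  moreover have "active H x = S" using 1 2 assms by (force simp: active_def)
  ultimately show "x \<in> stratum H S" by (simp add: stratum_def polar_cone_def)
qed (auto simp: stratum_def polar_cone_def active_def mem_orthogonal_comp less_le)

lemma stratum_subset: "stratum H S \<subseteq> S\<^sup>\<bottom>"
  by (auto simp: stratum_def active_def mem_orthogonal_comp)

lemma open_strict_inequalities: "finite H \<Longrightarrow> open (\<Inter>a\<in>H - S. {x. a \<bullet> x < 0})"
  by (intro open_INT ballI open_halfspace_lt) auto

lemma stratum_borel: "finite H \<Longrightarrow> S \<subseteq> H \<Longrightarrow> stratum H S \<in> sets borel"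
  unfolding stratum_eq
  by (intro sets.Int borel_open open_strict_inequalities borel_closed closed_subspace subspace_orthogonal_comp)

lemma sgn_in_conic_iff:
  fixes A :: "'a::real_normed_vector set"
  assumes "\<And>x c. x \<in> A \<Longrightarrow> c > 0 \<Longrightarrow> c *\<^sub>R x \<in> A"
  shows "sgn x \<in> A \<longleftrightarrow> x \<in> A"
proof (cases "x = 0")
  case False
  have "norm x *\<^sub>R sgn x = x" using False by (simp add: sgn_div_norm)
  then show ?thesis using assms[of "sgn x" "norm x"] assms[of x "inverse (norm x)"] False
    by (auto simp: sgn_div_norm)
qed simp

lemma sgn_in_stratum: "sgn x \<in> stratum H S \<longleftrightarrow> x \<in> stratum H S"
proof (rule sgn_in_conic_iff)
  fix x and c :: real assume x: "x \<in> stratum H S" and c: "c > 0"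
  then have "active H (c *\<^sub>R x) = active H x" by (auto simp: active_def)
  then show "c *\<^sub>R x \<in> stratum H S"
    using x c by (auto simp: stratum_def polar_cone_def mult_le_0_iff)
qed

lemma sgn_in_convex_cone_hull: "sgn x \<in> convex_cone hull S \<longleftrightarrow> x \<in> convex_cone hull S"
  for S :: "'a::real_normed_vector set"
  by (rule sgn_in_conic_iff) (simp add: convex_cone_hull_mul)

definition stratum_prob :: "'a::euclidean_space set \<Rightarrow> 'a set \<Rightarrow> real" where
  "stratum_prob H S = measure std_gaussian {g. active H (closest_point (polar_cone H) g) = S}"

lemma closest_point_stratum_iff:
  "active H (closest_point (polar_cone H) g) = S \<longleftrightarrow> closest_point (polar_cone H) g \<in> stratum H S"
  using closest_point_polar_cone by (auto simp: stratum_def)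

lemma active_closest_point_borel:
  assumes "finite H" "S \<subseteq> H"
  shows "{g. active H (closest_point (polar_cone H) g) = S} \<in> sets borel"
proof -
  have "closest_point (polar_cone H) -` stratum H S \<inter> space borel \<in> sets borel"
    by (rule measurable_sets[OF measurable_closest_point_polar_cone stratum_borel[OF assms]])
  then show ?thesis unfolding closest_point_stratum_iff vimage_def by simp
qed

text \<open>If \<open>S\<close> is active at the nearest point, that point lies in
  \<open>S\<^sup>\<bottom>\<close> and the residual in the cone over \<open>S\<close>, hence in the
  complement of \<open>S\<^sup>\<bottom>\<close>; so the nearest point is the linear projection.
  This is the form of a factor in \<open>nn_integral_kinematic\<close>.\<close>

lemma stratum_prob_eq_orth_proj:
  assumes "finite H"
  shows "stratum_prob H S = measure std_gaussian
    {g. orth_proj (S\<^sup>\<bottom>) g \<in> stratum H S \<and> g - orth_proj (S\<^sup>\<bottom>) g \<in> convex_cone hull S}"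
proof -
  have "active H (closest_point (polar_cone H) g) = S \<longleftrightarrow>
    orth_proj (S\<^sup>\<bottom>) g \<in> stratum H S \<and> g - orth_proj (S\<^sup>\<bottom>) g \<in> convex_cone hull S" for g
  proof
    assume S: "active H (closest_point (polar_cone H) g) = S"
    then have x: "closest_point (polar_cone H) g \<in> stratum H S"
      "g - closest_point (polar_cone H) g \<in> convex_cone hull S"
      using closest_point_polar_cone_iff[OF assms, of g "closest_point (polar_cone H) g"]
      by (simp_all add: closest_point_stratum_iff[symmetric])
    have "convex_cone hull S \<subseteq> (S\<^sup>\<bottom>)\<^sup>\<bottom>"
      using convex_cone_hull_subset_span[of S] span_minimal[OF orthogonal_comp_subset subspace_orthogonal_comp] by blast
    then have "orth_proj (S\<^sup>\<bottom>) g = closest_point (polar_cone H) g"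
      using x stratum_subset by (intro orth_proj_eqI subspace_orthogonal_comp) blast+
    with x show "orth_proj (S\<^sup>\<bottom>) g \<in> stratum H S \<and> g - orth_proj (S\<^sup>\<bottom>) g \<in> convex_cone hull S" by simp
  next
    assume "orth_proj (S\<^sup>\<bottom>) g \<in> stratum H S \<and> g - orth_proj (S\<^sup>\<bottom>) g \<in> convex_cone hull S"
    then have "closest_point (polar_cone H) g = orth_proj (S\<^sup>\<bottom>) g" "active H (orth_proj (S\<^sup>\<bottom>) g) = S"
      using closest_point_polar_cone_iff[OF assms, of g "orth_proj (S\<^sup>\<bottom>) g"] by (auto simp: stratum_def)
    then show "active H (closest_point (polar_cone H) g) = S" by simp
  qed
  then show ?thesis by (simp add: stratum_prob_def)
qed

lemma (in prob_space) prob_eq_sum_over_values: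
  assumes "finite I" "\<And>x. x \<in> space M \<Longrightarrow> \<phi> x \<in> I" "\<And>i. i \<in> I \<Longrightarrow> {x \<in> space M. \<phi> x = i} \<in> sets M"
  shows "prob {x \<in> space M. P (\<phi> x)} = (\<Sum>i\<in>{i\<in>I. P i}. prob {x \<in> space M. \<phi> x = i})"
proof -
  have "{x \<in> space M. P (\<phi> x)} = (\<Union>i\<in>{i\<in>I. P i}. {x \<in> space M. \<phi> x = i})"
    using assms(2) by auto
  then show ?thesis
    using assms(1,3) by (auto intro!: finite_measure_finite_Union simp: disjoint_family_on_def)
qed

lemma intrinsic_volume_eq_sum_strata:
  assumes "finite H"
  shows "intrinsic_volume k (polar_cone H) = (\<Sum>S\<in>{S\<in>Pow H. dim (S\<^sup>\<bottom>) = k}. stratum_prob H S)"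
  unfolding intrinsic_volume_polar_cone[OF assms] stratum_prob_def
  using std_gaussian.prob_eq_sum_over_values[of "Pow H" "\<lambda>g. active H (closest_point (polar_cone H) g)"
      "\<lambda>S. dim (S\<^sup>\<bottom>) = k"] assms active_subset active_closest_point_borel[OF assms]
  by auto

lemma sum_intrinsic_volume:
  fixes H :: "'a::euclidean_space set"
  assumes "finite H"
  shows "(\<Sum>k=0..DIM('a). intrinsic_volume k (polar_cone H)) = 1"
proof -
  have "(\<Sum>k=0..DIM('a). intrinsic_volume k (polar_cone H)) =
      (\<Sum>k\<in>{0..DIM('a)}. \<Sum>S\<in>{S\<in>Pow H. dim (S\<^sup>\<bottom>) = k}. stratum_prob H S)"
    by (simp add: intrinsic_volume_eq_sum_strata[OF assms])
  also have "\<dots> = (\<Sum>S\<in>Pow H. stratum_prob H S)"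
    using assms dim_subset_UNIV by (intro sum.group) auto
  also have "\<dots> = 1"
    using std_gaussian.prob_eq_sum_over_values[of "Pow H" "\<lambda>g. active H (closest_point (polar_cone H) g)"
      "\<lambda>S. True"] assms active_subset active_closest_point_borel[OF assms]
      std_gaussian.prob_space[where 'a = 'a]
    by (auto simp: stratum_prob_def Pow_def)
  finally show ?thesis .
qed

section \<open>Products of cones, and linear subspaces as cones\<close>

lemma polar_cone_Times:
  "polar_cone H \<times> polar_cone K = polar_cone (H \<times> {0} \<union> {0} \<times> K)"
  by (simp add: polar_cone_def ball_Un set_eq_iff Ball_def) blast

lemma closest_point_Times:
  assumes "closed C" "convex C" "C \<noteq> {}" "closed D" "convex D" "D \<noteq> {}"
  shows "closest_point (C \<times> D) (g, h) = (closest_point C g, closest_point D h)"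
proof (rule closest_point_unique[symmetric])
  show "\<forall>z\<in>C \<times> D. dist (g, h) (closest_point C g, closest_point D h) \<le> dist (g, h) z"
    using closest_point_le[OF assms(1)] closest_point_le[OF assms(4)]
    by (auto simp: dist_Pair_Pair intro!: real_sqrt_le_mono add_mono power_mono)
qed (use assms in \<open>auto intro!: convex_Times closed_Times closest_point_in_set\<close>)

text \<open>The nearest point of a product is taken componentwise, the complement of the active set
  is a product, so that dimensions add, and the Gaussian vector has independent components.\<close>

lemma intrinsic_volume_Times:
  fixes H :: "'a::euclidean_space set" and K :: "'b::euclidean_space set"
  assumes H: "finite H" and K: "finite K"
  shows "intrinsic_volume k (polar_cone H \<times> polar_cone K) =
    (\<Sum>(S,T)\<in>{(S,T)\<in>Pow H \<times> Pow K. dim (S\<^sup>\<bottom>) + dim (T\<^sup>\<bottom>) = k}. stratum_prob H S * stratum_prob K T)"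
proof -
  let ?\<gamma> = "(std_gaussian :: 'a measure) \<Otimes>\<^sub>M (std_gaussian :: 'b measure)"
  let ?HK = "H \<times> {0} \<union> {0} \<times> K"
  let ?\<phi> = "\<lambda>(g, h). (active H (closest_point (polar_cone H) g), active K (closest_point (polar_cone K) h))"
  interpret P: prob_space ?\<gamma> unfolding std_gaussian_pair by (rule prob_space_std_gaussian)
  have sp: "space ?\<gamma> = UNIV" by (simp add: space_pair_measure)
  have ne: "polar_cone S \<noteq> {}" for S :: "'c::euclidean_space set" using zero_in_polar_cone by blast
  have "dim ((active ?HK (closest_point (polar_cone ?HK) z))\<^sup>\<bottom>) = dim ((fst (?\<phi> z))\<^sup>\<bottom>) + dim ((snd (?\<phi> z))\<^sup>\<bottom>)" for z
  proof -
    obtain g h where z: "z = (g, h)" by (cases z)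
    have "closest_point (polar_cone ?HK) z = (closest_point (polar_cone H) g, closest_point (polar_cone K) h)"
      unfolding z polar_cone_Times[symmetric]
      by (intro closest_point_Times closed_polar_cone convex_polar_cone ne)
    moreover have "(active ?HK (x, y))\<^sup>\<bottom> = ((active H x)\<^sup>\<bottom>) \<times> ((active K y)\<^sup>\<bottom>)" for x y
      by (force simp: set_eq_iff mem_orthogonal_comp active_def)
    ultimately show ?thesis by (simp add: z dim_Times subspace_orthogonal_comp)
  qed
  then have "intrinsic_volume k (polar_cone H \<times> polar_cone K) =
      measure ?\<gamma> {z \<in> space ?\<gamma>. (\<lambda>(S, T). dim (S\<^sup>\<bottom>) + dim (T\<^sup>\<bottom>) = k) (?\<phi> z)}"
    unfolding polar_cone_Times sp std_gaussian_pair
    by (subst intrinsic_volume_polar_cone) (auto simp: H K case_prod_beta)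
  also have "\<dots> = (\<Sum>p\<in>{p\<in>Pow H \<times> Pow K. (\<lambda>(S, T). dim (S\<^sup>\<bottom>) + dim (T\<^sup>\<bottom>) = k) p}.
      measure ?\<gamma> {z \<in> space ?\<gamma>. ?\<phi> z = p})"
  proof (rule P.prob_eq_sum_over_values)
    show "{z \<in> space ?\<gamma>. ?\<phi> z = p} \<in> sets ?\<gamma>" if "p \<in> Pow H \<times> Pow K" for p
    proof -
      have "{z \<in> space ?\<gamma>. ?\<phi> z = p} = {g. active H (closest_point (polar_cone H) g) = fst p} \<times>
        {h. active K (closest_point (polar_cone K) h) = snd p}"
        by (auto simp: sp)
      moreover have "\<dots> \<in> sets ?\<gamma>"
        using that active_closest_point_borel[OF H, of "fst p"] active_closest_point_borel[OF K, of "snd p"]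
        by (intro pair_measureI) auto
      ultimately show ?thesis by simp
    qed
  qed (use H K active_subset[of H] active_subset[of K] in auto)
  also have "\<dots> = (\<Sum>(S,T)\<in>{(S,T)\<in>Pow H \<times> Pow K. dim (S\<^sup>\<bottom>) + dim (T\<^sup>\<bottom>) = k}. stratum_prob H S * stratum_prob K T)"
  proof (rule sum.cong)
    fix p assume "p \<in> {(S,T)\<in>Pow H \<times> Pow K. dim (S\<^sup>\<bottom>) + dim (T\<^sup>\<bottom>) = k}"
    then obtain S T where p: "p = (S, T)" "S \<subseteq> H" "T \<subseteq> K" by auto
    have "{z \<in> space ?\<gamma>. ?\<phi> z = p} = {g. active H (closest_point (polar_cone H) g) = S} \<times>
        {h. active K (closest_point (polar_cone K) h) = T}"
      by (auto simp: sp p)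
    then have "measure ?\<gamma> {z \<in> space ?\<gamma>. ?\<phi> z = p} = stratum_prob H S * stratum_prob K T"
      using active_closest_point_borel[OF H p(2)] active_closest_point_borel[OF K p(3)]
      by (simp add: stratum_prob_def measure_def std_gaussian.emeasure_pair_measure_Times enn2real_mult)
    then show "measure ?\<gamma> {z \<in> space ?\<gamma>. ?\<phi> z = p} = (case p of (S, T) \<Rightarrow> stratum_prob H S * stratum_prob K T)"
      by (simp add: p)
  qed auto
  finally show ?thesis .
qed

text \<open>A basis of the complement, taken with both signs, turns equations into inequalities;
  every constraint is active on all of \<open>L\<close>, so \<open>L\<close> is a single
  stratum.\<close>

lemma subspace_eq_polar_cone:
  fixes L :: "'a::euclidean_space set"
  assumes "subspace L"
  obtains K where "finite K" "L = polar_cone K" "\<And>x. x \<in> L \<Longrightarrow> active K x = K" "K\<^sup>\<bottom> = L"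
proof -
  obtain B where B: "finite B" "span B = L\<^sup>\<bottom>"
    using basis_subspace_exists[OF subspace_orthogonal_comp[of L]] by metis
  let ?K = "B \<union> uminus ` B"
  have "x \<in> L \<longleftrightarrow> (\<forall>b\<in>B. b \<bullet> x = 0)" for x
  proof
    assume "\<forall>b\<in>B. b \<bullet> x = 0"
    then have "span B \<subseteq> {b. x \<bullet> b = 0}"
      by (intro span_minimal subspace_hyperplane) (auto simp: inner_commute)
    then have "x \<in> L\<^sup>\<bottom>\<^sup>\<bottom>" using B(2) by (auto simp: mem_orthogonal_comp inner_commute)
    then show "x \<in> L" using orthogonal_comp_self[OF assms] by simp
  next
    assume "x \<in> L"
    moreover have "B \<subseteq> L\<^sup>\<bottom>" using B(2) span_superset by blast
    ultimately show "\<forall>b\<in>B. b \<bullet> x = 0" by (auto intro: orthogonal_comp_inner)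
  qed
  note L = this
  show ?thesis
  proof (rule that)
    show "finite ?K" using B(1) by simp
    have "x \<in> polar_cone ?K \<longleftrightarrow> (\<forall>b\<in>B. b \<bullet> x \<le> 0 \<and> 0 \<le> b \<bullet> x)" for x
      by (auto simp: polar_cone_def ball_Un)
    moreover have "(\<forall>b\<in>B. b \<bullet> x \<le> 0 \<and> 0 \<le> b \<bullet> x) \<longleftrightarrow> x \<in> L" for x
      unfolding L by (auto intro: antisym)
    ultimately show "L = polar_cone ?K" by blast
    show "active ?K x = ?K" if "x \<in> L" for x using that by (auto simp: L active_def)
    show "?K\<^sup>\<bottom> = L" by (auto simp: L mem_orthogonal_comp set_eq_iff)
  qed
qed

text \<open>The one stratum of \<open>L\<close> with positive probability is \<open>L\<close>
  itself, with probability \<open>1\<close> and dimension \<open>dim L\<close>; it shifts the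
  index.\<close>

lemma intrinsic_volume_Times_subspace:
  fixes H :: "'a::euclidean_space set" and L :: "'b::euclidean_space set"
  assumes H: "finite H" and L: "subspace L"
  shows "intrinsic_volume k (polar_cone H \<times> L) =
    (if dim L \<le> k then intrinsic_volume (k - dim L) (polar_cone H) else 0)"
proof -
  obtain K where K: "finite K" "L = polar_cone K" "\<And>x. x \<in> L \<Longrightarrow> active K x = K" "K\<^sup>\<bottom> = L"
    using subspace_eq_polar_cone[OF L] by metis
  have p: "stratum_prob K T = (if T = K then 1 else 0)" for T
  proof -
    have "active K (closest_point (polar_cone K) g) = K" for g
      using K(2,3) closest_point_polar_cone by blast
    then show ?thesis using std_gaussian.prob_space[where 'a = 'b] by (auto simp: stratum_prob_def)
  qed
  have "intrinsic_volume k (polar_cone H \<times> L) =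
    (\<Sum>(S,T)\<in>{(S,T)\<in>Pow H \<times> Pow K. dim (S\<^sup>\<bottom>) + dim (T\<^sup>\<bottom>) = k}. stratum_prob H S * stratum_prob K T)"
    unfolding K(2) by (rule intrinsic_volume_Times[OF H K(1)])
  also have "\<dots> = (\<Sum>(S,T)\<in>(\<lambda>S. (S, K)) ` {S\<in>Pow H. dim (S\<^sup>\<bottom>) + dim L = k}. stratum_prob H S * stratum_prob K T)"
  proof (rule sum.mono_neutral_right)
    show "finite {(S,T)\<in>Pow H \<times> Pow K. dim (S\<^sup>\<bottom>) + dim (T\<^sup>\<bottom>) = k}"
      by (rule finite_subset[of _ "Pow H \<times> Pow K"]) (use H K(1) in auto)
  qed (auto simp: p K(4))
  also have "\<dots> = (\<Sum>S\<in>{S\<in>Pow H. dim (S\<^sup>\<bottom>) + dim L = k}. stratum_prob H S)"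
    by (subst sum.reindex) (auto simp: inj_on_def p)
  also have "\<dots> = (if dim L \<le> k then intrinsic_volume (k - dim L) (polar_cone H) else 0)"
    unfolding intrinsic_volume_eq_sum_strata[OF H] by (auto intro!: sum.cong)
  finally show ?thesis .
qed

section \<open>Intersections with a rotated cone\<close>

text \<open>Testing a subspace against the coordinate subspaces makes its dimension a Borel function of parameters.\<close>

lemma dim_le_iff_trivial_Int_coordinate:
  fixes W :: "'a::euclidean_space set"
  assumes W: "subspace W"
  shows "dim W \<le> k \<longleftrightarrow> (\<exists>J\<subseteq>Basis. card J = DIM('a) - k \<and> W \<inter> span J = {0})"
proof
  assume le: "dim W \<le> k"
  obtain B where B: "B \<subseteq> W" "independent B" "W \<subseteq> span B" "card B = dim W"
    using basis_exists by metis
  then have spanB: "span B = W" using W span_minimal by blast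
  \<comment> \<open>The basis of \<open>W\<close> is completed by coordinate vectors; the added
    vectors \<open>J0\<close> span a complement of \<open>W\<close>, and a subset of the required
    size is selected from them.\<close>
  obtain B' where B': "B \<subseteq> B'" "B' \<subseteq> B \<union> Basis" "independent B'" "B \<union> Basis \<subseteq> span B'"
    using maximal_independent_subset_extend[of B "B \<union> Basis"] B(2) by blast
  have UN: "span B' = UNIV" using B'(4) span_minimal[of Basis "span B'"] span_Basis by auto
  define J0 where "J0 = B' - B"
  have finB': "finite B'" using B'(3) by (rule independent_imp_finite)
  have cB': "card B' = DIM('a)" using UN B'(3) by (metis dim_UNIV dim_eq_card_independent dim_span)
  have indJ0: "independent J0" using B'(3) by (rule independent_mono) (auto simp: J0_def)
  have cJ0: "card J0 = DIM('a) - dim W"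
    unfolding J0_def using B'(1) finB' B(4) cB' by (simp add: card_Diff_subset finite_subset)
  have triv: "W \<inter> span J0 = {0}"
  proof -
    have "{x + y | x y. x \<in> W \<and> y \<in> span J0} = span (B \<union> J0)"
      by (auto simp: span_Un spanB)
    also have "B \<union> J0 = B'" using B'(1) by (auto simp: J0_def)
    finally have "dim {x + y | x y. x \<in> W \<and> y \<in> span J0} = DIM('a)" using UN by simp
    moreover have "dim {x + y | x y. x \<in> W \<and> y \<in> span J0} + dim (W \<inter> span J0) = dim W + dim (span J0)"
      by (rule dim_sums_Int[OF W subspace_span])
    moreover have "dim (span J0) = DIM('a) - dim W"
      using indJ0 cJ0 by (simp add: dim_eq_card_independent)
    moreover have "dim W \<le> DIM('a)" by (rule dim_subset_UNIV)
    ultimately have "dim (W \<inter> span J0) = 0" by simp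
    then show ?thesis using W by (auto simp: subspace_0 span_zero)
  qed
  obtain J where J: "J \<subseteq> J0" "card J = DIM('a) - k"
    using obtain_subset_with_card_n[of "DIM('a) - k" J0] cJ0 diff_le_mono2[OF le] by metis
  have "W \<inter> span J = {0}"
    using triv span_mono[OF J(1)] W by (auto simp: subspace_0 span_zero)
  then show "\<exists>J\<subseteq>Basis. card J = DIM('a) - k \<and> W \<inter> span J = {0}"
    using J B'(2) by (intro exI[of _ J]) (auto simp: J0_def)
next
  assume "\<exists>J\<subseteq>Basis. card J = DIM('a) - k \<and> W \<inter> span J = {0}"
  then obtain J :: "'a set" where J: "J \<subseteq> Basis" "card J = DIM('a) - k" "W \<inter> span J = {0}" by blast
  have "independent J" using J(1) independent_Basis independent_mono by blast
  then have "dim (span J) = DIM('a) - k" using J(2) by (simp add: dim_eq_card_independent)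
  moreover have "dim {x + y | x y. x \<in> W \<and> y \<in> span J} + dim (W \<inter> span J) = dim W + dim (span J)"
    by (rule dim_sums_Int[OF W subspace_span])
  moreover have "dim {x + y | x y. x \<in> W \<and> y \<in> span J} \<le> DIM('a)" by (rule dim_subset_UNIV)
  ultimately show "dim W \<le> k" using J(3) by simp
qed

text \<open>For orthogonal \<open>Q\<close> this is the intersection of
  \<open>S\<^sup>\<bottom>\<close> with the rotated \<open>T\<^sup>\<bottom>\<close>. Written with
  \<open>transpose Q\<close>, it is a subspace for every matrix and a closed condition on the pair
  of \<open>Q\<close> and \<open>y\<close>.\<close>

definition comp_Int :: "(real^'n) set \<Rightarrow> (real^'n) set \<Rightarrow> real^'n^'n \<Rightarrow> (real^'n) set" where
  "comp_Int S T Q = {y \<in> S\<^sup>\<bottom>. transpose Q *v y \<in> T\<^sup>\<bottom>}"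

lemma subspace_comp_Int: "subspace (comp_Int S T Q)"
proof -
  have "comp_Int S T Q = S\<^sup>\<bottom> \<inter> (*v) (transpose Q) -` (T\<^sup>\<bottom>)" by (auto simp: comp_Int_def)
  then show ?thesis
    by (simp add: subspace_inter subspace_orthogonal_comp linear_subspace_vimage)
qed

lemma borel_dim_comp_Int:
  fixes S T :: "(real^'n) set"
  shows "{Q. dim (comp_Int S T Q) = k} \<in> sets borel"
proof -
  have le: "{Q. dim (comp_Int S T Q) \<le> j} \<in> sets borel" for j
  proof -
    let ?\<J> = "{J. J \<subseteq> (Basis :: (real^'n) set) \<and> card J = CARD('n) - j}"
    let ?N = "\<lambda>J. {Q. \<exists>x. norm x = 1 \<and> x \<in> S\<^sup>\<bottom> \<inter> span J \<and> transpose Q *v x \<in> T\<^sup>\<bottom>}"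
    have "comp_Int S T Q \<inter> span J = {0} \<longleftrightarrow> Q \<notin> ?N J" for Q and J :: "(real^'n) set"
    proof
      assume triv: "comp_Int S T Q \<inter> span J = {0}"
      have "x = 0" if "x \<in> S\<^sup>\<bottom> \<inter> span J" "transpose Q *v x \<in> T\<^sup>\<bottom>" for x
      proof -
        have "x \<in> comp_Int S T Q \<inter> span J" using that by (simp add: comp_Int_def)
        then show ?thesis using triv by simp
      qed
      then show "Q \<notin> ?N J" by force
    next
      assume Q: "Q \<notin> ?N J"
      have "x = 0" if x: "x \<in> comp_Int S T Q \<inter> span J" for x
      proof (rule ccontr)
        assume "x \<noteq> 0"
        have "x /\<^sub>R norm x \<in> comp_Int S T Q" "x /\<^sub>R norm x \<in> span J"
          using x by (auto intro: subspace_scale[OF subspace_comp_Int] span_scale)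
        then have "norm (x /\<^sub>R norm x) = 1" "x /\<^sub>R norm x \<in> S\<^sup>\<bottom> \<inter> span J" "transpose Q *v (x /\<^sub>R norm x) \<in> T\<^sup>\<bottom>"
          using \<open>x \<noteq> 0\<close> by (auto simp: comp_Int_def)
        then show False using Q by blast
      qed
      then show "comp_Int S T Q \<inter> span J = {0}"
        using subspace_0[OF subspace_comp_Int] span_zero by blast
    qed
    then have "dim (comp_Int S T Q) \<le> j \<longleftrightarrow> (\<exists>J\<in>?\<J>. Q \<in> - ?N J)" for Q
      unfolding dim_le_iff_trivial_Int_coordinate[OF subspace_comp_Int] by simp
    then have "{Q. dim (comp_Int S T Q) \<le> j} = (\<Union>J\<in>?\<J>. - ?N J)"
      by blast
    moreover have "finite ?\<J>" by (rule finite_subset[of _ "Pow Basis"]) auto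
    moreover have "?N J \<in> sets borel" for J
      by (intro borel_meets closed_Int closed_subspace subspace_orthogonal_comp subspace_span)
    ultimately show ?thesis by auto
  qed
  show ?thesis
  proof (cases k)
    case 0
    then show ?thesis using le[of 0] by simp
  next
    case (Suc j)
    then have "{Q. dim (comp_Int S T Q) = k} = {Q. dim (comp_Int S T Q) \<le> k} - {Q. dim (comp_Int S T Q) \<le> j}"
      by auto
    then show ?thesis using le by auto
  qed
qed

lemma polar_cone_Int_rotated:
  fixes H K :: "(real^'n) set"
  assumes o: "orthogonal_matrix Q"
  shows "polar_cone H \<inter> (*v) Q ` polar_cone K = polar_cone (H \<union> (*v) Q ` K)"
proof -
  show ?thesis
    by (intro set_eqI) (simp add: in_rotated_image_iff[OF o] polar_cone_def inner_matrix_vector_mult ball_Un)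
qed

lemma active_rotated:
  "active (H \<union> (*v) Q ` K) x = active H x \<union> (*v) Q ` active K (transpose Q *v x)"
  for H K :: "(real^'n) set"
  by (auto simp: active_def inner_matrix_vector_mult)

lemma orthogonal_comp_rotated: "(S \<union> (*v) Q ` T)\<^sup>\<bottom> = comp_Int S T Q"
  by (auto simp: comp_Int_def mem_orthogonal_comp inner_matrix_vector_mult ball_Un)

text \<open>The event that the nearest point has active sets \<open>S\<close> and \<open>T\<close>,
  phrased by the optimality decomposition; this form suits both Borel projection and the comparison
  with \<open>splits\<close>.\<close>

definition kin_event :: "(real^'n) set \<Rightarrow> (real^'n) set \<Rightarrow> (real^'n) set \<Rightarrow> (real^'n) set \<Rightarrow> real^'n^'n \<Rightarrow> (real^'n) set" where
  "kin_event H K S T Q = {g. \<exists>x u v. x \<in> stratum H S \<and> transpose Q *v x \<in> stratum K T \<and>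
     u \<in> convex_cone hull S \<and> v \<in> convex_cone hull T \<and> g = x + u + Q *v v}"

text \<open>The constraints active at \<open>x\<close> are those of \<open>H\<close> together with
  the rotated ones of \<open>K\<close>, and the cone generated by a union is the sum of the cones;
  the residual \<open>g - x\<close> therefore splits as \<open>u + Q *v v\<close>.\<close>

lemma kin_event_iff:
  fixes H K :: "(real^'n) set"
  assumes H: "finite H" and K: "finite K"
  defines "p \<equiv> \<lambda>Q. closest_point (polar_cone (H \<union> (*v) Q ` K))"
  shows "g \<in> kin_event H K S T Q \<longleftrightarrow> active H (p Q g) = S \<and> active K (transpose Q *v p Q g) = T"
proof -
  have p: "p Q g = x \<longleftrightarrow> (x \<in> polar_cone H \<and> transpose Q *v x \<in> polar_cone K) \<and>
    (\<exists>u v. u \<in> convex_cone hull (active H x) \<and> v \<in> convex_cone hull (active K (transpose Q *v x)) \<and> g = x + u + Q *v v)" for x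
  proof -
    have "x \<in> polar_cone (H \<union> (*v) Q ` K) \<longleftrightarrow> x \<in> polar_cone H \<and> transpose Q *v x \<in> polar_cone K"
      by (auto simp: polar_cone_def inner_matrix_vector_mult ball_Un)
    moreover have "g - x \<in> convex_cone hull (active (H \<union> (*v) Q ` K) x) \<longleftrightarrow>
      (\<exists>u v. u \<in> convex_cone hull (active H x) \<and> v \<in> convex_cone hull (active K (transpose Q *v x)) \<and> g - x = u + Q *v v)"
      unfolding active_rotated convex_cone_hull_Un convex_cone_hull_linear_image[OF matrix_vector_mul_linear]
      by auto
    moreover have "g - x = u + Q *v v \<longleftrightarrow> g = x + u + Q *v v" for u v
      by (auto simp: algebra_simps)
    ultimately show ?thesis
      unfolding p_def using closest_point_polar_cone_iff[of "H \<union> (*v) Q ` K" g x] H K by simp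
  qed
  show ?thesis
  proof
    assume "g \<in> kin_event H K S T Q"
    then obtain x u v where x: "x \<in> stratum H S" "transpose Q *v x \<in> stratum K T"
      "u \<in> convex_cone hull S" "v \<in> convex_cone hull T" "g = x + u + Q *v v"
      unfolding kin_event_def by blast
    then have "p Q g = x" unfolding p stratum_def by blast
    then show "active H (p Q g) = S \<and> active K (transpose Q *v p Q g) = T"
      using x by (simp add: stratum_def)
  next
    assume a: "active H (p Q g) = S \<and> active K (transpose Q *v p Q g) = T"
    show "g \<in> kin_event H K S T Q"
      using p[of "p Q g"] a unfolding kin_event_def stratum_def by blast
  qed
qed

lemma kin_event_borel:
  fixes H K :: "(real^'n) set"
  assumes H: "finite H" "S \<subseteq> H" and K: "finite K" "T \<subseteq> K"
  shows "{z. snd z \<in> kin_event H K S T (fst z)} \<in> sets borel"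
proof -
  let ?A = "\<Inter>a\<in>H - S. {x. a \<bullet> x < 0}" and ?B = "\<Inter>a\<in>K - T. {x. a \<bullet> x < 0}"
  let ?q = "\<lambda>p :: ((real^'n^'n) \<times> (real^'n)) \<times> ((real^'n) \<times> (real^'n) \<times> (real^'n)). transpose (fst (fst p)) *v fst (snd p)"
  let ?G = "((\<lambda>p. fst (snd p)) -` (S\<^sup>\<bottom>)) \<inter> (?q -` (T\<^sup>\<bottom>)) \<inter>
     ((\<lambda>p. fst (snd (snd p))) -` (convex_cone hull S)) \<inter> ((\<lambda>p. snd (snd (snd p))) -` (convex_cone hull T)) \<inter>
     {p :: ((real^'n^'n) \<times> (real^'n)) \<times> ((real^'n) \<times> (real^'n) \<times> (real^'n)).
         snd (fst p) = fst (snd p) + fst (snd (snd p)) + fst (fst p) *v snd (snd (snd p))}"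
  let ?U = "((\<lambda>p. fst (snd p)) -` ?A) \<inter> (?q -` ?B)"
  have fin: "finite S" "finite T" using assms finite_subset by blast+
  have "closed ?G"
    using fin by (intro closed_Int closed_vimage closed_Collect_eq closed_subspace subspace_orthogonal_comp
       closed_convex_cone_hull continuous_intros)
  moreover have "open ?U"
    using H(1) K(1) by (intro open_Int open_vimage open_strict_inequalities continuous_intros)
  ultimately have "fst ` (?G \<inter> ?U) \<in> sets borel"
    by (rule borel_fst_image_closed_Int_open)
  moreover have "{z. snd z \<in> kin_event H K S T (fst z)} = fst ` (?G \<inter> ?U)"
  proof (intro set_eqI iffI)
    fix z :: "(real^'n^'n) \<times> (real^'n)"
    assume "z \<in> {z. snd z \<in> kin_event H K S T (fst z)}"
    then obtain x u v where x: "x \<in> stratum H S" "transpose (fst z) *v x \<in> stratum K T"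
      "u \<in> convex_cone hull S" "v \<in> convex_cone hull T" "snd z = x + u + fst z *v v"
      unfolding kin_event_def by blast
    then have "(z, (x, u, v)) \<in> ?G \<inter> ?U"
      unfolding stratum_eq[OF H(2)] stratum_eq[OF K(2)] by simp
    then have "fst (z, (x, u, v)) \<in> fst ` (?G \<inter> ?U)" by (rule imageI)
    then show "z \<in> fst ` (?G \<inter> ?U)" by simp
  next
    fix z :: "(real^'n^'n) \<times> (real^'n)"
    assume "z \<in> fst ` (?G \<inter> ?U)"
    then obtain p where p: "z = fst p" "p \<in> ?G \<inter> ?U" by blast
    obtain x u v where s: "snd p = (x, u, v)" by (cases "snd p")
    have "x \<in> stratum H S" "transpose (fst z) *v x \<in> stratum K T"
      "u \<in> convex_cone hull S" "v \<in> convex_cone hull T" "snd z = x + u + fst z *v v"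
      unfolding stratum_eq[OF H(2)] stratum_eq[OF K(2)] using p s by simp_all
    then show "z \<in> {z. snd z \<in> kin_event H K S T (fst z)}" unfolding kin_event_def by blast
  qed
  ultimately show ?thesis by simp
qed

lemma kin_event_section_borel:
  fixes H K :: "(real^'n) set"
  assumes "finite H" "S \<subseteq> H" "finite K" "T \<subseteq> K"
  shows "kin_event H K S T Q \<in> sets borel"
proof -
  have "Pair Q -` {z. snd z \<in> kin_event H K S T (fst z)} \<in> sets borel"
    using kin_event_borel[OF assms] unfolding borel_prod[symmetric] by (rule sets_Pair1)
  then show ?thesis by simp
qed

text \<open>A Borel function of all matrices that agrees with the intrinsic volume of the
  intersection on orthogonal ones. The indicator enters because the dimension belonging to a pair
  \<open>(S, T)\<close> depends on \<open>Q\<close>.\<close>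

definition section_volume :: "nat \<Rightarrow> (real^'n) set \<Rightarrow> (real^'n) set \<Rightarrow> real^'n^'n \<Rightarrow> real" where
  "section_volume k H K Q = (\<Sum>(S,T)\<in>Pow H \<times> Pow K.
     indicator {Q. dim (comp_Int S T Q) = k} Q * measure std_gaussian (kin_event H K S T Q))"

lemma intrinsic_volume_Int_rotated:
  fixes H K :: "(real^'n) set"
  assumes H: "finite H" and K: "finite K" and o: "orthogonal_matrix Q"
  shows "intrinsic_volume k (polar_cone H \<inter> (*v) Q ` polar_cone K) = section_volume k H K Q"
proof -
  let ?p = "closest_point (polar_cone (H \<union> (*v) Q ` K))"
  let ?\<phi> = "\<lambda>g. (active H (?p g), active K (transpose Q *v ?p g))"
  have ev: "{g. ?\<phi> g = st} = kin_event H K (fst st) (snd st) Q" for st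
    using kin_event_iff[OF H K] by (cases st) auto
  have "intrinsic_volume k (polar_cone H \<inter> (*v) Q ` polar_cone K) =
      measure std_gaussian {g \<in> space std_gaussian. (\<lambda>(S, T). dim (comp_Int S T Q) = k) (?\<phi> g)}"
    unfolding polar_cone_Int_rotated[OF o]
    by (subst intrinsic_volume_polar_cone) (auto simp: H K active_rotated orthogonal_comp_rotated)
  also have "\<dots> = (\<Sum>st\<in>{st\<in>Pow H \<times> Pow K. (\<lambda>(S, T). dim (comp_Int S T Q) = k) st}.
      measure std_gaussian {g \<in> space std_gaussian. ?\<phi> g = st})"
    by (rule std_gaussian.prob_eq_sum_over_values)
       (use H K ev active_subset[of H] active_subset[of K] in \<open>auto intro!: kin_event_section_borel\<close>)
  also have "\<dots> = (\<Sum>st\<in>{st\<in>Pow H \<times> Pow K. (\<lambda>(S, T). dim (comp_Int S T Q) = k) st}.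
      measure std_gaussian (kin_event H K (fst st) (snd st) Q))"
    by (simp add: ev)
  also have "\<dots> = section_volume k H K Q"
    unfolding section_volume_def using H K
    by (intro sum.mono_neutral_cong_left) (auto simp: indicator_def split: if_splits)
  finally show ?thesis .
qed

lemma measurable_measure_kin_event:
  fixes H K :: "(real^'n) set"
  assumes "finite H" "S \<subseteq> H" "finite K" "T \<subseteq> K"
  shows "(\<lambda>Q. measure std_gaussian (kin_event H K S T Q)) \<in> borel_measurable borel"
proof -
  have "{z. snd z \<in> kin_event H K S T (fst z)} \<in> sets (borel \<Otimes>\<^sub>M std_gaussian)"
  proof -
    have "sets ((borel :: (real^'n^'n) measure) \<Otimes>\<^sub>M (std_gaussian :: (real^'n) measure)) = sets (borel \<Otimes>\<^sub>M borel)"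
      by (intro sets_pair_measure_cong) simp_all
    also have "\<dots> = sets borel" by (simp only: borel_prod)
    finally show ?thesis using kin_event_borel[OF assms] by (simp only:)
  qed
  from std_gaussian.measurable_emeasure_Pair[OF this]
  have "(\<lambda>Q. emeasure std_gaussian (kin_event H K S T Q)) \<in> borel_measurable borel"
    by (simp add: vimage_def)
  then show ?thesis unfolding measure_def by measurable
qed

lemma measurable_section_volume:
  assumes "finite H" "finite K"
  shows "section_volume k H K \<in> borel_measurable borel"
  unfolding section_volume_def[abs_def]
  using assms borel_dim_comp_Int measurable_measure_kin_event
  by (intro borel_measurable_sum) (auto intro!: borel_measurable_times borel_measurable_indicator)

section \<open>The kinematic formula\<close>

context haar_orthogonal begin

text \<open>The stratum of \<open>S\<close> lies in \<open>S\<^sup>\<bottom>\<close> and the cone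
  over \<open>S\<close> in its complement, and likewise for \<open>T\<close>; so the decomposition
  in \<open>kin_event\<close> is a splitting for these two subspaces and the kinematic identity
  applies.\<close>

lemma integral_kin_event:
  assumes H: "finite H" "S \<subseteq> H" and K: "finite K" "T \<subseteq> K"
    and dims: "CARD('n) < dim (S\<^sup>\<bottom>) + dim (T\<^sup>\<bottom>)"
  shows "(\<integral>Q. measure std_gaussian (kin_event H K S T Q) \<partial>\<mu>) = stratum_prob H S * stratum_prob K T"
proof -
  interpret kinematic \<mu> "S\<^sup>\<bottom>" "T\<^sup>\<bottom>"
    by unfold_locales (simp_all add: subspace_orthogonal_comp dims)
  have sub: "convex_cone hull X \<subseteq> (X\<^sup>\<bottom>)\<^sup>\<bottom>" for X :: "(real^'n) set"
    using convex_cone_hull_subset_span[of X] span_minimal[OF orthogonal_comp_subset subspace_orthogonal_comp] by blast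
  have fin: "finite S" "finite T" using assms finite_subset by blast+
  have ev: "kin_event H K S T Q = {g. \<exists>x u v. splits (Q, g) (x, u, v) \<and> x \<in> stratum H S \<and>
      u \<in> convex_cone hull S \<and> transpose Q *v x \<in> stratum K T \<and> v \<in> convex_cone hull T}" for Q
    unfolding kin_event_def splits_def using sub[of S] sub[of T] stratum_subset[of H S] stratum_subset[of K T]
    by (intro Collect_cong) (simp, blast)
  have "(\<integral>\<^sup>+Q. emeasure std_gaussian (kin_event H K S T Q) \<partial>\<mu>) =
    emeasure std_gaussian {g. orth_proj (S\<^sup>\<bottom>) g \<in> stratum H S \<and> g - orth_proj (S\<^sup>\<bottom>) g \<in> convex_cone hull S} *
    emeasure std_gaussian {g. orth_proj (T\<^sup>\<bottom>) g \<in> stratum K T \<and> g - orth_proj (T\<^sup>\<bottom>) g \<in> convex_cone hull T}"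
    unfolding ev using H K fin
    by (intro nn_integral_kinematic sgn_in_stratum sgn_in_convex_cone_hull stratum_borel borel_closed closed_convex_cone_hull)
  also have "\<dots> = ennreal (stratum_prob H S * stratum_prob K T)"
    by (simp add: stratum_prob_eq_orth_proj[OF H(1)] stratum_prob_eq_orth_proj[OF K(1)]
        std_gaussian.emeasure_eq_measure ennreal_mult)
  finally have "(\<integral>\<^sup>+Q. ennreal (measure std_gaussian (kin_event H K S T Q)) \<partial>\<mu>) =
      ennreal (stratum_prob H S * stratum_prob K T)"
    by (simp add: std_gaussian.emeasure_eq_measure)
  then show ?thesis
    using measurable_measure_kin_event[OF H K]
    by (intro integral_eq_nn_integral[THEN trans]) (auto simp: stratum_prob_def)
qed

text \<open>Truncated subtraction covers the case of a trivial intersection. In the other case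
  transversality makes the two subspaces span the space, and the dimension formula gives the
  value.\<close>

lemma AE_dim_comp_Int:
  fixes S T :: "(real^'n) set"
  shows "AE Q in \<mu>. dim (comp_Int S T Q) = dim (S\<^sup>\<bottom>) + dim (T\<^sup>\<bottom>) - CARD('n)"
proof (cases "dim (S\<^sup>\<bottom>) + dim (T\<^sup>\<bottom>) \<le> CARD('n)")
  case True
  have "AE Q in \<mu>. \<forall>x\<in>S\<^sup>\<bottom>. transpose Q *v x \<in> T\<^sup>\<bottom> \<longrightarrow> x = 0"
    by (intro AE_subspace_Int_trivial subspace_orthogonal_comp True)
  then show ?thesis
  proof eventually_elim
    case (elim Q)
    then have "comp_Int S T Q \<subseteq> {0}" by (auto simp: comp_Int_def)
    then show ?case using True by (simp add: dim_eq_0)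
  qed
next
  case False
  then interpret kinematic \<mu> "S\<^sup>\<bottom>" "T\<^sup>\<bottom>"
    by unfold_locales (simp_all add: subspace_orthogonal_comp)
  show ?thesis
    using AE_good
  proof eventually_elim
    case (elim Q)
    note o = good_orthogonal[OF elim]
    have sT: "subspace ((*v) Q ` (T\<^sup>\<bottom>))"
      by (intro linear_subspace_image matrix_vector_mul_linear subspace_orthogonal_comp)
    have "g \<in> {x + y | x y. x \<in> S\<^sup>\<bottom> \<and> y \<in> (*v) Q ` (T\<^sup>\<bottom>)}" for g
    proof -
      let ?P = "{x + y | x y. x \<in> S\<^sup>\<bottom> \<and> y \<in> (*v) Q ` (T\<^sup>\<bottom>)}"
      have P: "subspace ?P" by (intro subspace_sums subspace_orthogonal_comp sT)
      have "x = 0" if x: "x \<in> ?P\<^sup>\<bottom>" for x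
      proof -
        have "a \<bullet> x = 0" if "a \<in> S\<^sup>\<bottom>" for a
        proof -
          have "a + 0 \<in> ?P" using that subspace_0[OF sT] by blast
          then show ?thesis using x by (auto simp: mem_orthogonal_comp)
        qed
        then have 1: "x \<in> (S\<^sup>\<bottom>)\<^sup>\<bottom>" by (simp add: mem_orthogonal_comp)
        have "a \<bullet> (transpose Q *v x) = 0" if "a \<in> T\<^sup>\<bottom>" for a
        proof -
          have "0 + Q *v a \<in> ?P" using that subspace_0[OF subspace_orthogonal_comp[of S]] by blast
          then have "(0 + Q *v a) \<bullet> x = 0" using x unfolding mem_orthogonal_comp by blast
          then show ?thesis by (simp add: inner_matrix_vector_mult)
        qed
        then have "transpose Q *v x \<in> (T\<^sup>\<bottom>)\<^sup>\<bottom>" by (simp add: mem_orthogonal_comp)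
        with 1 elim show ?thesis by (simp add: good_def)
      qed
      then have "g - orth_proj ?P g = 0" using diff_orth_proj_in[OF P, of g] by blast
      then show ?thesis using orth_proj_in[OF P, of g] by simp
    qed
    then have "{x + y | x y. x \<in> S\<^sup>\<bottom> \<and> y \<in> (*v) Q ` (T\<^sup>\<bottom>)} = UNIV" by blast
    moreover have "dim {x + y | x y. x \<in> S\<^sup>\<bottom> \<and> y \<in> (*v) Q ` (T\<^sup>\<bottom>)} + dim (S\<^sup>\<bottom> \<inter> (*v) Q ` (T\<^sup>\<bottom>)) =
        dim (S\<^sup>\<bottom>) + dim ((*v) Q ` (T\<^sup>\<bottom>))"
      by (intro dim_sums_Int subspace_orthogonal_comp sT)
    moreover have "S\<^sup>\<bottom> \<inter> (*v) Q ` (T\<^sup>\<bottom>) = comp_Int S T Q"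
      by (intro set_eqI) (simp add: comp_Int_def in_rotated_image_iff[OF o])
    moreover have "dim ((*v) Q ` (T\<^sup>\<bottom>)) = dim (T\<^sup>\<bottom>)"
      by (intro dim_image_eq matrix_vector_mul_linear inj_onI)
         (metis orthogonal_matrix_mult_transpose(1)[OF o])
    ultimately show ?case by simp
  qed
qed

lemma integrable_bounded_measure:
  fixes f :: "real^'n^'n \<Rightarrow> real"
  assumes "f \<in> borel_measurable borel" "\<And>Q. 0 \<le> f Q" "\<And>Q. f Q \<le> c"
  shows "integrable \<mu> f"
  using assms by (intro integrable_const_bound[where B = c]) auto

lemma integrable_section_volume:
  assumes "finite H" "finite K"
  shows "integrable \<mu> (section_volume k H K)"
  unfolding section_volume_def[abs_def]
proof (intro Bochner_Integration.integrable_sum, clarify)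
  fix S T assume ST: "S \<subseteq> H" "T \<subseteq> K"
  show "integrable \<mu> (\<lambda>Q. indicator {Q. dim (comp_Int S T Q) = k} Q * measure std_gaussian (kin_event H K S T Q))"
    using borel_dim_comp_Int measurable_measure_kin_event[OF assms(1) ST(1) assms(2) ST(2)]
    by (intro integrable_bounded_measure[where c = 1] borel_measurable_times borel_measurable_indicator)
       (auto simp: indicator_def std_gaussian.prob_le_1)
qed

text \<open>For positive \<open>k\<close> the truncated difference in \<open>AE_dim_comp_Int\<close>
  equals \<open>k\<close> exactly when the dimensions add up to \<open>k + CARD('n)\<close>, so
  every surviving pair exceeds \<open>CARD('n)\<close> and \<open>integral_kin_event\<close>
  applies.\<close>

lemma integral_section_volume_pos:
  assumes H: "finite H" and K: "finite K" and k: "k > 0"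
  shows "(\<integral>Q. section_volume k H K Q \<partial>\<mu>) =
    intrinsic_volume (k + CARD('n)) (polar_cone H \<times> polar_cone K)"
proof -
  let ?f = "\<lambda>S T Q. measure std_gaussian (kin_event H K S T Q)"
  have m: "?f S T \<in> borel_measurable borel" if "S \<subseteq> H" "T \<subseteq> K" for S T
    by (rule measurable_measure_kin_event[OF H that(1) K that(2)])
  have 1: "(\<integral>Q. indicator {Q. dim (comp_Int S T Q) = k} Q * ?f S T Q \<partial>\<mu>) =
      (if dim (S\<^sup>\<bottom>) + dim (T\<^sup>\<bottom>) = k + CARD('n) then stratum_prob H S * stratum_prob K T else 0)"
    if ST: "S \<subseteq> H" "T \<subseteq> K" for S T
  proof -
    have "(\<integral>Q. indicator {Q. dim (comp_Int S T Q) = k} Q * ?f S T Q \<partial>\<mu>) =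
      (\<integral>Q. (if dim (S\<^sup>\<bottom>) + dim (T\<^sup>\<bottom>) = k + CARD('n) then ?f S T Q else 0) \<partial>\<mu>)"
    proof (rule integral_cong_AE)
      show "(\<lambda>Q. indicator {Q. dim (comp_Int S T Q) = k} Q * ?f S T Q) \<in> borel_measurable \<mu>"
        using borel_dim_comp_Int m[OF ST] by (intro borel_measurable_times borel_measurable_indicator) auto
      show "(\<lambda>Q. if dim (S\<^sup>\<bottom>) + dim (T\<^sup>\<bottom>) = k + CARD('n) then ?f S T Q else 0) \<in> borel_measurable \<mu>"
        using m[OF ST] by auto
      show "AE Q in \<mu>. indicator {Q. dim (comp_Int S T Q) = k} Q * ?f S T Q =
        (if dim (S\<^sup>\<bottom>) + dim (T\<^sup>\<bottom>) = k + CARD('n) then ?f S T Q else 0)"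
        using AE_dim_comp_Int[of S T] by eventually_elim (use k in auto)
    qed
    also have "\<dots> = (if dim (S\<^sup>\<bottom>) + dim (T\<^sup>\<bottom>) = k + CARD('n) then stratum_prob H S * stratum_prob K T else 0)"
      using integral_kin_event[OF H ST(1) K ST(2)] k by auto
    finally show ?thesis .
  qed
  have "(\<integral>Q. section_volume k H K Q \<partial>\<mu>) = (\<Sum>(S,T)\<in>Pow H \<times> Pow K.
      (\<integral>Q. indicator {Q. dim (comp_Int S T Q) = k} Q * ?f S T Q \<partial>\<mu>))"
    unfolding section_volume_def case_prod_beta
  proof (intro Bochner_Integration.integral_sum)
    fix p assume "p \<in> Pow H \<times> Pow K"
    then have "fst p \<subseteq> H" "snd p \<subseteq> K" by auto
    then show "integrable \<mu> (\<lambda>Q. indicator {Q. dim (comp_Int (fst p) (snd p) Q) = k} Q * ?f (fst p) (snd p) Q)"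
      using borel_dim_comp_Int m
      by (intro integrable_bounded_measure[where c = 1] borel_measurable_times borel_measurable_indicator)
         (auto simp: indicator_def std_gaussian.prob_le_1)
  qed
  also have "\<dots> = (\<Sum>(S,T)\<in>Pow H \<times> Pow K.
      if dim (S\<^sup>\<bottom>) + dim (T\<^sup>\<bottom>) = k + CARD('n) then stratum_prob H S * stratum_prob K T else 0)"
    using 1 by (intro sum.cong) auto
  also have "\<dots> = intrinsic_volume (k + CARD('n)) (polar_cone H \<times> polar_cone K)"
    unfolding intrinsic_volume_Times[OF H K] using H K
    by (intro sum.mono_neutral_cong_right) (auto split: if_splits)
  finally show ?thesis .
qed

text \<open>The intrinsic volumes of the intersection sum to \<open>1\<close>, and so do those of
  the product. With \<open>d = CARD('n)\<close>, the terms for \<open>k\<close> from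
  \<open>1\<close> to \<open>d\<close> match the product indices \<open>d + 1\<close> to
  \<open>2 d\<close>; what is left on both sides is the claim.\<close>

lemma integral_section_volume_0:
  assumes H: "finite H" and K: "finite K"
  shows "(\<integral>Q. section_volume 0 H K Q \<partial>\<mu>) =
    (\<Sum>j=0..CARD('n). intrinsic_volume j (polar_cone H \<times> polar_cone K))"
proof -
  let ?v = "\<lambda>j. intrinsic_volume j (polar_cone H \<times> polar_cone K)"
  have split: "{0..m} = insert 0 {1..m}" for m :: nat by auto
  have "AE Q in \<mu>. (\<Sum>k=0..CARD('n). section_volume k H K Q) = 1"
    using AE_orthogonal
  proof eventually_elim
    case (elim Q)
    have "(\<Sum>k=0..CARD('n). section_volume k H K Q) =
        (\<Sum>k=0..DIM(real^'n). intrinsic_volume k (polar_cone (H \<union> (*v) Q ` K)))"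
      by (simp add: intrinsic_volume_Int_rotated[OF H K elim, symmetric] polar_cone_Int_rotated[OF elim])
    also have "\<dots> = 1" using H K by (intro sum_intrinsic_volume) auto
    finally show ?case .
  qed
  then have "(\<integral>Q. (\<Sum>k=0..CARD('n). section_volume k H K Q) \<partial>\<mu>) = (\<integral>Q. 1 \<partial>\<mu>)"
    using measurable_section_volume[OF H K] by (intro integral_cong_AE) auto
  also have "\<dots> = 1" using prob_space by simp
  finally have "(\<Sum>k=0..CARD('n). (\<integral>Q. section_volume k H K Q \<partial>\<mu>)) = 1"
    by (simp add: Bochner_Integration.integral_sum integrable_section_volume[OF H K])
  moreover have "(\<Sum>k=1..CARD('n). (\<integral>Q. section_volume k H K Q \<partial>\<mu>)) = (\<Sum>k=1..CARD('n). ?v (k + CARD('n)))"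
    by (intro sum.cong refl integral_section_volume_pos H K) auto
  moreover have "(\<Sum>k=1..CARD('n). ?v (k + CARD('n))) = (\<Sum>j=CARD('n)+1..CARD('n)+CARD('n). ?v j)"
    using sum.shift_bounds_cl_nat_ivl[of ?v 1 "CARD('n)" "CARD('n)"] by (simp add: add.commute)
  moreover have "(\<Sum>j=0..CARD('n). ?v j) + (\<Sum>j=CARD('n)+1..CARD('n)+CARD('n). ?v j) =
      (\<Sum>j=0..CARD('n)+CARD('n). ?v j)"
    by (rule sum.ub_add_nat[symmetric]) simp
  moreover have "(\<Sum>j=0..CARD('n)+CARD('n). ?v j) = 1"
    using sum_intrinsic_volume[of "H \<times> {0} \<union> {0} \<times> K"] H K by (simp add: polar_cone_Times)
  moreover have "(\<Sum>k=0..CARD('n). (\<integral>Q. section_volume k H K Q \<partial>\<mu>)) =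
      (\<integral>Q. section_volume 0 H K Q \<partial>\<mu>) + (\<Sum>k=1..CARD('n). (\<integral>Q. section_volume k H K Q \<partial>\<mu>))"
    unfolding split by simp
  ultimately show ?thesis by simp
qed

end

section \<open>Transfer to the Haar measure on the orthogonal group\<close>

lemma haar_prob_orthogonal_measurable_id:
  assumes "haar_prob_orthogonal \<mu>"
  shows "(\<lambda>Q. Q) \<in> \<mu> \<rightarrow>\<^sub>M borel" "space \<mu> = orthogonal_group"
proof -
  have s: "sets \<mu> = sets (restrict_space borel orthogonal_group)"
    using assms by (simp add: haar_prob_orthogonal_def)
  show "(\<lambda>Q. Q) \<in> \<mu> \<rightarrow>\<^sub>M borel"
    unfolding measurable_cong_sets[OF s refl] by (intro measurable_restrict_space1) auto
  show "space \<mu> = orthogonal_group"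
    using sets_eq_imp_space_eq[OF s] by (simp add: space_restrict_space)
qed

text \<open>The measure is pushed forward along the inclusion into all matrices; invariance survives
  because left multiplication by \<open>U\<close> maps the group to itself.\<close>

lemma haar_orthogonal_distr:
  fixes \<mu> :: "(real^'n^'n) measure"
  assumes haar: "haar_prob_orthogonal \<mu>"
  shows "haar_orthogonal (distr \<mu> borel (\<lambda>Q. Q))"
proof -
  note id = haar_prob_orthogonal_measurable_id[OF haar]
  interpret \<mu>: prob_space \<mu> using haar by (simp add: haar_prob_orthogonal_def)
  have s: "sets \<mu> = sets (restrict_space borel orthogonal_group)"
    using haar by (simp add: haar_prob_orthogonal_def)
  have closed: "closed {Q::real^'n^'n. orthogonal_matrix Q}"
    unfolding orthogonal_matrix by (intro closed_Collect_eq continuous_intros)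
  interpret M: prob_space "distr \<mu> borel (\<lambda>Q. Q)"
    by (rule \<mu>.prob_space_distr[OF id(1)])
  show ?thesis
  proof
    show "AE Q in distr \<mu> borel (\<lambda>Q. Q). orthogonal_matrix Q"
      using closed id by (subst AE_distr_iff) (auto simp: orthogonal_group_def)
    fix U :: "real^'n^'n" assume U: "orthogonal_matrix U"
    have "(\<lambda>Q. U ** Q) \<in> restrict_space borel orthogonal_group \<rightarrow>\<^sub>M restrict_space borel orthogonal_group"
      by (intro measurable_restrict_space3) (auto simp: orthogonal_group_def orthogonal_matrix_mul U)
    then have mU: "(\<lambda>Q. U ** Q) \<in> \<mu> \<rightarrow>\<^sub>M \<mu>"
      by (simp add: measurable_cong_sets[OF s s])
    have "distr \<mu> borel (\<lambda>Q. Q) = distr (distr \<mu> \<mu> (\<lambda>Q. U ** Q)) borel (\<lambda>Q. Q)"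
      using haar U by (simp add: haar_prob_orthogonal_def orthogonal_group_def)
    also have "\<dots> = distr \<mu> borel (\<lambda>Q. U ** Q)"
      by (subst distr_distr[OF id(1) mU]) (simp add: comp_def)
    also have "\<dots> = distr (distr \<mu> borel (\<lambda>Q. Q)) borel (\<lambda>Q. U ** Q)"
      using id(1) by (subst distr_distr) (auto simp: comp_def)
    finally show "distr (distr \<mu> borel (\<lambda>Q. Q)) borel (\<lambda>Q. U ** Q) = distr \<mu> borel (\<lambda>Q. Q)" ..
  qed simp
qed

lemma kinematic_polar_cones:
  fixes \<mu> :: "(real^'n^'n) measure" and H K :: "(real^'n) set"
  assumes haar: "haar_prob_orthogonal \<mu>" and H: "finite H" and K: "finite K"
  shows "integrable \<mu> (\<lambda>Q. intrinsic_volume k (polar_cone H \<inter> (*v) Q ` polar_cone K))"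
    and "k > 0 \<Longrightarrow> (\<integral>Q. intrinsic_volume k (polar_cone H \<inter> (*v) Q ` polar_cone K) \<partial>\<mu>) =
      intrinsic_volume (k + CARD('n)) (polar_cone H \<times> polar_cone K)"
    and "(\<integral>Q. intrinsic_volume 0 (polar_cone H \<inter> (*v) Q ` polar_cone K) \<partial>\<mu>) =
      (\<Sum>j=0..CARD('n). intrinsic_volume j (polar_cone H \<times> polar_cone K))"
proof -
  note id = haar_prob_orthogonal_measurable_id[OF haar]
  interpret M: haar_orthogonal "distr \<mu> borel (\<lambda>Q. Q)" by (rule haar_orthogonal_distr[OF haar])
  have eq: "intrinsic_volume k (polar_cone H \<inter> (*v) Q ` polar_cone K) = section_volume k H K Q"
    if "Q \<in> space \<mu>" for Q k
    using that id(2) by (intro intrinsic_volume_Int_rotated H K) (simp add: orthogonal_group_def)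
  have meas: "section_volume k H K \<in> borel_measurable borel" for k
    by (rule measurable_section_volume[OF H K])
  have int: "(\<integral>Q. intrinsic_volume k (polar_cone H \<inter> (*v) Q ` polar_cone K) \<partial>\<mu>) =
      (\<integral>Q. section_volume k H K Q \<partial>distr \<mu> borel (\<lambda>Q. Q))" for k
    by (subst integral_distr[OF id(1) meas]) (intro Bochner_Integration.integral_cong refl eq)
  show "integrable \<mu> (\<lambda>Q. intrinsic_volume k (polar_cone H \<inter> (*v) Q ` polar_cone K))"
    using M.integrable_section_volume[OF H K, of k]
    unfolding integrable_distr_eq[OF id(1) meas]
    by (rule Bochner_Integration.integrable_cong[THEN iffD1, rotated -1]) (simp_all add: eq)
  show "(\<integral>Q. intrinsic_volume k (polar_cone H \<inter> (*v) Q ` polar_cone K) \<partial>\<mu>) =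
      intrinsic_volume (k + CARD('n)) (polar_cone H \<times> polar_cone K)" if "k > 0"
    unfolding int by (rule M.integral_section_volume_pos[OF H K that])
  show "(\<integral>Q. intrinsic_volume 0 (polar_cone H \<inter> (*v) Q ` polar_cone K) \<partial>\<mu>) =
      (\<Sum>j=0..CARD('n). intrinsic_volume j (polar_cone H \<times> polar_cone K))"
    unfolding int by (rule M.integral_section_volume_0[OF H K])
qed

theorem theorem5p1:
  fixes C :: "(real^'n) set" and \<mu> :: "(real^'n^'n) measure"
  assumes "polyhedral_cone C" and "haar_prob_orthogonal \<mu>"
  shows
    "(\<forall>D :: (real^'n) set. polyhedral_cone D \<longrightarrow>
        (\<forall>k. integrable \<mu> (\<lambda>Q. intrinsic_volume k (C \<inter> (*v) Q ` D))) \<and>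
        (\<forall>k>0. (\<integral>Q. intrinsic_volume k (C \<inter> (*v) Q ` D) \<partial>\<mu>)
                 = intrinsic_volume (k + CARD('n)) (C \<times> D)) \<and>
        (\<integral>Q. intrinsic_volume 0 (C \<inter> (*v) Q ` D) \<partial>\<mu>)
          = (\<Sum>j=0..CARD('n). intrinsic_volume j (C \<times> D))) \<and>
     (\<forall>(L :: (real^'n) set) m. subspace L \<and> dim L + m = CARD('n) \<longrightarrow>
        (\<forall>k. integrable \<mu> (\<lambda>Q. intrinsic_volume k (C \<inter> (*v) Q ` L))) \<and>
        (\<forall>k>0. (\<integral>Q. intrinsic_volume k (C \<inter> (*v) Q ` L) \<partial>\<mu>)
                 = intrinsic_volume (k + m) C) \<and>
        (\<integral>Q. intrinsic_volume 0 (C \<inter> (*v) Q ` L) \<partial>\<mu>)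
          = (\<Sum>j=0..m. intrinsic_volume j C))"
proof (intro conjI allI impI; (elim conjE)?)
  obtain H where H: "finite H" "C = polar_cone H"
    using polyhedral_cone_imp_polar_cone[OF assms(1)] .
  note kin = kinematic_polar_cones[OF assms(2) H(1)]
  {
    fix D :: "(real^'n) set" and k :: nat
    assume "polyhedral_cone D"
    then obtain K where K: "finite K" "D = polar_cone K"
      by (rule polyhedral_cone_imp_polar_cone)
    show "integrable \<mu> (\<lambda>Q. intrinsic_volume k (C \<inter> (*v) Q ` D))"
      unfolding H K by (rule kin(1)[OF K(1)])
    show "(\<integral>Q. intrinsic_volume k (C \<inter> (*v) Q ` D) \<partial>\<mu>) = intrinsic_volume (k + CARD('n)) (C \<times> D)"
      if "0 < k"
      unfolding H K by (rule kin(2)[OF K(1) that])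
    show "(\<integral>Q. intrinsic_volume 0 (C \<inter> (*v) Q ` D) \<partial>\<mu>) = (\<Sum>j=0..CARD('n). intrinsic_volume j (C \<times> D))"
      unfolding H K by (rule kin(3)[OF K(1)])
  }
  fix L :: "(real^'n) set" and m k :: nat
  assume L: "subspace L" "dim L + m = CARD('n)"
  obtain K where K: "finite K" "L = polar_cone K"
    using subspace_eq_polar_cone[OF L(1)] by metis
  \<comment> \<open>Taking \<open>D = L\<close> shifts the indices of the product by
    \<open>dim L = d - m\<close>, which turns \<open>k + d\<close> into
    \<open>k + m\<close>.\<close>
  have vol: "intrinsic_volume j (C \<times> L) = (if dim L \<le> j then intrinsic_volume (j - dim L) C else 0)" for j
    unfolding H(2) by (rule intrinsic_volume_Times_subspace[OF H(1) L(1)])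
  show "integrable \<mu> (\<lambda>Q. intrinsic_volume k (C \<inter> (*v) Q ` L))"
    unfolding H K by (rule kin(1)[OF K(1)])
  show "(\<integral>Q. intrinsic_volume k (C \<inter> (*v) Q ` L) \<partial>\<mu>) = intrinsic_volume (k + m) C" if "0 < k"
  proof -
    have "(\<integral>Q. intrinsic_volume k (C \<inter> (*v) Q ` L) \<partial>\<mu>) = intrinsic_volume (k + CARD('n)) (C \<times> L)"
      unfolding H K by (rule kin(2)[OF K(1) that])
    then show ?thesis unfolding vol L(2)[symmetric] by (simp add: algebra_simps)
  qed
  have "(\<integral>Q. intrinsic_volume 0 (C \<inter> (*v) Q ` L) \<partial>\<mu>) = (\<Sum>j=0..CARD('n). intrinsic_volume j (C \<times> L))"
    unfolding H K by (rule kin(3)[OF K(1)])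
  \<comment> \<open>Indices below \<open>dim L\<close> contribute \<open>0\<close>, which leaves
    \<open>m + 1\<close> terms.\<close>
  also have "\<dots> = (\<Sum>j=dim L..dim L + m. intrinsic_volume j (C \<times> L))"
    unfolding L(2)[symmetric] by (intro sum.mono_neutral_right) (auto simp: vol)
  also have "\<dots> = (\<Sum>j=0..m. intrinsic_volume (j + dim L) (C \<times> L))"
    using sum.shift_bounds_cl_nat_ivl[of "\<lambda>j. intrinsic_volume j (C \<times> L)" 0 "dim L" m]
    by (simp add: add.commute)
  also have "\<dots> = (\<Sum>j=0..m. intrinsic_volume j C)"
    by (simp add: vol)
  finally show "(\<integral>Q. intrinsic_volume 0 (C \<inter> (*v) Q ` L) \<partial>\<mu>) = (\<Sum>j=0..m. intrinsic_volume j C)" .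
qed

end
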